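(* Assume that $a_i\in A_{p_i}$ for every $i\in I_N$. Then, for every function $v\in W^{1,1}_{\mathrm{loc}}(\Omega)$ and any pair of balls $B\Subset\widetilde B\Subset\Omega$ satisfying $\mathbb F(v,\widetilde B)<\infty$, there exists a sequence $(v_m)_{m\ge1}\subset W^{1,\infty}(B)$ such that $$v_m\to v\ \text{ strongly in }W^{1,p}(B)\quad\text{and}\quad\mathbb F(v_m,B)\to\mathbb F(v,B)\quad\text{as }m\to\infty.$$
   Context: Let $n\ge2$, $\Omega\subset\mathbb R^n$ a bounded open set, $N\ge1$, $I_N=\{1,\dots,N\}$, and $1<p\le p_1\le\dots\le p_N<\infty$. For $\gamma>1$, a non-negative $\omega\in L^1_{\mathrm{loc}}(\mathbb R^n)$ belongs to the Muckenhoupt class $A_\gamma$ if $[\omega]_{A_\gamma}:=\sup_B\left(\fint_B\omega\,dx\right)\left(\fint_B\omega^{-\frac1{\gamma-1}}dx\right)^{\gamma-1}<\infty$, the supremum being over all balls $B\subset\mathbb R^n$ (here $\fint_E f=\frac1{|E|}\int_E f$). The coefficients are functions $a_i:\mathbb R^n\to[0,\infty)$. Set $\mathcal H(x,t)=t^p+\sum_{i=1}^N a_i(x)t^{p_i}$ for $t\ge0$, and for measurable $S\subset\Omega$ set $\mathbb F(v,S)=\int_S\mathcal H(x,|\nabla v|)\,dx$. *)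

theory Defs
  imports "HOL-Analysis.Analysis"
begin

definition compactly_inside :: "'a::topological_space set \<Rightarrow> 'a set \<Rightarrow> bool"
    (infix "\<Subset>" 50) where
  "A \<Subset> U \<longleftrightarrow> compact (closure A) \<and> closure A \<subseteq> U"

section \<open>Lebesgue spaces\<close>

definition L1_loc :: "'a::euclidean_space set \<Rightarrow> ('a \<Rightarrow> 'b::euclidean_space) set" where
  "L1_loc U = {f. \<forall>K. compact K \<and> K \<subseteq> U \<longrightarrow> f absolutely_integrable_on K}"

definition Lp :: "real \<Rightarrow> 'a::euclidean_space set \<Rightarrow> ('a \<Rightarrow> 'b::euclidean_space) set" where
  "Lp p U = {f \<in> borel_measurable (lebesgue_on U).
     integrable (lebesgue_on U) (\<lambda>x. norm (f x) powr p)}"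

definition Linf :: "'a::euclidean_space set \<Rightarrow> ('a \<Rightarrow> 'b::euclidean_space) set" where
  "Linf U = {f \<in> borel_measurable (lebesgue_on U).
     \<exists>C. AE x in lebesgue_on U. norm (f x) \<le> C}"

section \<open>Weak gradients and Sobolev spaces\<close>

text \<open>Requiring differentiability at each step, not just continuous partial derivatives,
  is no restriction and makes \<^const>\<open>frechet_derivative\<close> meaningful.\<close>

primrec C_k :: "nat \<Rightarrow> ('a::euclidean_space \<Rightarrow> real) set" where
  "C_k 0 = {f. continuous_on UNIV f}"
| "C_k (Suc k) = {f. f differentiable_on UNIV \<and>
     (\<forall>b\<in>Basis. (\<lambda>x. frechet_derivative f (at x) b) \<in> C_k k)}"

definition test_functions :: "'a::euclidean_space set \<Rightarrow> ('a \<Rightarrow> real) set" where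
  "test_functions U = {\<phi>. (\<forall>k. \<phi> \<in> C_k k) \<and> {x. \<phi> x \<noteq> 0} \<Subset> U}"

definition has_weak_gradient ::
    "'a::euclidean_space set \<Rightarrow> ('a \<Rightarrow> real) \<Rightarrow> ('a \<Rightarrow> 'a) \<Rightarrow> bool" where
  "has_weak_gradient U v g \<longleftrightarrow> v \<in> L1_loc U \<and> g \<in> L1_loc U \<and>
     (\<forall>\<phi>\<in>test_functions U. \<forall>b\<in>Basis.
        (\<integral>x. v x * frechet_derivative \<phi> (at x) b \<partial>lebesgue_on U) =
        - (\<integral>x. (g x \<bullet> b) * \<phi> x \<partial>lebesgue_on U))"

text \<open>The weak gradient is unique only up to null sets, so this is an arbitrary
  representative, and it is unspecified if \<open>v\<close> has no weak gradient on \<open>U\<close>.\<close>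

definition weak_gradient ::
    "'a::euclidean_space set \<Rightarrow> ('a \<Rightarrow> real) \<Rightarrow> 'a \<Rightarrow> 'a" where
  "weak_gradient U v = (SOME g. has_weak_gradient U v g)"

definition W11_loc :: "'a::euclidean_space set \<Rightarrow> ('a \<Rightarrow> real) set" where
  "W11_loc U = {v. \<exists>g. has_weak_gradient U v g}"

definition W1p :: "real \<Rightarrow> 'a::euclidean_space set \<Rightarrow> ('a \<Rightarrow> real) set" where
  "W1p p U = {v \<in> W11_loc U. v \<in> Lp p U \<and> weak_gradient U v \<in> Lp p U}"

definition W1inf :: "'a::euclidean_space set \<Rightarrow> ('a \<Rightarrow> real) set" where
  "W1inf U = {v \<in> W11_loc U. v \<in> Linf U \<and> weak_gradient U v \<in> Linf U}"

definition W1p_norm :: "real \<Rightarrow> 'a::euclidean_space set \<Rightarrow> ('a \<Rightarrow> real) \<Rightarrow> real" where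
  "W1p_norm p U v =
     ((\<integral>x. \<bar>v x\<bar> powr p \<partial>lebesgue_on U)
      + (\<integral>x. norm (weak_gradient U v x) powr p \<partial>lebesgue_on U)) powr (1 / p)"

text \<open>Membership is part of convergence: the integrals in \<^const>\<open>W1p_norm\<close> are 0 by
  convention when they diverge.\<close>

definition converges_W1p ::
    "real \<Rightarrow> 'a::euclidean_space set \<Rightarrow> (nat \<Rightarrow> 'a \<Rightarrow> real) \<Rightarrow> ('a \<Rightarrow> real) \<Rightarrow> bool" where
  "converges_W1p p U w v \<longleftrightarrow> (\<forall>m. w m \<in> W1p p U) \<and> v \<in> W1p p U \<and>
     (\<lambda>m. W1p_norm p U (\<lambda>x. w m x - v x)) \<longlonglongrightarrow> 0"

section \<open>Muckenhoupt weights\<close>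

definition mean :: "'a::euclidean_space set \<Rightarrow> ('a \<Rightarrow> ennreal) \<Rightarrow> ennreal" where
  "mean E f = (\<integral>\<^sup>+x. f x \<partial>lebesgue_on E) / emeasure lebesgue E"

text \<open>Meant for exponents \<open>r > 0\<close> only.\<close>

definition ennreal_powr :: "ennreal \<Rightarrow> real \<Rightarrow> ennreal" where
  "ennreal_powr x r = (if x = \<infinity> then \<infinity> else ennreal (enn2real x powr r))"

text \<open>The negative power is the \<^typ>\<open>ennreal\<close> inverse of a positive power, so that it is
  \<open>\<infinity>\<close> where \<open>\<omega>\<close> vanishes; the real expression \<open>0 powr s\<close> would be 0. With
  \<open>0 \<cdot> \<infinity> = 0\<close>, a weight that vanishes almost everywhere has constant 0; a weight that
  vanishes on a set of positive measure, but not almost everywhere, has constant \<open>\<infinity>\<close>.\<close>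

definition muckenhoupt_const :: "real \<Rightarrow> ('a::euclidean_space \<Rightarrow> real) \<Rightarrow> ennreal" where
  "muckenhoupt_const \<gamma> \<omega> =
     (SUP (z, r) \<in> UNIV \<times> {0<..}.
        mean (ball z r) (\<lambda>x. ennreal (\<omega> x)) *
        ennreal_powr
          (mean (ball z r) (\<lambda>x. inverse (ennreal (\<omega> x powr (1 / (\<gamma> - 1)))))) (\<gamma> - 1))"

definition muckenhoupt :: "real \<Rightarrow> ('a::euclidean_space \<Rightarrow> real) set" where
  "muckenhoupt \<gamma> =
     {\<omega> \<in> L1_loc UNIV. (\<forall>x. 0 \<le> \<omega> x) \<and> muckenhoupt_const \<gamma> \<omega> < \<infinity>}"

section \<open>The multi-phase functional\<close>

definition multi_phase :: "nat \<Rightarrow> real \<Rightarrow> (nat \<Rightarrow> real) \<Rightarrow> (nat \<Rightarrow> 'a \<Rightarrow> real) \<Rightarrow>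
    'a \<Rightarrow> real \<Rightarrow> real" where
  "multi_phase N p q a x t = t powr p + (\<Sum>i=1..N. a i x * t powr q i)"

text \<open>The set \<open>U\<close> is the domain on which \<open>v\<close> is considered as a Sobolev function, and
  \<open>S \<subseteq> U\<close> is the set over which the energy is taken.\<close>

definition energy :: "nat \<Rightarrow> real \<Rightarrow> (nat \<Rightarrow> real) \<Rightarrow> (nat \<Rightarrow> 'a \<Rightarrow> real) \<Rightarrow>
    'a::euclidean_space set \<Rightarrow> ('a \<Rightarrow> real) \<Rightarrow> 'a set \<Rightarrow> ennreal" where
  "energy N p q a U v S =
     (\<integral>\<^sup>+x. ennreal (multi_phase N p q a x (norm (weak_gradient U v x))) \<partial>lebesgue_on S)"

end

theory Submission
  imports Defs
begin

text \<open>
  No smooth mollifier is needed: let \<open>w\<^sub>\<epsilon>(x)\<close> be the average of \<open>v\<close> over the cube \<open>x + [0, \<epsilon>]\<^sup>n\<close>.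
  Translating test functions shows that the weak gradient of \<open>w\<^sub>\<epsilon>\<close> is the average of \<open>\<nabla>v\<close>, so both
  are bounded, and \<open>\<nabla>w\<^sub>\<epsilon> \<rightarrow> \<nabla>v\<close> almost everywhere by Lebesgue differentiation. The \<open>A\<^sub>\<gamma>\<close> condition
  and Hoelder's inequality bound \<open>(mean of F over B)\<^sup>\<gamma> \<omega>(B)\<close> by the \<open>\<omega>\<close>-weighted integral of \<open>F\<^sup>\<gamma>\<close> over
  \<open>B\<close>; integrating over the centre of \<open>B\<close>, the averages are bounded on \<open>L\<^sup>\<gamma>(\<omega>)\<close> uniformly in \<open>\<epsilon>\<close>, without
  the maximal theorem. Splitting \<open>\<nabla>v\<close> at height \<open>k\<close> then gives a dominated part and a uniformly small
  part, hence convergence of every phase of the energy. Finally \<open>v(x + h) - v(x)\<close> is the integral of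
  \<open>\<nabla>v(x + t h) \<cdot> h\<close> over \<open>t \<in> [0, 1]\<close>, so \<open>w\<^sub>\<epsilon> - v\<close> has \<open>L\<^sup>p\<close> norm at most \<open>n \<epsilon>\<close> times that of \<open>\<nabla>v\<close>.
  Since \<^const>\<open>weak_gradient\<close> is an arbitrary representative, uniqueness of weak gradients is needed
  as well; it rests on the test functions built from \<open>exp (- 1 / t)\<close>.
\<close>

section \<open>Smooth test functions\<close>

text \<open>Almost everywhere convergence of the averaged gradients is not enough: a common majorant
  for their \<gamma>-th powers would be a maximal function. A bound uniform in \<epsilon> replaces
  it, and splitting by height turns that bound into convergence; the bounded part is dominated
  because a weight has finite mass on a ball. The analysis is done with Borel functions on the whole
  space. Let W be the larger ball: v and its gradient are cut off to W and replaced by Borel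
  versions V and G. Then Fubini over products with \<open>lborel\<close> and translation invariance
  apply, and the finite energy on W becomes finite integrals over the whole space. The cut-off may
  destroy weak differentiability across the boundary of W, so identities are tested only inside W,
  and \<epsilon> is kept small against the gap between the two balls. The cubes have x as a corner,
  not as the centre, because the differentiation theorem
  \<open>integrable_ccontinuous_explicit\<close> has this form. The phase t^p is handled like the
  others, with weight 1, where Jensen's inequality gives the bound with constant 1.\<close>

lemma C_k_const: "(\<lambda>x. c) \<in> C_k k"
  by (induction k arbitrary: c) (auto simp: frechet_derivative_const)

text \<open>Trades \<open>frechet_derivative\<close> for any derivative at hand, so that the
  inductions below can use the usual rules of differentiation.\<close>

lemma C_k_Suc_I:
  assumes "\<And>x. (f has_derivative f' x) (at x)" "\<And>b. b \<in> Basis \<Longrightarrow> (\<lambda>x. f' x b) \<in> C_k k"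
  shows "f \<in> C_k (Suc k)"
proof -
  have "frechet_derivative f (at x) = f' x" for x
    using frechet_derivative_at[OF assms(1)] by simp
  moreover have "f differentiable_on UNIV"
    using assms(1) by (auto simp: differentiable_on_def differentiable_def)
  ultimately show ?thesis using assms(2) by simp
qed

lemma C_k_Suc_E:
  assumes "f \<in> C_k (Suc k)"
  shows "(f has_derivative frechet_derivative f (at x)) (at x)"
    and "b \<in> Basis \<Longrightarrow> (\<lambda>x. frechet_derivative f (at x) b) \<in> C_k k"
  using assms by (simp_all add: differentiable_on_def flip: frechet_derivative_works)

lemma C_k_add:
  assumes "f \<in> C_k k" "g \<in> C_k k"
  shows "(\<lambda>x. f x + g x) \<in> C_k k"
  using assms
proof (induction k arbitrary: f g)
  case 0
  then show ?case by (simp add: continuous_on_add)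
next
  case (Suc k)
  show ?case
    by (rule C_k_Suc_I[OF has_derivative_add[OF C_k_Suc_E(1)[OF Suc.prems(1)] C_k_Suc_E(1)[OF Suc.prems(2)]]])
       (intro Suc.IH C_k_Suc_E(2)[OF Suc.prems(1)] C_k_Suc_E(2)[OF Suc.prems(2)])
qed

lemma C_k_Suc_D: "f \<in> C_k (Suc k) \<Longrightarrow> f \<in> C_k k"
proof (induction k arbitrary: f)
  case 0
  then have "f differentiable_on UNIV" by simp
  then show ?case by (simp add: differentiable_imp_continuous_on)
next
  case (Suc k)
  show ?case
    by (rule C_k_Suc_I[OF C_k_Suc_E(1)[OF Suc.prems]]) (rule Suc.IH[OF C_k_Suc_E(2)[OF Suc.prems]])
qed

text \<open>The product rule leaves one factor of each term undifferentiated; the induction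
  hypothesis needs that factor one order lower, which \<open>C_k_Suc_D\<close> supplies.\<close>

lemma C_k_mult:
  assumes "f \<in> C_k k" "g \<in> C_k k"
  shows "(\<lambda>x. f x * g x) \<in> C_k k"
  using assms
proof (induction k arbitrary: f g)
  case 0
  then show ?case by (simp add: continuous_on_mult)
next
  case (Suc k)
  show ?case
    by (rule C_k_Suc_I[OF has_derivative_mult[OF C_k_Suc_E(1)[OF Suc.prems(1)] C_k_Suc_E(1)[OF Suc.prems(2)]]])
       (intro C_k_add Suc.IH C_k_Suc_E(2)[OF Suc.prems(1)] C_k_Suc_E(2)[OF Suc.prems(2)]
          C_k_Suc_D[OF Suc.prems(1)] C_k_Suc_D[OF Suc.prems(2)])
qed

lemma C_k_prod:
  assumes "finite I" "\<And>i. i \<in> I \<Longrightarrow> f i \<in> C_k k"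
  shows "(\<lambda>x. \<Prod>i\<in>I. f i x) \<in> C_k k"
  using assms by (induction I rule: finite_induct) (auto intro: C_k_const C_k_mult)

lemma frechet_derivative_shift:
  fixes f :: "'a::real_normed_vector \<Rightarrow> 'b::real_normed_vector"
  assumes "f differentiable (at (x + h))"
  shows "((\<lambda>y. f (y + h)) has_derivative frechet_derivative f (at (x + h))) (at x)"
    and "frechet_derivative (\<lambda>y. f (y + h)) (at x) = frechet_derivative f (at (x + h))"
proof -
  have f: "(f has_derivative frechet_derivative f (at (x + h))) (at (x + h))"
    using assms by (simp add: frechet_derivative_works)
  have "((\<lambda>y. y + h) has_derivative (\<lambda>y. y)) (at x)"
    by (auto intro!: derivative_eq_intros)
  from has_derivative_compose[OF this f]
  show 1: "((\<lambda>y. f (y + h)) has_derivative frechet_derivative f (at (x + h))) (at x)" .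
  show "frechet_derivative (\<lambda>y. f (y + h)) (at x) = frechet_derivative f (at (x + h))"
    using frechet_derivative_at[OF 1] by simp
qed

lemma C_k_shift: "f \<in> C_k k \<Longrightarrow> (\<lambda>x. f (x + h)) \<in> C_k k"
proof (induction k arbitrary: f)
  case 0
  then have "continuous_on UNIV f" by simp
  then have "continuous_on UNIV (\<lambda>x. f (x + h))"
    by (rule continuous_on_compose2) (auto intro: continuous_intros)
  then show ?case by simp
next
  case (Suc k)
  have "f differentiable (at x)" for x
    using C_k_Suc_E(1)[OF Suc.prems] by (auto simp: differentiable_def)
  then show ?case
    by (intro C_k_Suc_I[OF frechet_derivative_shift(1)] Suc.IH C_k_Suc_E(2)[OF Suc.prems])
qed

text \<open>The functions P(1/t) exp(-1/t), continued by 0 to t \<le> 0. Admitting every polynomial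
  P makes the family closed under differentiation, so that smoothness is a single induction;
  \<open>flat 1\<close> is the classical smooth function that is not analytic at 0.\<close>

definition flat :: "real poly \<Rightarrow> real \<Rightarrow> real" where
  "flat P t = (if t \<le> 0 then 0 else poly P (1 / t) * exp (- (1 / t)))"

lemma poly_times_exp_minus_tendsto_0:
  fixes P :: "real poly"
  shows "((\<lambda>s. poly P s * exp (- s)) \<longlongrightarrow> 0) at_top"
proof -
  have "((\<lambda>s. \<Sum>i\<le>degree P. coeff P i * (s ^ i / exp s)) \<longlongrightarrow> (\<Sum>i\<le>degree P. coeff P i * 0)) at_top"
    by (intro tendsto_intros tendsto_power_div_exp_0)
  then show ?thesis
    by (simp add: poly_altdef exp_minus sum_distrib_right divide_inverse mult.assoc)
qed

lemma flat_tendsto_0: "(flat P \<longlongrightarrow> 0) (at 0)"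
proof -
  have "((\<lambda>t. poly P (inverse t) * exp (- inverse t)) \<longlongrightarrow> 0) (at_right 0)"
    by (rule filterlim_compose[OF poly_times_exp_minus_tendsto_0 filterlim_inverse_at_top_right])
  then have "(flat P \<longlongrightarrow> 0) (at_right 0)"
    by (rule Lim_transform_eventually)
       (auto simp: flat_def eventually_at_filter inverse_eq_divide)
  moreover have "(flat P \<longlongrightarrow> 0) (at_left 0)"
    by (rule tendsto_eventually) (auto simp: flat_def eventually_at_filter)
  ultimately show ?thesis by (simp add: filterlim_split_at)
qed

text \<open>With s = 1/t one has ds/dt = -s^2, so P(s) exp(-s) has derivative s^2 (P(s) - P'(s))
  exp(-s); \<open>[:0, 0, 1:]\<close> is the polynomial s^2.\<close>

lemma flat_has_derivative:
  "(flat P has_real_derivative flat ([:0, 0, 1:] * (P - pderiv P)) t) (at t)"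
proof -
  consider "t < 0" | "t = 0" | "t > 0" by linarith
  then show ?thesis
  proof cases
    case 1
    have "((\<lambda>_. 0) has_real_derivative 0) (at t)" by simp
    then have "(flat P has_real_derivative 0) (at t)"
      by (rule DERIV_cong_ev[THEN iffD1, rotated 3])
         (use 1 in \<open>auto simp: flat_def intro!: eventually_mono[OF eventually_nhds_in_open[of "{..<0}"]]\<close>)
    then show ?thesis using 1 by (simp add: flat_def)
  next
    case 2
    \<comment> \<open>The difference quotient at 0 is again in the family: dividing by h multiplies
      P by its variable, and \<open>pCons 0 P\<close> is that product.\<close>
    have "((\<lambda>h. (flat P (0 + h) - flat P 0) / h) \<longlongrightarrow> 0) (at 0)"
      by (rule Lim_transform_eventually[OF flat_tendsto_0[of "pCons 0 P"]])
         (auto simp: flat_def eventually_at_filter)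
    then show ?thesis using 2 by (simp add: DERIV_def flat_def)
  next
    case 3
    have "((\<lambda>t. poly P (1 / t) * exp (- (1 / t))) has_real_derivative
        flat ([:0, 0, 1:] * (P - pderiv P)) t) (at t)"
    proof -
      have "((\<lambda>t. poly P (1 / t) * exp (- (1 / t))) has_real_derivative
          (poly (pderiv P) (1 / t) * (- 1 / t\<^sup>2)) * exp (- (1 / t)) + poly P (1 / t) * (exp (- (1 / t)) * (1 / t\<^sup>2))) (at t)"
        using 3
        by (auto intro!: derivative_eq_intros DERIV_chain2[OF poly_DERIV] simp: power2_eq_square)
      then show ?thesis
        by (rule DERIV_cong) (use 3 in \<open>simp add: flat_def field_simps power2_eq_square\<close>)
    qed
    then show ?thesis
      by (rule DERIV_cong_ev[THEN iffD1, rotated 3])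
         (use 3 in \<open>auto simp: flat_def intro!: eventually_mono[OF eventually_nhds_in_open[of "{0<..}"]]\<close>)
  qed
qed

lemma C_k_flat: "(\<lambda>x. flat P (c + d * (x \<bullet> b))) \<in> C_k k"
proof (induction k arbitrary: P)
  case 0
  have "continuous_on UNIV (flat P)"
    using DERIV_isCont[OF flat_has_derivative] continuous_at_imp_continuous_on by blast
  then have "continuous_on UNIV (\<lambda>x. flat P (c + d * (x \<bullet> b)))"
    by (rule continuous_on_compose2) (auto intro!: continuous_intros)
  then show ?case by simp
next
  case (Suc k)
  let ?Q = "[:0, 0, 1:] * (P - pderiv P)"
  have D: "((\<lambda>x. flat P (c + d * (x \<bullet> b))) has_derivative
      (\<lambda>e. flat ?Q (c + d * (x \<bullet> b)) * (d * (e \<bullet> b)))) (at x)" for x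
  proof -
    have "((\<lambda>x. c + d * (x \<bullet> b)) has_derivative (\<lambda>e. d * (e \<bullet> b))) (at x)"
      by (auto intro!: derivative_eq_intros)
    from has_derivative_compose[OF this
        flat_has_derivative[of P "c + d * (x \<bullet> b)", unfolded has_field_derivative_def]]
    show ?thesis .
  qed
  show ?case by (rule C_k_Suc_I[OF D]) (intro C_k_mult C_k_const Suc.IH)
qed

text \<open>As j grows, each factor with positive argument tends to 1, while the others are 0. The
  bumps thus tend to the indicator of the open box and are non-zero exactly on it for every j, so a
  box can be tested without mollifying its indicator.\<close>

definition box_bump :: "'a::euclidean_space \<Rightarrow> 'a \<Rightarrow> nat \<Rightarrow> 'a \<Rightarrow> real" where
  "box_bump l u j x =
     (\<Prod>b\<in>Basis. flat 1 (real (Suc j) * ((x - l) \<bullet> b)) * flat 1 (real (Suc j) * ((u - x) \<bullet> b)))"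

lemma box_bump_C_k: "box_bump l u j \<in> C_k k"
proof -
  have "(\<lambda>x. flat 1 (real (Suc j) * ((x - l) \<bullet> b))) \<in> C_k k" for b
    using C_k_flat[of 1 "- (real (Suc j) * (l \<bullet> b))" "real (Suc j)" b k]
    by (simp add: inner_diff_left right_diff_distrib)
  moreover have "(\<lambda>x. flat 1 (real (Suc j) * ((u - x) \<bullet> b))) \<in> C_k k" for b
    using C_k_flat[of 1 "real (Suc j) * (u \<bullet> b)" "- real (Suc j)" b k]
    by (simp add: inner_diff_left right_diff_distrib del: of_nat_Suc)
  ultimately show ?thesis
    unfolding box_bump_def[abs_def] by (intro C_k_prod C_k_mult) auto
qed

lemma flat_1_bounds: "0 \<le> flat 1 t" "flat 1 t \<le> 1"
  by (auto simp: flat_def)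

lemma box_bump_bounds: "0 \<le> box_bump l u j x" "box_bump l u j x \<le> 1"
  unfolding box_bump_def
  by (auto intro!: prod_nonneg prod_le_1 mult_nonneg_nonneg mult_le_one flat_1_bounds)

lemma box_bump_nonzero_iff: "box_bump l u j x \<noteq> 0 \<longleftrightarrow> x \<in> box l u"
  by (auto simp: box_bump_def flat_def mem_box inner_diff_left zero_less_mult_iff not_le)

lemma flat_1_scaled_tendsto: "t > 0 \<Longrightarrow> (\<lambda>j. flat 1 (real (Suc j) * t)) \<longlonglongrightarrow> 1"
proof -
  assume t: "t > 0"
  have "(\<lambda>j. exp (- (inverse (real (Suc j)) / t))) \<longlonglongrightarrow> exp (- (0 / t))"
    by (intro tendsto_intros LIMSEQ_inverse_real_of_nat) (use t in auto)
  moreover have "flat 1 (real (Suc j) * t) = exp (- (inverse (real (Suc j)) / t))" for j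
  proof -
    have "\<not> real (Suc j) * t \<le> 0" using t by (simp add: not_le)
    then show ?thesis by (simp add: flat_def divide_inverse del: of_nat_Suc)
  qed
  ultimately show ?thesis by simp
qed

lemma box_bump_tendsto: "(\<lambda>j. box_bump l u j x) \<longlonglongrightarrow> indicator (box l u) x"
proof (cases "x \<in> box l u")
  case True
  have "(\<lambda>j. box_bump l u j x) \<longlonglongrightarrow> (\<Prod>b\<in>(Basis::'a set). 1 * 1)"
    unfolding box_bump_def
    by (intro tendsto_prod tendsto_mult flat_1_scaled_tendsto) (use True in \<open>auto simp: mem_box inner_diff_left\<close>)
  then show ?thesis using True by simp
next
  case False
  then show ?thesis using box_bump_nonzero_iff[of l u _ x] by simp
qed

lemma box_bump_test_function:
  assumes "cbox l u \<subseteq> U"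
  shows "box_bump l u j \<in> test_functions U"
proof -
  have "closure {x. box_bump l u j x \<noteq> 0} \<subseteq> cbox l u"
    unfolding box_bump_nonzero_iff by (intro closure_minimal) (simp_all add: box_subset_cbox closed_cbox)
  moreover from this have "compact (closure {x. box_bump l u j x \<noteq> 0})"
    by (meson bounded_cbox bounded_subset closed_closure compact_eq_bounded_closed)
  ultimately show ?thesis
    using assms by (auto simp: test_functions_def compactly_inside_def box_bump_C_k)
qed

section \<open>Supports, bounds and translates of test functions\<close>

lemma test_function_continuous: "\<phi> \<in> test_functions U \<Longrightarrow> continuous_on UNIV \<phi>"
  using C_k.simps(1) unfolding test_functions_def by blast

lemma test_function_differentiable: "\<phi> \<in> test_functions U \<Longrightarrow> \<phi> differentiable (at x)"
proof -
  assume "\<phi> \<in> test_functions U"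
  then have "\<phi> \<in> C_k (Suc 0)" unfolding test_functions_def by blast
  then show ?thesis by (auto simp: differentiable_on_def)
qed

lemma test_function_partial_continuous:
  assumes "\<phi> \<in> test_functions U" "b \<in> Basis"
  shows "continuous_on UNIV (\<lambda>x. frechet_derivative \<phi> (at x) b)"
proof -
  have "\<phi> \<in> C_k (Suc 0)" using assms unfolding test_functions_def by blast
  then show ?thesis using assms by auto
qed

definition support :: "('a::topological_space \<Rightarrow> real) \<Rightarrow> 'a set" where
  "support \<phi> = closure {x. \<phi> x \<noteq> 0}"

lemma test_function_support:
  assumes "\<phi> \<in> test_functions U"
  shows "compact (support \<phi>)" "support \<phi> \<subseteq> U"
  using assms by (auto simp: test_functions_def compactly_inside_def support_def)

lemma not_in_support:
  assumes "x \<notin> support \<phi>"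
  shows "\<phi> x = 0" "frechet_derivative \<phi> (at x) = (\<lambda>_. 0)"
proof -
  show "\<phi> x = 0" using assms closure_subset[of "{x. \<phi> x \<noteq> 0}"] by (auto simp: support_def)
  have "((\<lambda>_. 0) has_derivative (\<lambda>_. 0)) (at x)" by simp
  then have "(\<phi> has_derivative (\<lambda>_. 0)) (at x)"
  proof (rule has_derivative_transform_within_open)
    show "open (- support \<phi>)" unfolding support_def by (rule open_Compl) (rule closed_closure)
    show "x \<in> - support \<phi>" using assms by simp
    show "0 = \<phi> y" if "y \<in> - support \<phi>" for y
      using that closure_subset[of "{x. \<phi> x \<noteq> 0}"] by (auto simp: support_def)
  qed
  then show "frechet_derivative \<phi> (at x) = (\<lambda>_. 0)" using frechet_derivative_at by metis
qed

lemma continuous_compact_support_bounded: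
  fixes f :: "'a::euclidean_space \<Rightarrow> real"
  assumes "continuous_on UNIV f" "compact K" "\<And>x. x \<notin> K \<Longrightarrow> f x = 0"
  obtains C where "C \<ge> 0" "\<And>x. \<bar>f x\<bar> \<le> C"
proof -
  have "bounded (f ` K)"
    using assms by (meson compact_continuous_image compact_imp_bounded continuous_on_subset subset_UNIV)
  then obtain C where "C > 0" "\<And>x. x \<in> K \<Longrightarrow> \<bar>f x\<bar> \<le> C"
    by (auto simp: bounded_pos)
  then show ?thesis using assms(3) that[of C] by (metis abs_zero less_imp_le)
qed

lemma test_function_bounded:
  assumes "\<phi> \<in> test_functions U"
  obtains C where "C \<ge> 0" "\<And>x. \<bar>\<phi> x\<bar> \<le> C"
  using continuous_compact_support_bounded[OF test_function_continuous[OF assms]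
      test_function_support(1)[OF assms]] not_in_support by metis

lemma test_function_partial_bounded:
  assumes "\<phi> \<in> test_functions U" "b \<in> Basis"
  obtains C where "C \<ge> 0" "\<And>x. \<bar>frechet_derivative \<phi> (at x) b\<bar> \<le> C"
  using continuous_compact_support_bounded[OF test_function_partial_continuous[OF assms]
      test_function_support(1)[OF assms(1)]] not_in_support by metis

lemma test_function_shift:
  assumes "\<phi> \<in> test_functions U" "\<And>x. x \<in> U \<Longrightarrow> x - h \<in> W"
  shows "(\<lambda>x. \<phi> (x + h)) \<in> test_functions W"
proof -
  have "closure {x. \<phi> (x + h) \<noteq> 0} = (\<lambda>x. - h + x) ` closure {x. \<phi> x \<noteq> 0}"
  proof -
    have "{x. \<phi> (x + h) \<noteq> 0} = (\<lambda>x. - h + x) ` {x. \<phi> x \<noteq> 0}"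
      by (auto simp: image_iff) (metis add.commute add_diff_cancel_right' uminus_add_conv_diff)
    then show ?thesis by (simp only: closure_translation)
  qed
  moreover have "compact (closure {x. \<phi> x \<noteq> 0})" "closure {x. \<phi> x \<noteq> 0} \<subseteq> U" "\<phi> \<in> C_k k" for k
    using assms(1) by (auto simp: test_functions_def compactly_inside_def)
  moreover from this have "(\<lambda>x. - h + x) ` closure {x. \<phi> x \<noteq> 0} \<subseteq> W"
    using assms(2) by (auto simp: add.commute)
  ultimately show ?thesis
    unfolding test_functions_def compactly_inside_def
    by (auto simp only: mem_Collect_eq intro!: C_k_shift compact_translation)
qed

lemma test_functions_mono: "U \<subseteq> W \<Longrightarrow> test_functions U \<subseteq> test_functions W"
  by (auto simp: test_functions_def compactly_inside_def)

text \<open>Testing with the bumps of a box and passing to the limit shows that f has integral 0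
  over every box whose closure lies in U. Lebesgue differentiation along small cubes gives f = 0
  almost everywhere in such a box, and countably many of them cover U up to a null set.\<close>

lemma fundamental_lemma:
  fixes f :: "'a::euclidean_space \<Rightarrow> real"
  assumes "open U" "f \<in> L1_loc U"
    and "\<And>\<phi>. \<phi> \<in> test_functions U \<Longrightarrow> (\<integral>x. f x * \<phi> x \<partial>lebesgue_on U) = 0"
  shows "AE x in lebesgue_on U. f x = 0"
proof -
  have U: "U \<in> sets lebesgue" using assms(1) by (simp add: borel_open)
  have ind: "indicat_real (box l u) \<in> borel_measurable lebesgue"
    "indicat_real (cbox l u) \<in> borel_measurable lebesgue" for l u :: 'a
    by (intro measurable_completion, measurable)+
  have box0: "(\<integral>x. indicator (box l u) x * f x \<partial>lebesgue) = 0" if lu: "cbox l u \<subseteq> U" for l u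
  proof -
    have f: "f absolutely_integrable_on cbox l u"
      using assms(2) lu by (simp add: L1_loc_def)
    then have fi: "integrable lebesgue (\<lambda>x. indicator (cbox l u) x * f x)"
      by (simp add: set_integrable_def)
    \<comment> \<open>Local integrability speaks of compact sets, so the dominating function is |f|
      cut off to the closed box.\<close>
    have sub: "indicator (box l u) x * f x = indicator (box l u) x * (indicator (cbox l u) x * f x)" for x
      using box_subset_cbox[of l u] by (auto split: split_indicator)
    have "(\<lambda>j. \<integral>x. box_bump l u j x * (indicator (cbox l u) x * f x) \<partial>lebesgue)
        \<longlonglongrightarrow> (\<integral>x. indicator (box l u) x * (indicator (cbox l u) x * f x) \<partial>lebesgue)"
    proof (rule integral_dominated_convergence[where w = "\<lambda>x. norm (indicator (cbox l u) x * f x)"])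
      show "(\<lambda>x. box_bump l u j x * (indicator (cbox l u) x * f x)) \<in> borel_measurable lebesgue" for j
      proof -
        have "continuous_on UNIV (box_bump l u j)"
          using box_bump_C_k[of l u j 0] by simp
        then have "box_bump l u j \<in> borel_measurable lebesgue"
          by (simp add: borel_measurable_continuous_onI measurable_completion)
        then show ?thesis by (rule borel_measurable_times[OF _ borel_measurable_integrable[OF fi]])
      qed
      show "AE x in lebesgue. (\<lambda>j. box_bump l u j x * (indicator (cbox l u) x * f x))
          \<longlonglongrightarrow> indicator (box l u) x * (indicator (cbox l u) x * f x)"
        by (intro AE_I2 tendsto_mult box_bump_tendsto tendsto_const)
      show "AE x in lebesgue. norm (box_bump l u j x * (indicator (cbox l u) x * f x))
          \<le> norm (indicator (cbox l u) x * f x)" for j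
        using box_bump_bounds[of l u j] by (auto simp: abs_mult intro!: mult_left_le_one_le)
      show "(\<lambda>x. indicator (box l u) x * (indicator (cbox l u) x * f x)) \<in> borel_measurable lebesgue"
        by (rule borel_measurable_times[OF _ borel_measurable_integrable[OF fi]]) (simp add: ind)
      show "integrable lebesgue (\<lambda>x. norm (indicator (cbox l u) x * f x))"
        using fi by (rule integrable_norm)
    qed
    moreover have "(\<integral>x. box_bump l u j x * (indicator (cbox l u) x * f x) \<partial>lebesgue) = 0" for j
    proof -
      have "(\<integral>x. box_bump l u j x * (indicator (cbox l u) x * f x) \<partial>lebesgue)
          = (\<integral>x. indicator U x *\<^sub>R (f x * box_bump l u j x) \<partial>lebesgue)"
      proof (rule Bochner_Integration.integral_cong)
        fix x
        show "box_bump l u j x * (indicator (cbox l u) x * f x) = indicator U x *\<^sub>R (f x * box_bump l u j x)"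
          using box_bump_nonzero_iff[of l u j x] box_subset_cbox[of l u] lu
          by (cases "x \<in> box l u") (auto split: split_indicator)
      qed simp
      also have "\<dots> = (\<integral>x. f x * box_bump l u j x \<partial>lebesgue_on U)"
        using U by (simp add: integral_restrict_space)
      also have "\<dots> = 0" by (rule assms(3)[OF box_bump_test_function[OF lu]])
      finally show ?thesis .
    qed
    ultimately show ?thesis by (simp only: sub[symmetric] LIMSEQ_const_iff)
  qed
  have local_zero: "AE x in lebesgue. x \<in> box l u \<longrightarrow> f x = 0" if lu: "cbox l u \<subseteq> U" for l u
  proof -
    have f: "f absolutely_integrable_on cbox l u"
      using assms(2) lu by (simp add: L1_loc_def)
    then have fi: "set_integrable lebesgue (box l u) f"
      by (rule set_integrable_subset) (auto simp: box_subset_cbox)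
    define F where "F x = indicator (box l u) x *\<^sub>R f x" for x
    have Fi: "integrable lebesgue F" using fi by (simp add: set_integrable_def F_def[abs_def])
    have Fhk: "(F has_integral (\<integral>x. indicator (cbox c d) x * F x \<partial>lebesgue)) (cbox c d)" for c d
    proof -
      have "set_integrable lebesgue (cbox c d) F"
        unfolding set_integrable_def using Fi by (intro integrable_mult_indicator) auto
      from has_integral_set_lebesgue[OF this] show ?thesis
        by (simp add: set_lebesgue_integral_def)
    qed
    \<comment> \<open>The cut-off F is integrated over arbitrary cubes, also those that leave the
      box. The intersection of two boxes is the box with corners \<open>l'\<close> and
      \<open>u'\<close>, to which \<open>box0\<close> applies.\<close>
    have F0: "(\<integral>x. indicator (cbox c d) x * F x \<partial>lebesgue) = 0" for c d
    proof -
      define l' where "l' = (\<Sum>i\<in>Basis. max (l \<bullet> i) (c \<bullet> i) *\<^sub>R i)"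
      define u' where "u' = (\<Sum>i\<in>Basis. min (u \<bullet> i) (d \<bullet> i) *\<^sub>R i)"
      have eq: "box l u \<inter> box c d = box l' u'" "cbox l u \<inter> cbox c d = cbox l' u'"
        by (auto simp: mem_box l'_def u'_def)
      have null: "cbox c d - box c d \<in> null_sets lebesgue"
        using negligible_frontier_interval[of c d] negligible_iff_null_sets by blast
      have "(\<integral>x. indicator (cbox c d) x * F x \<partial>lebesgue) = (\<integral>x. indicator (box l' u') x * f x \<partial>lebesgue)"
      proof (rule integral_cong_AE)
        show "(\<lambda>x. indicator (cbox c d) x * F x) \<in> borel_measurable lebesgue"
          by (rule borel_measurable_times[OF _ borel_measurable_integrable[OF Fi]]) (simp add: ind)
        have "(\<lambda>x. indicator (box c d) x * F x) \<in> borel_measurable lebesgue"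
          by (rule borel_measurable_times[OF _ borel_measurable_integrable[OF Fi]]) (simp add: ind)
        moreover have "indicator (box c d) x * F x = indicator (box l' u') x * f x" for x
          using eq(1) by (auto simp: F_def split: split_indicator)
        ultimately show "(\<lambda>x. indicator (box l' u') x * f x) \<in> borel_measurable lebesgue" by simp
        show "AE x in lebesgue. indicator (cbox c d) x * F x = indicator (box l' u') x * f x"
          using AE_not_in[OF null]
        proof eventually_elim
          case (elim x)
          then show ?case using eq(1) box_subset_cbox[of c d] by (auto simp: F_def split: split_indicator)
        qed
      qed
      also have "\<dots> = 0" using box0[of l' u'] eq(2) lu by blast
      finally show ?thesis .
    qed
    have F_on: "F integrable_on cbox c d" for c d using Fhk by blast
    obtain N where N: "negligible N" "\<And>x e. \<lbrakk>x \<notin> N; 0 < e\<rbrakk> \<Longrightarrow>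
        \<exists>\<delta>>0. \<forall>h. 0 < h \<and> h < \<delta> \<longrightarrow> norm (integral (cbox x (x + h *\<^sub>R One)) F /\<^sub>R h ^ DIM('a) - F x) < e"
      using integrable_ccontinuous_explicit[OF F_on] by blast
    \<comment> \<open>F x is a limit of averages that are all 0; if it were non-zero, the cube of
      side \<delta>/2 would already give a contradiction.\<close>
    have "F x = 0" if xN: "x \<notin> N" for x
    proof (rule ccontr)
      assume "F x \<noteq> 0"
      then obtain \<delta> where "\<delta> > 0" "\<forall>h. 0 < h \<and> h < \<delta> \<longrightarrow> norm (integral (cbox x (x + h *\<^sub>R One)) F /\<^sub>R h ^ DIM('a) - F x) < norm (F x)"
        using N(2)[OF xN, of "norm (F x)"] by auto
      then have "norm (integral (cbox x (x + (\<delta>/2) *\<^sub>R One)) F /\<^sub>R (\<delta>/2) ^ DIM('a) - F x) < norm (F x)"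
        by auto
      moreover have "integral (cbox x (x + (\<delta>/2) *\<^sub>R One)) F = 0"
        using Fhk[of x "x + (\<delta>/2) *\<^sub>R One"] F0 by (metis integral_unique)
      ultimately show False by simp
    qed
    then have "AE x in lebesgue. F x = 0"
      using N(1) by (metis (mono_tags, lifting) AE_I' mem_Collect_eq negligible_iff_null_sets subsetI)
    then show ?thesis by eventually_elim (auto simp: F_def)
  qed
  obtain D where D: "countable D" "D \<subseteq> Pow U" "\<And>X. X \<in> D \<Longrightarrow> \<exists>a b. X = cbox a b" "\<Union>D = U"
    using open_countable_Union_open_cbox[OF assms(1)] by blast
  have cov: "AE x in lebesgue. x \<in> X \<longrightarrow> f x = 0" if "X \<in> D" for X
  proof -
    obtain l u where X: "X = cbox l u" using D(3)[OF \<open>X \<in> D\<close>] by blast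
    have null: "cbox l u - box l u \<in> null_sets lebesgue"
      using negligible_frontier_interval[of l u] negligible_iff_null_sets by blast
    have "cbox l u \<subseteq> U" using D(2) \<open>X \<in> D\<close> X by blast
    from local_zero[OF this] AE_not_in[OF null] show ?thesis
      by eventually_elim (use X in blast)
  qed
  have "AE x in lebesgue. \<forall>X\<in>D. x \<in> X \<longrightarrow> f x = 0"
    unfolding AE_ball_countable[OF D(1)] using cov by simp
  then have "AE x in lebesgue. x \<in> U \<longrightarrow> f x = 0"
    using D(4) by (auto elim!: eventually_mono)
  then show ?thesis using U by (simp add: AE_restrict_space_iff)
qed

section \<open>Hoelder's inequality and Muckenhoupt weights\<close>

text \<open>Both functions are scaled to norm 1, by a = A^(1/p) and b = B^(1/q), and Young's
  inequality is integrated. If one norm is 0 the scaling is impossible, but then that function is 0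
  almost everywhere.\<close>

lemma Holder_inequality:
  fixes f g :: "'a \<Rightarrow> real"
  assumes "p > 1" "q > 1" "1 / p + 1 / q = 1"
    and f[measurable]: "f \<in> borel_measurable M" and f0: "\<And>x. 0 \<le> f x"
    and g[measurable]: "g \<in> borel_measurable M" and g0: "\<And>x. 0 \<le> g x"
    and fi: "integrable M (\<lambda>x. f x powr p)" and gi: "integrable M (\<lambda>x. g x powr q)"
  shows "(\<integral>x. f x * g x \<partial>M) \<le> (\<integral>x. f x powr p \<partial>M) powr (1 / p) * (\<integral>x. g x powr q \<partial>M) powr (1 / q)"
proof -
  define A where "A = (\<integral>x. f x powr p \<partial>M)"
  define B where "B = (\<integral>x. g x powr q \<partial>M)"
  have nn: "0 \<le> A" "0 \<le> B" by (simp_all add: A_def B_def integral_nonneg)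
  consider "A = 0" | "B = 0" | "A > 0" "B > 0" using nn by linarith
  then show ?thesis
  proof cases
    case 1
    then have "AE x in M. f x powr p = 0"
      using integral_nonneg_eq_0_iff_AE[OF fi] by (simp add: A_def)
    then have "(\<integral>x. f x * g x \<partial>M) = (\<integral>x. 0 \<partial>M)"
      by (intro integral_cong_AE) auto
    then show ?thesis by simp
  next
    case 2
    then have "AE x in M. g x powr q = 0"
      using integral_nonneg_eq_0_iff_AE[OF gi] by (simp add: B_def)
    then have "(\<integral>x. f x * g x \<partial>M) = (\<integral>x. 0 \<partial>M)"
      by (intro integral_cong_AE) auto
    then show ?thesis by simp
  next
    case 3
    define a where "a = A powr (1 / p)"
    define b where "b = B powr (1 / q)"
    have ab: "a > 0" "b > 0" "a powr p = A" "b powr q = B"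
      using 3 assms(1,2) by (auto simp: a_def b_def powr_powr)
    have "f x * g x \<le> a * b * (f x powr p / A / p + g x powr q / B / q)" for x
    proof -
      have "(f x / a) * (g x / b) \<le> (f x / a) powr p / p + (g x / b) powr q / q"
        using ab f0 g0 by (intro Youngs_inequality assms) auto
      then show ?thesis using ab f0[of x] g0[of x] by (simp add: powr_divide field_simps)
    qed
    moreover have ri: "integrable M (\<lambda>x. a * b * (f x powr p / A / p + g x powr q / B / q))"
      using fi gi by simp
    ultimately have "(\<integral>x. f x * g x \<partial>M) \<le> (\<integral>x. a * b * (f x powr p / A / p + g x powr q / B / q) \<partial>M)"
      using f0 g0 by (intro integral_mono_AE' AE_I2) (auto intro: order_trans[OF mult_nonneg_nonneg])
    also have "\<dots> = a * b * (A / A / p + B / B / q)"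
      using fi gi by (simp add: A_def B_def)
    also have "\<dots> = a * b" using 3 assms(3) by simp
    finally show ?thesis by (simp add: a_def b_def A_def B_def)
  qed
qed

text \<open>Jensen's inequality for t^p on a probability measure, obtained from Hoelder's inequality
  against the constant 1. If \<open>f x powr p\<close> is not integrable, the right side is
  \<infinity>, and a default value of the integral of f does no harm.\<close>

lemma power_mean_inequality:
  fixes f :: "'a \<Rightarrow> real"
  assumes "p > 1" and M: "emeasure M (space M) = 1"
    and f[measurable]: "f \<in> borel_measurable M" and f0: "\<And>x. 0 \<le> f x"
  shows "ennreal ((\<integral>x. f x \<partial>M) powr p) \<le> (\<integral>\<^sup>+x. ennreal (f x powr p) \<partial>M)"
proof (cases "integrable M (\<lambda>x. f x powr p)")
  case True
  interpret finite_measure M by (rule finite_measureI) (simp add: M)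
  define q where "q = p / (p - 1)"
  have q: "q > 1" "1 / p + 1 / q = 1" using assms(1) by (auto simp: q_def field_simps)
  have "(\<integral>x. f x * 1 \<partial>M) \<le> (\<integral>x. f x powr p \<partial>M) powr (1 / p) * (\<integral>x. 1 powr q \<partial>M) powr (1 / q)"
    by (rule Holder_inequality) (use q assms True in auto)
  also have "(\<integral>x. 1 powr q \<partial>M) = 1" using M by (simp add: measure_def)
  finally have "(\<integral>x. f x \<partial>M) \<le> (\<integral>x. f x powr p \<partial>M) powr (1 / p)" by simp
  then have "(\<integral>x. f x \<partial>M) powr p \<le> ((\<integral>x. f x powr p \<partial>M) powr (1 / p)) powr p"
    using f0 assms(1) by (intro powr_mono2) (auto simp: integral_nonneg)
  also have "\<dots> = (\<integral>x. f x powr p \<partial>M)"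
    using assms(1) by (simp add: powr_powr integral_nonneg)
  finally show ?thesis
    using nn_integral_eq_integral[OF True] by (simp add: ennreal_leI)
next
  case False
  then have "(\<integral>\<^sup>+x. ennreal (f x powr p) \<partial>M) = \<infinity>"
    by (simp add: integrable_iff_bounded not_less top.extremum_unique)
  then show ?thesis by simp
qed

text \<open>Hoelder's inequality for F = (F \<omega>^(1/\<gamma>)) \<omega>^(-1/\<gamma>) with
  exponents \<gamma> and \<delta> = \<gamma>/(\<gamma>-1): the last factor to the power \<delta> is
  the dual weight \<omega>^(-1/(\<gamma>-1)), whose mean the class controls. The remaining work
  concerns means that are 0 or \<infinity>.\<close>

lemma muckenhoupt_ball_average:
  fixes \<omega> F :: "'a::euclidean_space \<Rightarrow> real"
  assumes \<omega>: "\<omega> \<in> muckenhoupt \<gamma>" and \<gamma>: "\<gamma> > 1" and r: "r > 0"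
    and F[measurable]: "F \<in> borel_measurable (lebesgue_on (ball z r))" and F0: "\<And>x. 0 \<le> F x"
  shows "ennreal (((\<integral>x. F x \<partial>lebesgue_on (ball z r)) / measure lebesgue (ball z r)) powr \<gamma>)
      * (\<integral>\<^sup>+x. ennreal (\<omega> x) \<partial>lebesgue_on (ball z r))
    \<le> muckenhoupt_const \<gamma> \<omega> * (\<integral>\<^sup>+x. ennreal (F x powr \<gamma> * \<omega> x) \<partial>lebesgue_on (ball z r))"
    (is "ennreal ((_ / ?m) powr \<gamma>) * ?W \<le> ?A * ?X")
proof -
  let ?M = "lebesgue_on (ball z r)"
  have bl: "ball z r \<in> sets lebesgue" by simp
  have \<omega>0: "\<And>x. 0 \<le> \<omega> x" and A: "?A < \<infinity>" and "\<omega> \<in> L1_loc UNIV"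
    using \<omega> by (auto simp: muckenhoupt_def)
  then have "set_integrable lebesgue (cball z r) \<omega>"
    by (simp add: L1_loc_def)
  then have "set_integrable lebesgue (ball z r) \<omega>"
    by (rule set_integrable_subset) auto
  then have \<omega>i: "integrable ?M \<omega>"
    by (simp add: set_integrable_def integrable_restrict_space)
  then have \<omega>m[measurable]: "\<omega> \<in> borel_measurable ?M" by auto
  have m: "?m > 0" using r by (simp add: content_ball_pos measure_completion)
  have em: "emeasure lebesgue (ball z r) = ennreal ?m"
    using emeasure_eq_measure2[OF lmeasurable_ball] by simp
  define V where "V = mean (ball z r) (\<lambda>x. inverse (ennreal (\<omega> x powr (1 / (\<gamma> - 1)))))"
  have sup: "mean (ball z r) (\<lambda>x. ennreal (\<omega> x)) * ennreal_powr V (\<gamma> - 1) \<le> ?A"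
    unfolding muckenhoupt_const_def V_def using r by (intro SUP_upper2[of "(z, r)"]) auto
  define w where "w = (\<integral>x. \<omega> x \<partial>?M)"
  have W: "?W = ennreal w"
    unfolding w_def by (rule nn_integral_eq_integral[OF \<omega>i]) (simp add: \<omega>0)
  have w0: "w \<ge> 0" using \<omega>0 by (simp add: w_def integral_nonneg)
  have mw: "mean (ball z r) (\<lambda>x. ennreal (\<omega> x)) = ennreal (w / ?m)"
    unfolding mean_def W em using m w0 by (simp add: divide_ennreal)
  show ?thesis
  proof (cases "w = 0")
    case True
    then show ?thesis by (simp add: W)
  next
    case False
    with w0 have w: "w > 0" by simp
    have Minv: "(\<lambda>x. inverse (ennreal (\<omega> x powr (1 / (\<gamma> - 1))))) \<in> borel_measurable ?M"
      by measurable
    \<comment> \<open>The integrand is nowhere 0, being the \<open>ennreal\<close> inverse of a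
      finite number, so its integral over a ball of positive measure cannot vanish.\<close>
    have V0: "V \<noteq> 0"
    proof
      assume "V = 0"
      then have "(\<integral>\<^sup>+x. inverse (ennreal (\<omega> x powr (1 / (\<gamma> - 1)))) \<partial>?M) = 0"
        using m by (auto simp: V_def mean_def em ennreal_divide_eq_0_iff)
      then have "AE x in ?M. inverse (ennreal (\<omega> x powr (1 / (\<gamma> - 1)))) = 0"
        using nn_integral_0_iff_AE[OF Minv] by simp
      then have "AE x in ?M. False" by eventually_elim (simp add: ennreal_inverse_eq_0_iff)
      then have "emeasure ?M (space ?M) = 0"
        using AE_iff_measurable[of "ball z r" ?M "\<lambda>_. False"] by (simp add: ball_def)
      then show False using em m bl by (simp add: emeasure_restrict_space)
    qed
    \<comment> \<open>Here the convention 1/0 = \<infinity> pays off: an infinite dual mean next to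
      a positive mean of \<omega> would make the constant infinite. Finiteness then yields \<omega>
      > 0 almost everywhere, and only where \<omega> > 0 does the real power in \<open>s\<close>
      agree with the \<open>ennreal\<close> inverse.\<close>
    have Vfin: "V < \<infinity>"
    proof (rule ccontr)
      assume "\<not> V < \<infinity>"
      then have "ennreal_powr V (\<gamma> - 1) = \<infinity>" by (simp add: ennreal_powr_def less_top[symmetric])
      with sup mw w m have "?A = \<infinity>" by (simp add: ennreal_mult_top top.extremum_unique)
      with A show False by simp
    qed
    define s where "s x = \<omega> x powr (- 1 / (\<gamma> - 1))" for x
    have s0: "s x \<ge> 0" for x by (simp add: s_def)
    have s_m[measurable]: "s \<in> borel_measurable ?M" unfolding s_def[abs_def] by measurable
    have Vi: "(\<integral>\<^sup>+x. inverse (ennreal (\<omega> x powr (1 / (\<gamma> - 1)))) \<partial>?M) \<noteq> \<infinity>"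
      using Vfin m by (auto simp: V_def mean_def em ennreal_top_divide)
    then have "AE x in ?M. inverse (ennreal (\<omega> x powr (1 / (\<gamma> - 1)))) \<noteq> \<infinity>"
      using nn_integral_PInf_AE[OF Minv] by simp
    then have pos: "AE x in ?M. \<omega> x > 0"
    proof eventually_elim
      case (elim x)
      then show ?case using \<omega>0[of x] by (cases "\<omega> x = 0") auto
    qed
    have inv_s: "AE x in ?M. inverse (ennreal (\<omega> x powr (1 / (\<gamma> - 1)))) = ennreal (s x)"
      using pos by eventually_elim (simp add: s_def inverse_ennreal powr_minus)
    have S: "(\<integral>\<^sup>+x. ennreal (s x) \<partial>?M) < \<infinity>"
      using Vi nn_integral_cong_AE[OF inv_s] by (simp add: less_top[symmetric])
    then have si: "integrable ?M s"
      by (intro integrableI_nonneg) (auto simp: s0)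
    define \<sigma> where "\<sigma> = (\<integral>x. s x \<partial>?M)"
    have \<sigma>0: "\<sigma> \<ge> 0" using s0 by (simp add: \<sigma>_def integral_nonneg)
    have V_eq: "V = ennreal (\<sigma> / ?m)"
      unfolding V_def mean_def em nn_integral_cong_AE[OF inv_s]
      using nn_integral_eq_integral[OF si] m s0 \<sigma>0 by (simp add: divide_ennreal \<sigma>_def)
    then have "ennreal_powr V (\<gamma> - 1) = ennreal ((\<sigma> / ?m) powr (\<gamma> - 1))"
      using V_eq \<sigma>0 m by (simp add: ennreal_powr_def)
    with sup have sup': "ennreal (w / ?m * (\<sigma> / ?m) powr (\<gamma> - 1)) \<le> ?A"
      using w m unfolding mw by (subst ennreal_mult) auto
    have \<sigma>: "\<sigma> > 0" using V0 V_eq \<sigma>0 by (cases "\<sigma> = 0") auto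
    show ?thesis
    proof (cases "integrable ?M (\<lambda>x. F x powr \<gamma> * \<omega> x)")
      case True
      define x where "x = (\<integral>x. F x powr \<gamma> * \<omega> x \<partial>?M)"
      have X: "?X = ennreal x"
        unfolding x_def by (rule nn_integral_eq_integral[OF True]) (simp add: \<omega>0)
      have x0: "x \<ge> 0" using \<omega>0 by (simp add: x_def integral_nonneg)
      define \<delta> where "\<delta> = \<gamma> / (\<gamma> - 1)"
      have \<delta>: "\<delta> > 1" "1 / \<gamma> + 1 / \<delta> = 1" using \<gamma> by (auto simp: \<delta>_def field_simps)
      have e1: "(F x * \<omega> x powr (1 / \<gamma>)) powr \<gamma> = F x powr \<gamma> * \<omega> x" for x
        using \<gamma> \<omega>0[of x] F0[of x] by (simp add: powr_mult powr_powr)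
      have e2: "(\<omega> x powr (- (1 / \<gamma>))) powr \<delta> = s x" for x
        using \<gamma> by (simp add: powr_powr s_def \<delta>_def)
      have "(\<integral>x. (F x * \<omega> x powr (1 / \<gamma>)) * \<omega> x powr (- (1 / \<gamma>)) \<partial>?M)
          \<le> (\<integral>x. (F x * \<omega> x powr (1 / \<gamma>)) powr \<gamma> \<partial>?M) powr (1 / \<gamma>)
            * (\<integral>x. (\<omega> x powr (- (1 / \<gamma>))) powr \<delta> \<partial>?M) powr (1 / \<delta>)"
        using True si by (intro Holder_inequality) (auto simp: e1 e2 \<gamma> \<delta> F0)
      also have "\<dots> = x powr (1 / \<gamma>) * \<sigma> powr (1 / \<delta>)"
        unfolding e1 e2 by (simp add: x_def \<sigma>_def)
      also have "(\<integral>x. (F x * \<omega> x powr (1 / \<gamma>)) * \<omega> x powr (- (1 / \<gamma>)) \<partial>?M) = (\<integral>x. F x \<partial>?M)"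
        using pos by (intro integral_cong_AE) (auto elim!: eventually_mono simp: powr_minus field_simps)
      finally have H: "(\<integral>x. F x \<partial>?M) \<le> x powr (1 / \<gamma>) * \<sigma> powr (1 / \<delta>)" .
      have "(\<integral>x. F x \<partial>?M) powr \<gamma> \<le> (x powr (1 / \<gamma>) * \<sigma> powr (1 / \<delta>)) powr \<gamma>"
        using \<gamma> F0 by (intro powr_mono2[OF _ _ H]) (auto simp: integral_nonneg)
      also have "\<dots> = x * \<sigma> powr (\<gamma> - 1)"
        using \<gamma> x0 \<sigma> by (simp add: powr_mult powr_powr \<delta>_def)
      finally have "((\<integral>x. F x \<partial>?M) / ?m) powr \<gamma> * w \<le> x * \<sigma> powr (\<gamma> - 1) / ?m powr \<gamma> * w"
        using w m F0 by (auto simp: powr_divide integral_nonneg intro!: mult_right_mono divide_right_mono)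
      \<comment> \<open>Splitting the power \<gamma> of \<open>?m\<close> into \<open>?m\<close> and
        its power \<gamma> - 1 exposes the product of the two means that \<open>sup'\<close>
        bounds.\<close>
      also have "\<dots> = w / ?m * (\<sigma> / ?m) powr (\<gamma> - 1) * x"
        using m \<sigma> by (simp add: powr_divide powr_diff field_simps)
      finally have "ennreal (((\<integral>x. F x \<partial>?M) / ?m) powr \<gamma>) * ?W
          \<le> ennreal (w / ?m * (\<sigma> / ?m) powr (\<gamma> - 1)) * ennreal x"
        unfolding W using w m x0 by (simp add: ennreal_leI flip: ennreal_mult)
      also have "\<dots> \<le> ?A * ?X" unfolding X using sup' by (rule mult_right_mono) simp
      finally show ?thesis .
    next
      case False
      then have "?X = \<infinity>"
        using \<omega>0 by (simp add: integrable_iff_bounded not_less top.extremum_unique)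
      \<comment> \<open>In \<open>ennreal\<close> 0 * \<infinity> = 0, so an infinite integral on
        the right settles the claim only together with a positive constant.\<close>
      moreover have "?A \<noteq> 0"
      proof -
        have "w / ?m * (\<sigma> / ?m) powr (\<gamma> - 1) > 0" using w m \<sigma> by simp
        then show ?thesis using sup' by (metis ennreal_eq_0_iff le_zero_eq not_le)
      qed
      ultimately show ?thesis by (simp add: ennreal_mult_top)
    qed
  qed
qed

section \<open>Averages over cubes\<close>

text \<open>A probability measure, so that averages are integrals over a parameter and Jensen's
  inequality and Fubini apply to them directly. On \<open>real\<close> it is Lebesgue measure on
  [0, 1] and serves for integrals along segments.\<close>

definition unit_cube :: "'a::euclidean_space measure" where
  "unit_cube = density lborel (indicator (cbox 0 One))"

definition cube_avg :: "real \<Rightarrow> ('a::euclidean_space \<Rightarrow> 'b::euclidean_space) \<Rightarrow> 'a \<Rightarrow> 'b" where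
  "cube_avg \<epsilon> f x = (\<integral>h. f (x + \<epsilon> *\<^sub>R h) \<partial>unit_cube)"

lemma sets_unit_cube[measurable_cong, simp]: "sets unit_cube = sets borel"
  by (simp add: unit_cube_def)

lemma space_unit_cube[simp]: "space unit_cube = UNIV"
  by (simp add: unit_cube_def)

lemma emeasure_unit_cube_UNIV[simp]: "emeasure (unit_cube :: 'a::euclidean_space measure) UNIV = 1"
proof -
  have "emeasure (unit_cube :: 'a measure) UNIV = emeasure lborel (cbox (0::'a) One)"
    by (simp add: unit_cube_def emeasure_density)
  also have "\<dots> = 1" by (simp add: emeasure_lborel_cbox_eq)
  finally show ?thesis .
qed

lemma finite_measure_unit_cube: "finite_measure unit_cube"
  by (rule finite_measureI) simp

interpretation unit_cube: finite_measure unit_cube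
  by (rule finite_measure_unit_cube)

interpretation lborel_unit_cube: pair_sigma_finite lborel unit_cube ..

lemma AE_unit_cube: "AE h in unit_cube. h \<in> cbox 0 One"
  unfolding unit_cube_def by (subst AE_density) (auto simp: indicator_def)

lemma norm_unit_cube_le:
  assumes "h \<in> cbox 0 (One :: 'a::euclidean_space)"
  shows "norm h \<le> DIM('a)"
proof -
  have "norm h \<le> (\<Sum>b\<in>Basis. \<bar>h \<bullet> b\<bar>)" by (rule norm_le_l1)
  also have "\<dots> \<le> (\<Sum>b\<in>(Basis::'a set). 1)" using assms by (intro sum_mono) (auto simp: mem_box)
  finally show ?thesis by simp
qed

lemma ball_in_borel[measurable]: "ball z r \<in> sets borel"
  by simp

section \<open>Change of variables between small cubes and the unit cube\<close>

lemma nn_integral_affine: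
  fixes x :: "'a::euclidean_space"
  assumes [measurable]: "f \<in> borel_measurable borel" and "\<epsilon> > 0"
  shows "(\<integral>\<^sup>+y. f y \<partial>lborel) = ennreal (\<epsilon> ^ DIM('a)) * (\<integral>\<^sup>+h. f (x + \<epsilon> *\<^sub>R h) \<partial>lborel)"
  by (subst lborel_affine[of \<epsilon> x])
     (use assms(2) in \<open>simp_all add: nn_integral_density nn_integral_distr nn_integral_cmult\<close>)

lemma integral_affine:
  fixes x :: "'a::euclidean_space" and f :: "'a \<Rightarrow> 'b::euclidean_space"
  assumes [measurable]: "f \<in> borel_measurable borel" and "\<epsilon> > 0"
  shows "(\<integral>y. f y \<partial>lborel) = \<epsilon> ^ DIM('a) *\<^sub>R (\<integral>h. f (x + \<epsilon> *\<^sub>R h) \<partial>lborel)"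
  by (subst lborel_affine[of \<epsilon> x])
     (use assms(2) in \<open>simp_all add: integral_density integral_distr\<close>)

lemma indicator_cube_affine:
  fixes x :: "'a::euclidean_space"
  assumes "\<epsilon> > 0"
  shows "indicator (cbox x (x + \<epsilon> *\<^sub>R One)) (x + \<epsilon> *\<^sub>R h) = indicator (cbox 0 One) h"
  using assms by (auto simp: indicator_def mem_box inner_add_left zero_le_mult_iff)

lemma nn_integral_unit_cube:
  fixes x :: "'a::euclidean_space"
  assumes [measurable]: "f \<in> borel_measurable borel" and "\<epsilon> > 0"
  shows "(\<integral>\<^sup>+y. indicator (cbox x (x + \<epsilon> *\<^sub>R One)) y * f y \<partial>lborel)
    = ennreal (\<epsilon> ^ DIM('a)) * (\<integral>\<^sup>+h. f (x + \<epsilon> *\<^sub>R h) \<partial>unit_cube)"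
  by (subst nn_integral_affine[of _ \<epsilon> x])
     (use assms in \<open>simp_all add: indicator_cube_affine unit_cube_def nn_integral_density\<close>)

text \<open>Links the average over a parameter to cubes with corner x, the form in which Lebesgue
  differentiation is available.\<close>

lemma cube_avg_eq_integral:
  fixes x :: "'a::euclidean_space" and f :: "'a \<Rightarrow> 'b::euclidean_space"
  assumes [measurable]: "f \<in> borel_measurable borel" and "\<epsilon> > 0"
  shows "cube_avg \<epsilon> f x = (\<integral>y. indicator (cbox x (x + \<epsilon> *\<^sub>R One)) y *\<^sub>R f y \<partial>lborel) /\<^sub>R \<epsilon> ^ DIM('a)"
proof -
  have "cube_avg \<epsilon> f x = (\<integral>h. f (x + \<epsilon> *\<^sub>R h) \<partial>density lborel (\<lambda>x. ennreal (indicator (cbox 0 One) x)))"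
    by (simp add: cube_avg_def unit_cube_def ennreal_indicator)
  also have "\<dots> = (\<integral>h. indicator (cbox 0 One) h *\<^sub>R f (x + \<epsilon> *\<^sub>R h) \<partial>lborel)"
    by (subst integral_density) auto
  finally show ?thesis
    by (subst integral_affine[of _ \<epsilon> x]) (use assms in \<open>simp_all add: indicator_cube_affine\<close>)
qed

lemma integrable_unit_cube:
  fixes f :: "'a::euclidean_space \<Rightarrow> 'b::euclidean_space"
  assumes f: "integrable lborel f" and "\<epsilon> > 0"
  shows "integrable unit_cube (\<lambda>h. f (x + \<epsilon> *\<^sub>R h))"
proof (rule integrableI_bounded)
  have [measurable]: "f \<in> borel_measurable borel" using f by auto
  show "(\<lambda>h. f (x + \<epsilon> *\<^sub>R h)) \<in> borel_measurable unit_cube" by measurable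
  have "ennreal (\<epsilon> ^ DIM('a)) * (\<integral>\<^sup>+h. ennreal (norm (f (x + \<epsilon> *\<^sub>R h))) \<partial>unit_cube)
      = (\<integral>\<^sup>+y. indicator (cbox x (x + \<epsilon> *\<^sub>R One)) y * ennreal (norm (f y)) \<partial>lborel)"
    using assms(2) by (subst nn_integral_unit_cube) auto
  also have "\<dots> \<le> (\<integral>\<^sup>+y. ennreal (norm (f y)) \<partial>lborel)"
    by (intro nn_integral_mono) (auto simp: indicator_def)
  also have "\<dots> < \<infinity>" using f by (simp add: integrable_iff_bounded)
  finally show "(\<integral>\<^sup>+h. ennreal (norm (f (x + \<epsilon> *\<^sub>R h))) \<partial>unit_cube) < \<infinity>"
    using assms(2) by (auto simp: ennreal_mult_less_top)
qed

lemma cube_avg_measurable[measurable]: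
  fixes f :: "'a::euclidean_space \<Rightarrow> 'b::euclidean_space"
  assumes [measurable]: "f \<in> borel_measurable borel"
  shows "cube_avg \<epsilon> f \<in> borel_measurable borel"
  unfolding cube_avg_def[abs_def]
  by (rule unit_cube.borel_measurable_lebesgue_integral) measurable

lemma norm_cube_avg_le: "norm (cube_avg \<epsilon> f x) \<le> cube_avg \<epsilon> (\<lambda>y. norm (f y)) x"
  unfolding cube_avg_def by (rule integral_norm_bound)

text \<open>Meant for the splitting by height: c is the height, f the modulus of the gradient, and g
  what is left of it where it exceeds c.\<close>

lemma cube_avg_mono:
  fixes f g :: "'a::euclidean_space \<Rightarrow> real"
  assumes "integrable lborel g" "f \<in> borel_measurable borel" "\<epsilon> > 0" "\<And>y. 0 \<le> f y" "\<And>y. f y \<le> c + g y"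
  shows "cube_avg \<epsilon> f x \<le> c + cube_avg \<epsilon> g x"
proof -
  note i = integrable_unit_cube[OF assms(1,3)]
  have "cube_avg \<epsilon> f x \<le> (\<integral>h. c + g (x + \<epsilon> *\<^sub>R h) \<partial>unit_cube)"
    unfolding cube_avg_def using assms(4,5) i
    by (intro integral_mono_AE') (auto intro!: order_trans[OF assms(4) assms(5)])
  also have "\<dots> = c + cube_avg \<epsilon> g x"
    using i by (simp add: cube_avg_def measure_def)
  finally show ?thesis .
qed

text \<open>A point of the cube is at most n \<epsilon> away from x, with n the dimension, and x is
  within \<epsilon> of z: hence the radius (n + 1) \<epsilon>. One ball serves all x near z, which
  is what allows the later integration over the centre.\<close>

lemma cube_avg_le_ball:
  fixes F :: "'a::euclidean_space \<Rightarrow> real" and \<epsilon> :: real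
  assumes F: "integrable lborel F" and F0: "\<And>y. 0 \<le> F y" and "\<epsilon> > 0" and "dist x z < \<epsilon>"
  shows "cube_avg \<epsilon> F x \<le> (\<integral>y. indicator (ball z ((real DIM('a) + 1) * \<epsilon>)) y * F y \<partial>lborel) / \<epsilon> ^ DIM('a)"
proof -
  have sub: "cbox x (x + \<epsilon> *\<^sub>R One) \<subseteq> ball z ((real DIM('a) + 1) * \<epsilon>)"
  proof
    fix y assume y: "y \<in> cbox x (x + \<epsilon> *\<^sub>R One)"
    have "dist x y \<le> (\<Sum>b\<in>Basis. \<bar>(x - y) \<bullet> b\<bar>)" unfolding dist_norm by (rule norm_le_l1)
    also have "\<dots> \<le> (\<Sum>b\<in>(Basis::'a set). \<epsilon>)"
      using y by (intro sum_mono) (auto simp: mem_box inner_add_left inner_diff_left)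
    finally have "dist z y < (real DIM('a) + 1) * \<epsilon>"
      using dist_triangle[of z y x] assms(4) by (simp add: dist_commute algebra_simps)
    then show "y \<in> ball z ((real DIM('a) + 1) * \<epsilon>)" by simp
  qed
  have [measurable]: "F \<in> borel_measurable borel" using F by auto
  have i: "integrable lborel (\<lambda>y. indicator (ball z r) y * F y)" for r
    using integrable_mult_indicator[OF _ F, of "ball z r"] by simp
  have "(\<integral>y. indicator (cbox x (x + \<epsilon> *\<^sub>R One)) y * F y \<partial>lborel)
      \<le> (\<integral>y. indicator (ball z ((real DIM('a) + 1) * \<epsilon>)) y * F y \<partial>lborel)"
    using F0 sub by (intro integral_mono_AE' i AE_I2) (auto simp: indicator_def subset_iff)
  then show ?thesis using assms(3)
    by (simp add: cube_avg_eq_integral divide_inverse mult.commute[of "inverse _"] mult_right_mono)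
qed

lemma cube_avg_nonneg: "(\<And>y. 0 \<le> F y) \<Longrightarrow> 0 \<le> cube_avg \<epsilon> F x" for F :: "_ \<Rightarrow> real"
  unfolding cube_avg_def by (simp add: Bochner_Integration.integral_nonneg)

lemma cube_avg_le_norm:
  fixes f :: "'a::euclidean_space \<Rightarrow> 'b::euclidean_space"
  assumes f: "integrable lborel f" and "\<epsilon> > 0"
  shows "norm (cube_avg \<epsilon> f x) \<le> (\<integral>y. norm (f y) \<partial>lborel) / \<epsilon> ^ DIM('a)"
proof -
  have "norm (cube_avg \<epsilon> f x) \<le> cube_avg \<epsilon> (\<lambda>y. norm (f y)) x" by (rule norm_cube_avg_le)
  also have "\<dots> \<le> (\<integral>y. indicator (ball x ((real DIM('a) + 1) * \<epsilon>)) y * norm (f y) \<partial>lborel) / \<epsilon> ^ DIM('a)"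
    using assms by (intro cube_avg_le_ball) auto
  also have "\<dots> \<le> (\<integral>y. norm (f y) \<partial>lborel) / \<epsilon> ^ DIM('a)"
    using assms by (intro divide_right_mono integral_mono_AE') (auto simp: indicator_def)
  finally show ?thesis .
qed

lemma cube_avg_tendsto:
  fixes f :: "'a::euclidean_space \<Rightarrow> 'b::euclidean_space"
  assumes f: "integrable lborel f"
  shows "AE x in lborel. ((\<lambda>\<epsilon>. cube_avg \<epsilon> f x) \<longlongrightarrow> f x) (at_right 0)"
proof -
  have [measurable]: "f \<in> borel_measurable borel" using f by auto
  have hk: "(f has_integral (\<integral>y. indicator (cbox c d) y *\<^sub>R f y \<partial>lborel)) (cbox c d)" for c d
  proof -
    have "set_integrable lborel (cbox c d) f"
      unfolding set_integrable_def using f by (intro integrable_mult_indicator) auto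
    from set_borel_integral_eq_integral[OF this] show ?thesis
      by (simp add: set_lebesgue_integral_def integrable_integral)
  qed
  have f_on: "f integrable_on cbox c d" for c d using hk by blast
  obtain N where N: "negligible N" "\<And>x e. \<lbrakk>x \<notin> N; 0 < e\<rbrakk> \<Longrightarrow>
      \<exists>\<delta>>0. \<forall>h. 0 < h \<and> h < \<delta> \<longrightarrow> norm (integral (cbox x (x + h *\<^sub>R One)) f /\<^sub>R h ^ DIM('a) - f x) < e"
    using integrable_ccontinuous_explicit[OF f_on] by blast
  have lim: "((\<lambda>\<epsilon>. cube_avg \<epsilon> f x) \<longlongrightarrow> f x) (at_right 0)" if x: "x \<notin> N" for x
  proof (rule tendstoI)
    fix e :: real assume "e > 0"
    then obtain \<delta> where \<delta>: "\<delta> > 0" "\<And>h. 0 < h \<Longrightarrow> h < \<delta> \<Longrightarrow>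
        norm (integral (cbox x (x + h *\<^sub>R One)) f /\<^sub>R h ^ DIM('a) - f x) < e"
      using N(2)[OF x] by metis
    show "\<forall>\<^sub>F \<epsilon> in at_right 0. dist (cube_avg \<epsilon> f x) (f x) < e"
      using eventually_at_right_less[of 0] order_tendstoD(2)[OF tendsto_ident_at \<delta>(1), of "{0<..}"]
    proof eventually_elim
      case (elim \<epsilon>)
      then show ?case
        using \<delta>(2)[of \<epsilon>] integral_unique[OF hk[of x "x + \<epsilon> *\<^sub>R One"]]
        by (simp add: cube_avg_eq_integral dist_norm)
    qed
  qed
  have "AE x in lebesgue. x \<notin> N"
    using N(1) negligible_iff_null_sets AE_not_in by blast
  then have "AE x in lebesgue. ((\<lambda>\<epsilon>. cube_avg \<epsilon> f x) \<longlongrightarrow> f x) (at_right 0)"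
    by (rule eventually_mono) (rule lim)
  then show ?thesis by (simp add: AE_completion_iff)
qed

text \<open>Fubini over pairs of points will ask for Borel functions, so \<omega> is exchanged for a
  Borel weight equal to it almost everywhere; neither side changes.\<close>

lemma muckenhoupt_ball_average_borel:
  fixes w F :: "'a::euclidean_space \<Rightarrow> real"
  assumes \<omega>: "\<omega> \<in> muckenhoupt \<gamma>" and \<gamma>: "\<gamma> > 1" and r: "r > 0"
    and w: "AE x in lebesgue. \<omega> x = w x"
    and [measurable]: "F \<in> borel_measurable borel" and F0: "\<And>x. 0 \<le> F x"
  shows "ennreal (((\<integral>x. indicator (ball z r) x * F x \<partial>lborel) / measure lborel (ball z r)) powr \<gamma>)
      * (\<integral>\<^sup>+x. ennreal (w x) * indicator (ball z r) x \<partial>lborel)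
    \<le> muckenhoupt_const \<gamma> \<omega> * (\<integral>\<^sup>+x. ennreal (F x powr \<gamma> * w x) * indicator (ball z r) x \<partial>lborel)"
proof -
  have b: "ball z r \<inter> space lebesgue \<in> sets lebesgue" by simp
  have "F \<in> borel_measurable (lebesgue_on (ball z r))"
    by (intro measurable_restrict_space1 measurable_completion) measurable
  from muckenhoupt_ball_average[OF \<omega> \<gamma> r this F0]
  have "ennreal (((\<integral>x. indicator (ball z r) x * F x \<partial>lebesgue) / measure lebesgue (ball z r)) powr \<gamma>)
      * (\<integral>\<^sup>+x. ennreal (\<omega> x) * indicator (ball z r) x \<partial>lebesgue)
    \<le> muckenhoupt_const \<gamma> \<omega> * (\<integral>\<^sup>+x. ennreal (F x powr \<gamma> * \<omega> x) * indicator (ball z r) x \<partial>lebesgue)"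
    by (simp add: integral_restrict_space[OF b] nn_integral_restrict_space[OF b])
  also have "(\<integral>\<^sup>+x. ennreal (\<omega> x) * indicator (ball z r) x \<partial>lebesgue)
      = (\<integral>\<^sup>+x. ennreal (w x) * indicator (ball z r) x \<partial>lebesgue)"
    by (rule nn_integral_cong_AE) (use w in \<open>auto elim: eventually_mono\<close>)
  also have "(\<integral>\<^sup>+x. ennreal (F x powr \<gamma> * \<omega> x) * indicator (ball z r) x \<partial>lebesgue)
      = (\<integral>\<^sup>+x. ennreal (F x powr \<gamma> * w x) * indicator (ball z r) x \<partial>lebesgue)"
    by (rule nn_integral_cong_AE) (use w in \<open>auto elim: eventually_mono\<close>)
  also have "(\<integral>x. indicator (ball z r) x * F x \<partial>lebesgue) = (\<integral>x. indicator (ball z r) x * F x \<partial>lborel)"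
    by (rule integral_completion) measurable
  finally show ?thesis by (simp add: nn_integral_completion measure_completion)
qed

text \<open>K is the volume of a ball of radius r = (n + 1) \<epsilon> divided by \<epsilon>^n, so
  the average at x is at most K times the mean \<open>J z\<close> over the ball about any z within
  \<epsilon> of x. After integration over z, each x counts with the volume b of an \<epsilon>-ball
  on the left and with (n + 1)^n b on the right; b cancels, and with it all dependence on
  \<epsilon>.\<close>

lemma cube_avg_muckenhoupt_bounded:
  fixes w F :: "'a::euclidean_space \<Rightarrow> real"
  assumes \<omega>: "\<omega> \<in> muckenhoupt \<gamma>" and \<gamma>: "\<gamma> > 1" and \<epsilon>: "\<epsilon> > 0"
    and w: "AE x in lebesgue. \<omega> x = w x" and w0: "\<And>x. 0 \<le> w x"
    and [measurable]: "w \<in> borel_measurable borel"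
    and F: "integrable lborel F" and F0: "\<And>x. 0 \<le> F x"
  defines "n \<equiv> DIM('a)"
  shows "(\<integral>\<^sup>+x. ennreal (cube_avg \<epsilon> F x powr \<gamma> * w x) \<partial>lborel)
    \<le> ennreal ((unit_ball_vol n * (n + 1) ^ n) powr \<gamma> * (n + 1) ^ n) * muckenhoupt_const \<gamma> \<omega>
      * (\<integral>\<^sup>+x. ennreal (F x powr \<gamma> * w x) \<partial>lborel)"
proof -
  have [measurable]: "F \<in> borel_measurable borel" using F by auto
  define r where "r = (n + 1) * \<epsilon>"
  define K where "K = unit_ball_vol n * (n + 1) ^ n"
  define b where "b = unit_ball_vol n * \<epsilon> ^ n"
  have r: "r > 0" and b: "b > 0" and K: "K > 0" using \<epsilon> by (auto simp: r_def b_def K_def)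
  have vol\<epsilon>: "emeasure lborel (ball z \<epsilon>) = ennreal b" for z :: 'a
    using \<epsilon> by (simp add: emeasure_ball b_def n_def)
  have volr: "emeasure lborel (ball z r) = ennreal ((n + 1) ^ n * b)" for z :: 'a
    using r by (simp add: emeasure_ball b_def n_def r_def power_mult_distrib mult_ac)
  have volr': "measure lborel (ball z r) = (n + 1) ^ n * b" for z :: 'a
    using b by (simp add: measure_def volr)
  define J where "J z = (\<integral>x. indicator (ball z r) x * F x \<partial>lborel) / measure lborel (ball z r)" for z
  have J: "cube_avg \<epsilon> F x \<le> K * J z" if "dist x z < \<epsilon>" for x z
  proof -
    have "K / ((n + 1) ^ n * b) = 1 / \<epsilon> ^ n"
      using \<epsilon> less_imp_neq[OF unit_ball_vol_pos[of "real n"]] by (simp add: K_def b_def)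
    then have "K * J z = (\<integral>x. indicator (ball z r) x * F x \<partial>lborel) / \<epsilon> ^ n"
      unfolding J_def volr' by (metis times_divide_eq_left times_divide_eq_right mult_1)
    with cube_avg_le_ball[OF F F0 \<epsilon> that] show ?thesis
      by (simp add: r_def n_def add.commute)
  qed
  define T where "T x = ennreal (cube_avg \<epsilon> F x powr \<gamma> * w x)" for x
  have [measurable]: "T \<in> borel_measurable borel" unfolding T_def[abs_def] by measurable
  \<comment> \<open>Written with \<open>dist\<close>, the kernels are jointly measurable and
    symmetric, so each reads as a ball indicator in x as well as in z.\<close>
  define I where "I x z = (if dist x z < \<epsilon> then 1 else 0 :: ennreal)" for x z :: 'a
  define I' where "I' x z = (if dist x z < r then 1 else 0 :: ennreal)" for x z :: 'a
  have [measurable]: "(\<lambda>p. I (snd p) (fst p)) \<in> borel_measurable (borel \<Otimes>\<^sub>M borel)"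
    "(\<lambda>p. I' (snd p) (fst p)) \<in> borel_measurable (borel \<Otimes>\<^sub>M borel)"
    "(\<lambda>p. I (fst p) (snd p)) \<in> borel_measurable (borel \<Otimes>\<^sub>M borel)"
    "(\<lambda>p. I' (fst p) (snd p)) \<in> borel_measurable (borel \<Otimes>\<^sub>M borel)"
    unfolding I_def I'_def by measurable
  have Ib: "I x z = indicator (ball z \<epsilon>) x" "I x z = indicator (ball x \<epsilon>) z"
    "I' x z = indicator (ball z r) x" "I' x z = indicator (ball x r) z" for x z
    by (auto simp: I_def I'_def indicator_def dist_commute)
  have "ennreal b * (\<integral>\<^sup>+x. T x \<partial>lborel) = (\<integral>\<^sup>+x. T x * (\<integral>\<^sup>+z. I x z \<partial>lborel) \<partial>lborel)"
    by (simp add: Ib(2) vol\<epsilon> nn_integral_cmult nn_integral_multc mult.commute)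
  also have "\<dots> = (\<integral>\<^sup>+x. (\<integral>\<^sup>+z. T x * I x z \<partial>lborel) \<partial>lborel)"
    by (intro nn_integral_cong nn_integral_cmult[symmetric]) (simp add: Ib(2))
  also have "\<dots> = (\<integral>\<^sup>+z. (\<integral>\<^sup>+x. T x * I x z \<partial>lborel) \<partial>lborel)"
    by (rule lborel_pair.Fubini') measurable
  also have "\<dots> \<le> (\<integral>\<^sup>+z. ennreal (K powr \<gamma>) * muckenhoupt_const \<gamma> \<omega> * (\<integral>\<^sup>+x. ennreal (F x powr \<gamma> * w x) * I' x z \<partial>lborel) \<partial>lborel)"
  proof (rule nn_integral_mono)
    fix z
    have J0: "J z \<ge> 0" unfolding J_def using F0 by (simp add: integral_nonneg)
    \<comment> \<open>Only x within \<epsilon> of z contribute, yet the weight is integrated over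
      the whole ball of radius r: the ball inequality pairs the mean \<open>J z\<close> with the
      weight of the same ball.\<close>
    have "(\<integral>\<^sup>+x. T x * I x z \<partial>lborel) \<le> (\<integral>\<^sup>+x. ennreal (K powr \<gamma>) * ennreal (J z powr \<gamma>) * (ennreal (w x) * indicator (ball z r) x) \<partial>lborel)"
    proof (rule nn_integral_mono)
      fix x
      show "T x * I x z \<le> ennreal (K powr \<gamma>) * ennreal (J z powr \<gamma>) * (ennreal (w x) * indicator (ball z r) x)"
      proof (cases "dist x z < \<epsilon>")
        case True
        have "\<epsilon> \<le> r" using \<epsilon> by (simp add: r_def algebra_simps)
        with True have "dist z x < r" by (simp add: dist_commute)
        moreover have "cube_avg \<epsilon> F x powr \<gamma> \<le> (K * J z) powr \<gamma>"
          using J[OF True] \<gamma> cube_avg_nonneg[of F, OF F0] by (intro powr_mono2) auto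
        then have "ennreal (cube_avg \<epsilon> F x powr \<gamma> * w x) \<le> ennreal (K powr \<gamma>) * ennreal (J z powr \<gamma>) * ennreal (w x)"
          using K J0 w0[of x] by (simp add: powr_mult ennreal_leI mult_right_mono flip: ennreal_mult)
        ultimately show ?thesis using True by (simp add: T_def I_def)
      qed (simp add: I_def)
    qed
    also have "\<dots> = ennreal (K powr \<gamma>) * (ennreal (J z powr \<gamma>) * (\<integral>\<^sup>+x. ennreal (w x) * indicator (ball z r) x \<partial>lborel))"
      by (simp add: nn_integral_cmult mult.assoc)
    also have "\<dots> \<le> ennreal (K powr \<gamma>) * (muckenhoupt_const \<gamma> \<omega> * (\<integral>\<^sup>+x. ennreal (F x powr \<gamma> * w x) * indicator (ball z r) x \<partial>lborel))"
      unfolding J_def by (intro mult_left_mono muckenhoupt_ball_average_borel[OF \<omega> \<gamma> r w]) (auto simp: F0)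
    finally show "(\<integral>\<^sup>+x. T x * I x z \<partial>lborel) \<le> ennreal (K powr \<gamma>) * muckenhoupt_const \<gamma> \<omega> * (\<integral>\<^sup>+x. ennreal (F x powr \<gamma> * w x) * I' x z \<partial>lborel)"
      by (simp add: Ib mult.assoc)
  qed
  also have "\<dots> = ennreal (K powr \<gamma>) * muckenhoupt_const \<gamma> \<omega> * (\<integral>\<^sup>+z. (\<integral>\<^sup>+x. ennreal (F x powr \<gamma> * w x) * I' x z \<partial>lborel) \<partial>lborel)"
    by (rule nn_integral_cmult) measurable
  also have "(\<integral>\<^sup>+z. (\<integral>\<^sup>+x. ennreal (F x powr \<gamma> * w x) * I' x z \<partial>lborel) \<partial>lborel)
      = (\<integral>\<^sup>+x. (\<integral>\<^sup>+z. ennreal (F x powr \<gamma> * w x) * I' x z \<partial>lborel) \<partial>lborel)"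
    by (rule lborel_pair.Fubini'[symmetric]) measurable
  also have "\<dots> = (\<integral>\<^sup>+x. ennreal (F x powr \<gamma> * w x) * ennreal ((n + 1) ^ n * b) \<partial>lborel)"
    by (intro nn_integral_cong) (simp add: Ib(4) nn_integral_cmult_indicator volr)
  also have "\<dots> = (\<integral>\<^sup>+x. ennreal (F x powr \<gamma> * w x) \<partial>lborel) * ennreal ((n + 1) ^ n * b)"
    by (rule nn_integral_multc) measurable
  finally have "ennreal b * (\<integral>\<^sup>+x. T x \<partial>lborel) \<le> ennreal b * (ennreal (K powr \<gamma> * (n + 1) ^ n) * muckenhoupt_const \<gamma> \<omega>
      * (\<integral>\<^sup>+x. ennreal (F x powr \<gamma> * w x) \<partial>lborel))"
    using b K by (simp add: ennreal_mult mult_ac)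
  then show ?thesis using b by (simp add: T_def K_def ennreal_mult_le_mult_iff)
qed

section \<open>Translation invariance and the unweighted bound\<close>

lemma nn_integral_shift:
  fixes c :: "'a::euclidean_space"
  assumes [measurable]: "f \<in> borel_measurable borel"
  shows "(\<integral>\<^sup>+x. f (x + c) \<partial>lborel) = (\<integral>\<^sup>+x. f x \<partial>lborel)"
  using nn_integral_affine[of f 1 c] by (simp add: add.commute)

lemma integral_shift:
  fixes c :: "'a::euclidean_space" and f :: "'a \<Rightarrow> 'b::euclidean_space"
  assumes [measurable]: "f \<in> borel_measurable borel"
  shows "(\<integral>x. f (x + c) \<partial>lborel) = (\<integral>x. f x \<partial>lborel)"
  using integral_affine[of f 1 c] by (simp add: add.commute)

lemma integrable_shift:
  fixes c :: "'a::euclidean_space" and f :: "'a \<Rightarrow> 'b::euclidean_space"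
  assumes "integrable lborel f"
  shows "integrable lborel (\<lambda>x. f (x + c))"
proof -
  have [measurable]: "f \<in> borel_measurable borel" using assms by auto
  have "(\<integral>\<^sup>+x. ennreal (norm (f (x + c))) \<partial>lborel) = (\<integral>\<^sup>+x. ennreal (norm (f x)) \<partial>lborel)"
    by (rule nn_integral_shift) measurable
  then show ?thesis using assms by (simp add: integrable_iff_bounded)
qed

text \<open>Jensen's inequality inside the average, then Fubini and translation invariance. This is
  the uniform bound for the phase t^p, whose weight is 1.\<close>

lemma cube_avg_Lp_bounded:
  fixes F :: "'a::euclidean_space \<Rightarrow> real"
  assumes "\<gamma> > 1" and [measurable]: "F \<in> borel_measurable borel" and F0: "\<And>x. 0 \<le> F x"
  shows "(\<integral>\<^sup>+x. ennreal (cube_avg \<epsilon> F x powr \<gamma>) \<partial>lborel) \<le> (\<integral>\<^sup>+x. ennreal (F x powr \<gamma>) \<partial>lborel)"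
proof -
  have "(\<integral>\<^sup>+x. ennreal (cube_avg \<epsilon> F x powr \<gamma>) \<partial>lborel)
      \<le> (\<integral>\<^sup>+x. (\<integral>\<^sup>+h. ennreal (F (x + \<epsilon> *\<^sub>R h) powr \<gamma>) \<partial>unit_cube) \<partial>lborel)"
    unfolding cube_avg_def by (intro nn_integral_mono power_mean_inequality assms) (auto simp: F0)
  also have "\<dots> = (\<integral>\<^sup>+h. (\<integral>\<^sup>+x. ennreal (F (x + \<epsilon> *\<^sub>R h) powr \<gamma>) \<partial>lborel) \<partial>unit_cube)"
    by (rule lborel_unit_cube.Fubini'[symmetric]) measurable
  also have "\<dots> = (\<integral>\<^sup>+h. (\<integral>\<^sup>+x. ennreal (F x powr \<gamma>) \<partial>lborel) \<partial>(unit_cube :: 'a measure))"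
    by (intro nn_integral_cong nn_integral_shift) measurable
  also have "\<dots> = (\<integral>\<^sup>+x. ennreal (F x powr \<gamma>) \<partial>lborel)" by simp
  finally show ?thesis .
qed

text \<open>The majorants \<open>u k\<close> need not become small, but the minimum of
  \<open>h m\<close> and \<open>u k\<close> tends to 0 and is dominated by \<open>u k\<close>; what
  \<open>h m\<close> has beyond it is at most \<open>w m k\<close>. Hence the limsup is at most
  \<open>\<delta> k\<close> for every k.\<close>

lemma nn_integral_tendsto_0_by_splitting:
  fixes h :: "nat \<Rightarrow> 'a \<Rightarrow> ennreal" and \<delta> :: "nat \<Rightarrow> ennreal"
  assumes [measurable]: "\<And>m. h m \<in> borel_measurable M" "\<And>k. u k \<in> borel_measurable M"
      "\<And>m k. w m k \<in> borel_measurable M"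
    and lim: "AE x in M. (\<lambda>m. h m x) \<longlonglongrightarrow> 0"
    and u: "\<And>k. (\<integral>\<^sup>+x. u k x \<partial>M) < \<infinity>"
    and le: "\<And>m k x. h m x \<le> u k x + w m k x"
    and w: "\<And>m k. (\<integral>\<^sup>+x. w m k x \<partial>M) \<le> \<delta> k"
    and \<delta>: "\<delta> \<longlonglongrightarrow> 0"
  shows "(\<lambda>m. \<integral>\<^sup>+x. h m x \<partial>M) \<longlonglongrightarrow> 0"
proof (rule tendsto_0_if_Limsup_eq_0_ennreal)
  have "limsup (\<lambda>m. \<integral>\<^sup>+x. h m x \<partial>M) \<le> \<delta> k" for k
  proof -
    have "(\<lambda>m. \<integral>\<^sup>+x. min (h m x) (u k x) \<partial>M) \<longlonglongrightarrow> (\<integral>\<^sup>+x. 0 \<partial>M)"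
    proof (rule nn_integral_dominated_convergence[where w = "u k"])
      show "AE x in M. (\<lambda>m. min (h m x) (u k x)) \<longlonglongrightarrow> 0"
        using lim
      proof eventually_elim
        case (elim x)
        then show ?case using tendsto_min[OF elim tendsto_const[of "u k x"]] by simp
      qed
    qed (use u in auto)
    then have "(\<lambda>m. (\<integral>\<^sup>+x. min (h m x) (u k x) \<partial>M) + \<delta> k) \<longlonglongrightarrow> 0 + \<delta> k"
      by (intro tendsto_add) auto
    then have "limsup (\<lambda>m. (\<integral>\<^sup>+x. min (h m x) (u k x) \<partial>M) + \<delta> k) = \<delta> k"
      using lim_imp_Limsup[OF trivial_limit_sequentially] by fastforce
    moreover have "(\<integral>\<^sup>+x. h m x \<partial>M) \<le> (\<integral>\<^sup>+x. min (h m x) (u k x) \<partial>M) + \<delta> k" for m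
    proof -
      have "(\<integral>\<^sup>+x. h m x \<partial>M) \<le> (\<integral>\<^sup>+x. min (h m x) (u k x) + w m k x \<partial>M)"
        using le[of m _ k] by (intro nn_integral_mono) (simp add: min_def)
      also have "\<dots> = (\<integral>\<^sup>+x. min (h m x) (u k x) \<partial>M) + (\<integral>\<^sup>+x. w m k x \<partial>M)"
        by (rule nn_integral_add) measurable
      finally show ?thesis using w[of m k] by (meson add_left_mono order_trans)
    qed
    then have "limsup (\<lambda>m. \<integral>\<^sup>+x. h m x \<partial>M) \<le> limsup (\<lambda>m. (\<integral>\<^sup>+x. min (h m x) (u k x) \<partial>M) + \<delta> k)"
      by (intro Limsup_mono) simp
    ultimately show ?thesis by simp
  qed
  then have "limsup (\<lambda>m. \<integral>\<^sup>+x. h m x \<partial>M) \<le> 0"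
    using LIMSEQ_le_const[OF \<delta>] by blast
  then show "limsup (\<lambda>m. \<integral>\<^sup>+x. h m x \<partial>M) = 0" by simp
qed

lemma add_powr_le:
  fixes x y :: real
  assumes "0 \<le> x" "0 \<le> y" "\<gamma> > 0"
  shows "(x + y) powr \<gamma> \<le> 2 powr \<gamma> * (x powr \<gamma> + y powr \<gamma>)"
proof -
  have "(x + y) powr \<gamma> \<le> (2 * max x y) powr \<gamma>"
    using assms by (intro powr_mono2) auto
  also have "\<dots> = 2 powr \<gamma> * max x y powr \<gamma>" using assms by (simp add: powr_mult)
  also have "\<dots> \<le> 2 powr \<gamma> * (x powr \<gamma> + y powr \<gamma>)"
    by (intro mult_left_mono) (auto simp: max_def)
  finally show ?thesis .
qed

text \<open>The averages need not have a common integrable majorant, hence the splitting: the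
  bounded part uses that S has finite weight, the rest uses the operator bound. The latter is the
  hypothesis \<open>bounded\<close>, so that Muckenhoupt weights and the weight 1 are treated alike.
  \<Phi> is abstract because it will be a difference of powers for the energy and a power of a
  difference for the norm.\<close>

lemma weighted_cube_avg_tendsto_0:
  fixes w :: "'a::euclidean_space \<Rightarrow> real" and G :: "'a \<Rightarrow> 'b::euclidean_space" and C :: ennreal
  assumes \<gamma>: "\<gamma> > 1" and [measurable]: "w \<in> borel_measurable borel" and w0: "\<And>x. 0 \<le> w x"
    and bounded: "\<And>m F. integrable lborel F \<Longrightarrow> (\<And>x. 0 \<le> F x) \<Longrightarrow>
      (\<integral>\<^sup>+x. ennreal (cube_avg (\<epsilon> m) F x powr \<gamma> * w x) \<partial>lborel)
        \<le> C * (\<integral>\<^sup>+x. ennreal (F x powr \<gamma> * w x) \<partial>lborel)"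
    and C: "C < \<infinity>" and \<epsilon>: "\<And>m. \<epsilon> m > 0"
    and G: "integrable lborel G" and Gw: "(\<integral>\<^sup>+x. ennreal (norm (G x) powr \<gamma> * w x) \<partial>lborel) < \<infinity>"
    and [measurable]: "S \<in> sets borel" and wS: "(\<integral>\<^sup>+x. ennreal (w x) * indicator S x \<partial>lborel) < \<infinity>"
    and [measurable]: "\<And>m. \<Phi> m \<in> borel_measurable borel" and lim: "AE x in lborel. (\<lambda>m. \<Phi> m x) \<longlonglongrightarrow> 0"
    and c: "c \<ge> 0"
    and \<Phi>: "\<And>m x. \<Phi> m x \<le> c * (norm (cube_avg (\<epsilon> m) G x) powr \<gamma> + norm (G x) powr \<gamma>)"
  shows "(\<lambda>m. \<integral>\<^sup>+x. ennreal (\<Phi> m x * w x) * indicator S x \<partial>lborel) \<longlonglongrightarrow> 0"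
proof -
  have [measurable]: "G \<in> borel_measurable borel" using G by auto
  \<comment> \<open>|G| where it exceeds k, and 0 elsewhere. Its weighted integral tends to 0 as k
    grows, which makes \<delta> a null sequence.\<close>
  define H where "H k x = (if norm (G x) \<le> real k then 0 else norm (G x))" for k x
  have [measurable]: "H k \<in> borel_measurable borel" for k unfolding H_def[abs_def] by measurable
  have H0: "0 \<le> H k x" for k x by (simp add: H_def)
  have Hi: "integrable lborel (H k)" for k
    by (rule Bochner_Integration.integrable_bound[OF G]) (auto simp: H_def)
  define \<delta> where "\<delta> k = ennreal (c * 2 powr \<gamma>) * (C * (\<integral>\<^sup>+x. ennreal (H k x powr \<gamma> * w x) \<partial>lborel))" for k
  define u where "u k x = ennreal (c * (2 powr \<gamma> * real k powr \<gamma> + norm (G x) powr \<gamma>) * w x) * indicator S x" for k x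
  define v where "v m k x = ennreal (c * 2 powr \<gamma>) * ennreal (cube_avg (\<epsilon> m) (H k) x powr \<gamma> * w x)" for m k x
  show ?thesis
  proof (rule nn_integral_tendsto_0_by_splitting[where u = u and w = v and \<delta> = \<delta>])
    show "(\<lambda>x. ennreal (\<Phi> m x * w x) * indicator S x) \<in> borel_measurable lborel" for m by measurable
    show "u k \<in> borel_measurable lborel" for k unfolding u_def by measurable
    show "v m k \<in> borel_measurable lborel" for m k unfolding v_def by measurable
    show "AE x in lborel. (\<lambda>m. ennreal (\<Phi> m x * w x) * indicator S x) \<longlonglongrightarrow> 0"
      using lim
    proof eventually_elim
      case (elim x)
      have "(\<lambda>m. ennreal (\<Phi> m x * w x)) \<longlonglongrightarrow> ennreal (0 * w x)"
        by (intro tendsto_intros elim)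
      then show ?case by (cases "x \<in> S") auto
    qed
    show "(\<integral>\<^sup>+x. u k x \<partial>lborel) < \<infinity>" for k
    proof -
      have "(\<integral>\<^sup>+x. u k x \<partial>lborel) \<le> (\<integral>\<^sup>+x. ennreal (c * (2 powr \<gamma> * real k powr \<gamma>)) * (ennreal (w x) * indicator S x)
          + ennreal c * ennreal (norm (G x) powr \<gamma> * w x) \<partial>lborel)"
      proof (rule nn_integral_mono)
        fix x
        have "c * (2 powr \<gamma> * real k powr \<gamma> + norm (G x) powr \<gamma>) * w x
          = c * (2 powr \<gamma> * real k powr \<gamma>) * w x + c * (norm (G x) powr \<gamma> * w x)"
          by (simp add: algebra_simps)
        then have "ennreal (c * (2 powr \<gamma> * real k powr \<gamma> + norm (G x) powr \<gamma>) * w x)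
          = ennreal (c * (2 powr \<gamma> * real k powr \<gamma>)) * ennreal (w x) + ennreal c * ennreal (norm (G x) powr \<gamma> * w x)"
          using c w0[of x] by (simp flip: ennreal_mult ennreal_plus)
        then show "u k x \<le> ennreal (c * (2 powr \<gamma> * real k powr \<gamma>)) * (ennreal (w x) * indicator S x)
          + ennreal c * ennreal (norm (G x) powr \<gamma> * w x)"
          by (auto simp: u_def indicator_def)
      qed
      also have "\<dots> = ennreal (c * (2 powr \<gamma> * real k powr \<gamma>)) * (\<integral>\<^sup>+x. ennreal (w x) * indicator S x \<partial>lborel)
          + ennreal c * (\<integral>\<^sup>+x. ennreal (norm (G x) powr \<gamma> * w x) \<partial>lborel)"
        by (simp add: nn_integral_add nn_integral_cmult)
      also have "\<dots> < \<infinity>" using Gw wS by (simp add: ennreal_mult_less_top)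
      finally show ?thesis .
    qed
    show "ennreal (\<Phi> m x * w x) * indicator S x \<le> u k x + v m k x" for m k x
    proof -
      \<comment> \<open>Averages |G| \<le> k + \<open>H k\<close>; the constant survives unchanged
        because \<open>unit_cube\<close> has mass 1.\<close>
      have "norm (cube_avg (\<epsilon> m) G x) \<le> real k + cube_avg (\<epsilon> m) (H k) x"
        by (rule order_trans[OF norm_cube_avg_le cube_avg_mono[OF Hi _ \<epsilon>]]) (auto simp: H_def)
      then have "norm (cube_avg (\<epsilon> m) G x) powr \<gamma> \<le> (real k + cube_avg (\<epsilon> m) (H k) x) powr \<gamma>"
        using \<gamma> by (intro powr_mono2) auto
      also have "\<dots> \<le> 2 powr \<gamma> * (real k powr \<gamma> + cube_avg (\<epsilon> m) (H k) x powr \<gamma>)"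
        using \<gamma> by (intro add_powr_le cube_avg_nonneg H0) auto
      finally have "\<Phi> m x \<le> c * (2 powr \<gamma> * (real k powr \<gamma> + cube_avg (\<epsilon> m) (H k) x powr \<gamma>) + norm (G x) powr \<gamma>)"
        using \<Phi>[of m x] c by (meson add_right_mono mult_left_mono order_trans)
      then have "\<Phi> m x * w x \<le> c * (2 powr \<gamma> * (real k powr \<gamma> + cube_avg (\<epsilon> m) (H k) x powr \<gamma>) + norm (G x) powr \<gamma>) * w x"
        using w0 by (rule mult_right_mono)
      also have "\<dots> = c * (2 powr \<gamma> * real k powr \<gamma> + norm (G x) powr \<gamma>) * w x
          + c * 2 powr \<gamma> * (cube_avg (\<epsilon> m) (H k) x powr \<gamma> * w x)"
        by (simp add: algebra_simps)
      finally have "ennreal (\<Phi> m x * w x) \<le> ennreal (c * (2 powr \<gamma> * real k powr \<gamma> + norm (G x) powr \<gamma>) * w x)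
          + ennreal (c * 2 powr \<gamma>) * ennreal (cube_avg (\<epsilon> m) (H k) x powr \<gamma> * w x)"
        using c w0[of x] by (simp add: ennreal_leI flip: ennreal_mult ennreal_plus)
      then show ?thesis by (auto simp: u_def v_def indicator_def)
    qed
    show "(\<integral>\<^sup>+x. v m k x \<partial>lborel) \<le> \<delta> k" for m k
      unfolding v_def \<delta>_def by (simp add: nn_integral_cmult bounded[OF Hi H0] mult_left_mono)
    show "\<delta> \<longlonglongrightarrow> 0"
    proof -
      have "(\<lambda>k. \<integral>\<^sup>+x. ennreal (H k x powr \<gamma> * w x) \<partial>lborel) \<longlonglongrightarrow> (\<integral>\<^sup>+x. 0 \<partial>(lborel :: 'a measure))"
      proof (rule nn_integral_dominated_convergence[where w = "\<lambda>x. ennreal (norm (G x) powr \<gamma> * w x)"])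
        show "AE x in lborel. ennreal (H k x powr \<gamma> * w x) \<le> ennreal (norm (G x) powr \<gamma> * w x)" for k
          using w0 by (auto simp: H_def)
        show "AE x in lborel. (\<lambda>k. ennreal (H k x powr \<gamma> * w x)) \<longlonglongrightarrow> 0"
        proof (rule AE_I2)
          fix x
          have "\<forall>\<^sub>F k in sequentially. norm (G x) \<le> real k"
            using eventually_ge_at_top[of "nat \<lceil>norm (G x)\<rceil>"] by eventually_elim linarith
          then show "(\<lambda>k. ennreal (H k x powr \<gamma> * w x)) \<longlonglongrightarrow> 0"
            by (intro tendsto_eventually) (erule eventually_mono, simp add: H_def)
        qed
      qed (use Gw in auto)
      \<comment> \<open>Multiplication by C is continuous at 0 because C is finite.\<close>
      then have "\<delta> \<longlonglongrightarrow> ennreal (c * 2 powr \<gamma>) * (C * 0)"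
        unfolding \<delta>_def using C by (intro ennreal_tendsto_cmult) (auto simp: less_top)
      then show ?thesis by simp
    qed
  qed
qed

section \<open>Weak gradients of averages\<close>

text \<open>V and G live on the whole space, so that Fubini and translations apply freely, but the
  identity is tested only inside W: for functions cut off to W it may fail across the
  boundary.\<close>

definition weak_pair :: "'a::euclidean_space set \<Rightarrow> ('a \<Rightarrow> real) \<Rightarrow> ('a \<Rightarrow> 'a) \<Rightarrow> bool" where
  "weak_pair W V G \<longleftrightarrow> integrable lborel V \<and> integrable lborel G \<and>
     (\<forall>\<phi>\<in>test_functions W. \<forall>b\<in>Basis.
        (\<integral>x. V x * frechet_derivative \<phi> (at x) b \<partial>lborel) = - (\<integral>x. (G x \<bullet> b) * \<phi> x \<partial>lborel))"

lemma test_function_measurable: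
  assumes "\<phi> \<in> test_functions U"
  shows "\<phi> \<in> borel_measurable borel"
    and "b \<in> Basis \<Longrightarrow> (\<lambda>x. frechet_derivative \<phi> (at x) b) \<in> borel_measurable borel"
  using test_function_continuous[OF assms] test_function_partial_continuous[OF assms]
  by (auto intro: borel_measurable_continuous_onI)

text \<open>The test function is moved instead of V: \<phi>(x - h) is supported in W since U + h
  lies in W, and translation invariance moves the shift back.\<close>

lemma weak_pair_shift:
  assumes VG: "weak_pair W V G" and \<phi>: "\<phi> \<in> test_functions U" and b: "b \<in> Basis"
    and UW: "\<And>x. x \<in> U \<Longrightarrow> x + h \<in> W"
  shows "(\<integral>x. V (x + h) * frechet_derivative \<phi> (at x) b \<partial>lborel) = - (\<integral>x. (G (x + h) \<bullet> b) * \<phi> x \<partial>lborel)"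
proof -
  note [measurable] = test_function_measurable[OF \<phi>] test_function_measurable(2)[OF \<phi> b]
  have [measurable]: "V \<in> borel_measurable borel" "G \<in> borel_measurable borel"
    using VG by (auto simp: weak_pair_def)
  have "(\<lambda>x. \<phi> (x + - h)) \<in> test_functions W"
    by (rule test_function_shift[OF \<phi>]) (simp add: UW)
  then have "(\<integral>x. V x * frechet_derivative (\<lambda>x. \<phi> (x + - h)) (at x) b \<partial>lborel)
      = - (\<integral>x. (G x \<bullet> b) * \<phi> (x + - h) \<partial>lborel)"
    using VG b unfolding weak_pair_def by blast
  moreover have "frechet_derivative (\<lambda>x. \<phi> (x + - h)) (at x) = frechet_derivative \<phi> (at (x + - h))" for x
    by (rule frechet_derivative_shift(2)[OF test_function_differentiable[OF \<phi>]])
  moreover have "(\<integral>x. V (x + h) * frechet_derivative \<phi> (at x) b \<partial>lborel)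
      = (\<integral>x. V x * frechet_derivative \<phi> (at (x + - h)) b \<partial>lborel)"
    using integral_shift[of "\<lambda>x. V (x + h) * frechet_derivative \<phi> (at x) b" "- h"] by simp
  moreover have "(\<integral>x. (G (x + h) \<bullet> b) * \<phi> x \<partial>lborel) = (\<integral>x. (G x \<bullet> b) * \<phi> (x + - h) \<partial>lborel)"
    using integral_shift[of "\<lambda>x. (G (x + h) \<bullet> b) * \<phi> x" "- h"] by simp
  ultimately show ?thesis by simp
qed

text \<open>By translation invariance the integral of the majorant over x does not depend on t, so
  the outer integral only multiplies it by the finite mass of N.\<close>

lemma integrable_lborel_product_shift:
  fixes V :: "'a::euclidean_space \<Rightarrow> real"
  assumes "finite_measure N" and V: "integrable lborel V"
    and [measurable]: "s \<in> N \<rightarrow>\<^sub>M borel" "case_prod K \<in> borel_measurable (lborel \<Otimes>\<^sub>M N)"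
    and K: "\<And>x t. \<bar>K x t\<bar> \<le> C * \<bar>V (x + s t)\<bar>" and "C \<ge> 0"
  shows "integrable (lborel \<Otimes>\<^sub>M N) (case_prod K)"
proof (rule integrableI_bounded)
  interpret N: finite_measure N by fact
  interpret pair_sigma_finite lborel N ..
  have [measurable]: "V \<in> borel_measurable borel" using V by auto
  have "(\<integral>\<^sup>+p. ennreal (norm (case_prod K p)) \<partial>(lborel \<Otimes>\<^sub>M N)) = (\<integral>\<^sup>+t. (\<integral>\<^sup>+x. ennreal \<bar>K x t\<bar> \<partial>lborel) \<partial>N)"
    by (subst nn_integral_snd[symmetric]) auto
  also have "\<dots> \<le> (\<integral>\<^sup>+t. ennreal C * (\<integral>\<^sup>+x. ennreal \<bar>V x\<bar> \<partial>lborel) \<partial>N)"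
  proof (rule nn_integral_mono)
    fix t
    have "(\<integral>\<^sup>+x. ennreal \<bar>K x t\<bar> \<partial>lborel) \<le> (\<integral>\<^sup>+x. ennreal C * ennreal \<bar>V (x + s t)\<bar> \<partial>lborel)"
      using K assms(6) by (intro nn_integral_mono) (simp add: ennreal_leI flip: ennreal_mult)
    also have "\<dots> = ennreal C * (\<integral>\<^sup>+x. ennreal \<bar>V (x + s t)\<bar> \<partial>lborel)"
      by (rule nn_integral_cmult) measurable
    also have "(\<integral>\<^sup>+x. ennreal \<bar>V (x + s t)\<bar> \<partial>lborel) = (\<integral>\<^sup>+x. ennreal \<bar>V x\<bar> \<partial>lborel)"
      by (rule nn_integral_shift) measurable
    finally show "(\<integral>\<^sup>+x. ennreal \<bar>K x t\<bar> \<partial>lborel) \<le> ennreal C * (\<integral>\<^sup>+x. ennreal \<bar>V x\<bar> \<partial>lborel)" .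
  qed
  also have "\<dots> = ennreal C * (\<integral>\<^sup>+x. ennreal \<bar>V x\<bar> \<partial>lborel) * emeasure N (space N)" by simp
  also have "\<dots> < \<infinity>"
  proof -
    have "emeasure N (space N) < \<infinity>" using N.emeasure_finite by (simp add: less_top[symmetric])
    moreover have "(\<integral>\<^sup>+x. ennreal \<bar>V x\<bar> \<partial>lborel) < \<infinity>"
      using V by (simp add: integrable_iff_bounded)
    ultimately show ?thesis by (simp add: ennreal_mult_less_top)
  qed
  finally show "(\<integral>\<^sup>+p. ennreal (norm (case_prod K p)) \<partial>(lborel \<Otimes>\<^sub>M N)) < \<infinity>" .
qed fact

text \<open>The general shift s covers two uses: h in the unit cube shifted by \<epsilon> h, and t
  in [0, 1] shifted by t h along a segment.\<close>

lemma Fubini_shift: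
  fixes V :: "'a::euclidean_space \<Rightarrow> real"
  assumes N: "finite_measure N" and V: "integrable lborel V" and s: "s \<in> N \<rightarrow>\<^sub>M borel"
    and \<psi>: "\<psi> \<in> borel_measurable borel" and C: "\<And>x. \<bar>\<psi> x\<bar> \<le> C"
  shows "(\<integral>t. (\<integral>x. V (x + s t) * \<psi> x \<partial>lborel) \<partial>N) = (\<integral>x. (\<integral>t. V (x + s t) \<partial>N) * \<psi> x \<partial>lborel)"
    and "(\<integral>t. (\<integral>x. V x * \<psi> (x - s t) \<partial>lborel) \<partial>N) = (\<integral>x. V x * (\<integral>t. \<psi> (x - s t) \<partial>N) \<partial>lborel)"
    and "integrable lborel (\<lambda>x. \<integral>t. V (x + s t) \<partial>N)"
proof -
  interpret N: finite_measure N by fact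
  interpret pair_sigma_finite lborel N ..
  note [measurable] = s \<psi>
  have [measurable]: "V \<in> borel_measurable borel" using V by auto
  have C0: "C \<ge> 0" using C[of undefined] by linarith
  have CV: "\<bar>V x * \<psi> y\<bar> \<le> C * \<bar>V x\<bar>" for x y
    using mult_right_mono[OF C[of y], of "\<bar>V x\<bar>"] by (simp add: abs_mult mult.commute)
  have "integrable (lborel \<Otimes>\<^sub>M N) (\<lambda>(x, t). V (x + s t) * \<psi> x)"
    by (rule integrable_lborel_product_shift[OF N V s _ CV C0]) measurable
  from Fubini_integral[OF this]
  show "(\<integral>t. (\<integral>x. V (x + s t) * \<psi> x \<partial>lborel) \<partial>N) = (\<integral>x. (\<integral>t. V (x + s t) \<partial>N) * \<psi> x \<partial>lborel)"
    by simp
  have "integrable (lborel \<Otimes>\<^sub>M N) (\<lambda>(x, t). V x * \<psi> (x - s t))"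
    by (rule integrable_lborel_product_shift[OF N V, where s = "\<lambda>_. 0" and C = C])
       (auto simp: C0 CV)
  from Fubini_integral[OF this]
  show "(\<integral>t. (\<integral>x. V x * \<psi> (x - s t) \<partial>lborel) \<partial>N) = (\<integral>x. V x * (\<integral>t. \<psi> (x - s t) \<partial>N) \<partial>lborel)"
    by simp
  have "integrable (lborel \<Otimes>\<^sub>M N) (\<lambda>(x, t). V (x + s t))"
    by (rule integrable_lborel_product_shift[OF N V s, where C = 1]) auto
  from integrable_fst[OF this] show "integrable lborel (\<lambda>x. \<integral>t. V (x + s t) \<partial>N)" by simp
qed

lemma cube_avg_inner:
  assumes "integrable lborel G" "\<epsilon> > 0"
  shows "cube_avg \<epsilon> G x \<bullet> b = cube_avg \<epsilon> (\<lambda>y. G y \<bullet> b) x"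
  unfolding cube_avg_def by (simp add: integrable_unit_cube[OF assms] flip: integral_inner_left)

text \<open>Fubini turns the left side into an average over h of translated identities. Each holds
  by \<open>weak_pair_shift\<close>, because \<epsilon> h has norm at most \<epsilon> times the
  dimension and therefore does not leave W from U.\<close>

lemma weak_pair_cube_avg:
  fixes V :: "'a::euclidean_space \<Rightarrow> real" and \<epsilon> :: real
  assumes VG: "weak_pair W V G" and \<epsilon>: "\<epsilon> > 0" and \<phi>: "\<phi> \<in> test_functions U" and b: "b \<in> Basis"
    and UW: "\<And>x h. x \<in> U \<Longrightarrow> norm h \<le> \<epsilon> * DIM('a) \<Longrightarrow> x + h \<in> W"
  shows "(\<integral>x. cube_avg \<epsilon> V x * frechet_derivative \<phi> (at x) b \<partial>lborel) = - (\<integral>x. (cube_avg \<epsilon> G x \<bullet> b) * \<phi> x \<partial>lborel)"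
proof -
  have Vi: "integrable lborel V" and Gi: "integrable lborel G" using VG by (auto simp: weak_pair_def)
  have s: "(\<lambda>h. \<epsilon> *\<^sub>R h) \<in> unit_cube \<rightarrow>\<^sub>M borel" by measurable
  note [measurable] = test_function_measurable[OF \<phi>] test_function_measurable(2)[OF \<phi> b]
  obtain C where C: "\<And>x. \<bar>\<phi> x\<bar> \<le> C" using test_function_bounded[OF \<phi>] by metis
  obtain C' where C': "\<And>x. \<bar>frechet_derivative \<phi> (at x) b\<bar> \<le> C'"
    using test_function_partial_bounded[OF \<phi> b] by metis
  have "(\<integral>x. cube_avg \<epsilon> V x * frechet_derivative \<phi> (at x) b \<partial>lborel)
      = (\<integral>h. (\<integral>x. V (x + \<epsilon> *\<^sub>R h) * frechet_derivative \<phi> (at x) b \<partial>lborel) \<partial>unit_cube)"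
    unfolding cube_avg_def
    by (rule Fubini_shift(1)[OF finite_measure_unit_cube Vi s _ C', symmetric]) measurable
  also have "\<dots> = (\<integral>h. - (\<integral>x. (G (x + \<epsilon> *\<^sub>R h) \<bullet> b) * \<phi> x \<partial>lborel) \<partial>unit_cube)"
  proof (rule integral_cong_AE)
    have [measurable]: "V \<in> borel_measurable borel" "G \<in> borel_measurable borel" using Vi Gi by auto
    show "(\<lambda>h. \<integral>x. V (x + \<epsilon> *\<^sub>R h) * frechet_derivative \<phi> (at x) b \<partial>lborel) \<in> borel_measurable unit_cube"
      by (rule lborel.borel_measurable_lebesgue_integral) measurable
    have "(\<lambda>h. \<integral>x. (G (x + \<epsilon> *\<^sub>R h) \<bullet> b) * \<phi> x \<partial>lborel) \<in> borel_measurable unit_cube"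
      by (rule lborel.borel_measurable_lebesgue_integral) measurable
    then show "(\<lambda>h. - (\<integral>x. (G (x + \<epsilon> *\<^sub>R h) \<bullet> b) * \<phi> x \<partial>lborel)) \<in> borel_measurable unit_cube" by simp
    show "AE h in unit_cube. (\<integral>x. V (x + \<epsilon> *\<^sub>R h) * frechet_derivative \<phi> (at x) b \<partial>lborel)
        = - (\<integral>x. (G (x + \<epsilon> *\<^sub>R h) \<bullet> b) * \<phi> x \<partial>lborel)"
      using AE_unit_cube
    proof eventually_elim
      case (elim h)
      then have "norm (\<epsilon> *\<^sub>R h) \<le> \<epsilon> * DIM('a)" using norm_unit_cube_le \<epsilon> by simp
      then show ?case by (intro weak_pair_shift[OF VG \<phi> b] UW)
    qed
  qed
  also have "\<dots> = - (\<integral>x. cube_avg \<epsilon> (\<lambda>y. G y \<bullet> b) x * \<phi> x \<partial>lborel)"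
    unfolding cube_avg_def
    by (simp, rule Fubini_shift(1)[OF finite_measure_unit_cube _ s _ C]) (use Gi in auto)
  finally show ?thesis by (simp add: cube_avg_inner[OF Gi \<epsilon>])
qed

section \<open>Passage between Lebesgue measure on an open set and \<open>lborel\<close>\<close>

lemma integral_lebesgue_on_eq_lborel:
  fixes f :: "'a::euclidean_space \<Rightarrow> real"
  assumes "open U" and [measurable]: "f \<in> borel_measurable borel" and f0: "\<And>x. x \<notin> U \<Longrightarrow> f x = 0"
  shows "(\<integral>x. f x \<partial>lebesgue_on U) = (\<integral>x. f x \<partial>lborel)"
proof -
  have "U \<inter> space lebesgue \<in> sets lebesgue" using assms(1) by (simp add: borel_open)
  then have "(\<integral>x. f x \<partial>lebesgue_on U) = (\<integral>x. indicator U x *\<^sub>R f x \<partial>lebesgue)"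
    by (rule integral_restrict_space)
  also have "(\<lambda>x. indicator U x *\<^sub>R f x) = f" by (rule ext) (use f0 in \<open>auto simp: indicator_def\<close>)
  also have "(\<integral>x. f x \<partial>lebesgue) = (\<integral>x. f x \<partial>lborel)" by (rule integral_completion) measurable
  finally show ?thesis .
qed

lemma integrable_lborel_imp_L1_loc:
  fixes f :: "'a::euclidean_space \<Rightarrow> 'b::euclidean_space"
  assumes "integrable lborel f"
  shows "f \<in> L1_loc U"
proof -
  have "f absolutely_integrable_on K" if "compact K" for K
    unfolding set_integrable_def
    using assms that by (intro integrable_mult_indicator) (auto simp: integrable_completion compact_imp_closed borel_closed)
  then show ?thesis by (simp add: L1_loc_def)
qed

lemma fundamental_lemma_lborel:
  fixes f :: "'a::euclidean_space \<Rightarrow> real"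
  assumes "open U" "integrable lborel f"
    and "\<And>\<phi>. \<phi> \<in> test_functions U \<Longrightarrow> (\<integral>x. f x * \<phi> x \<partial>lborel) = 0"
  shows "AE x in lborel. x \<in> U \<longrightarrow> f x = 0"
proof -
  have "AE x in lebesgue_on U. f x = 0"
  proof (rule fundamental_lemma[OF assms(1) integrable_lborel_imp_L1_loc[OF assms(2)]])
    fix \<phi> assume \<phi>: "\<phi> \<in> test_functions U"
    note [measurable] = test_function_measurable(1)[OF \<phi>]
    have [measurable]: "f \<in> borel_measurable borel" using assms(2) by auto
    have "(\<integral>x. f x * \<phi> x \<partial>lebesgue_on U) = (\<integral>x. f x * \<phi> x \<partial>lborel)"
      using test_function_support(2)[OF \<phi>] not_in_support(1)[of _ \<phi>]
      by (intro integral_lebesgue_on_eq_lborel assms(1)) auto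
    then show "(\<integral>x. f x * \<phi> x \<partial>lebesgue_on U) = 0" using assms(3)[OF \<phi>] by simp
  qed
  then have "AE x in lebesgue. x \<in> U \<longrightarrow> f x = 0"
    using assms(1) by (simp add: AE_restrict_space_iff borel_open)
  then show ?thesis by (simp add: AE_completion_iff)
qed

lemma frechet_derivative_test_function_sum:
  fixes h :: "'a::euclidean_space"
  assumes "\<phi> \<in> test_functions U"
  shows "frechet_derivative \<phi> (at x) h = (\<Sum>b\<in>Basis. (h \<bullet> b) * frechet_derivative \<phi> (at x) b)"
proof -
  have l: "linear (frechet_derivative \<phi> (at x))"
    using test_function_differentiable[OF assms] linear_frechet_derivative by blast
  have "frechet_derivative \<phi> (at x) h = frechet_derivative \<phi> (at x) (\<Sum>b\<in>Basis. (h \<bullet> b) *\<^sub>R b)"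
    by (simp add: euclidean_representation)
  also have "\<dots> = (\<Sum>b\<in>Basis. (h \<bullet> b) * frechet_derivative \<phi> (at x) b)"
    by (simp add: linear_sum[OF l] linear_cmul[OF l])
  finally show ?thesis .
qed

text \<open>Tested against \<open>\<phi>\<close>, both sides become \<open>\<integral> V \<cdot> (\<phi>(\<cdot> - h) - \<phi>)\<close>.\<close>

lemma weak_pair_increment:
  fixes V :: "'a::euclidean_space \<Rightarrow> real"
  assumes VG: "weak_pair W V G" and U: "open U"
    and UW: "\<And>x t. x \<in> U \<Longrightarrow> 0 \<le> t \<Longrightarrow> t \<le> 1 \<Longrightarrow> x + t *\<^sub>R h \<in> W"
  shows "AE x in lborel. x \<in> U \<longrightarrow> V (x + h) - V x = (\<integral>t. G (x + t *\<^sub>R h) \<bullet> h \<partial>unit_cube)"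
proof -
  let ?N = "unit_cube :: real measure"
  have Vi: "integrable lborel V" and Gi: "integrable lborel G" using VG by (auto simp: weak_pair_def)
  have [measurable]: "V \<in> borel_measurable borel" "G \<in> borel_measurable borel" using Vi Gi by auto
  have Ghi: "integrable lborel (\<lambda>x. G x \<bullet> h)" using Gi by simp
  have s: "(\<lambda>t. t *\<^sub>R h) \<in> ?N \<rightarrow>\<^sub>M borel" by measurable
  define g where "g x = (\<integral>t. G (x + t *\<^sub>R h) \<bullet> h \<partial>?N)" for x
  have gi: "integrable lborel g"
    using Fubini_shift(3)[OF finite_measure_unit_cube Ghi s, of "\<lambda>_. 0" 0] by (simp add: g_def[abs_def])
  have "AE x in lborel. x \<in> U \<longrightarrow> V (x + h) - V x - g x = 0"
  proof (rule fundamental_lemma_lborel[OF U])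
    show "integrable lborel (\<lambda>x. V (x + h) - V x - g x)"
      using Vi gi integrable_shift[OF Vi, of h] by simp
    fix \<phi> assume \<phi>: "\<phi> \<in> test_functions U"
    note [measurable] = test_function_measurable(1)[OF \<phi>]
    obtain C where C: "\<And>x. \<bar>\<phi> x\<bar> \<le> C" using test_function_bounded[OF \<phi>] by metis
    \<comment> \<open>The derivative of \<phi> in direction h. Weak gradients are tested one
      coordinate at a time, hence the expansions of h in the basis below.\<close>
    define D where "D x = frechet_derivative \<phi> (at x) h" for x
    have D_cont: "continuous_on UNIV D"
      unfolding D_def frechet_derivative_test_function_sum[OF \<phi>, of _ h]
      by (intro continuous_intros test_function_partial_continuous[OF \<phi>])
    then have [measurable]: "D \<in> borel_measurable borel" by (rule borel_measurable_continuous_onI)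
    obtain C' where C': "\<And>x. \<bar>D x\<bar> \<le> C'"
      using continuous_compact_support_bounded[OF D_cont test_function_support(1)[OF \<phi>]] not_in_support(2)
      unfolding D_def by metis
    have int_mult: "integrable lborel (\<lambda>x. f x * \<psi> x)"
      if "integrable lborel f" "\<psi> \<in> borel_measurable borel" "\<And>x. \<bar>\<psi> x\<bar> \<le> c" for f \<psi> and c :: real
    proof (rule Bochner_Integration.integrable_bound)
      show "integrable lborel (\<lambda>x. c * f x)" using that(1) by simp
      show "(\<lambda>x. f x * \<psi> x) \<in> borel_measurable lborel" using that(1,2) by auto
      have "\<bar>f x\<bar> * \<bar>\<psi> x\<bar> \<le> \<bar>f x\<bar> * \<bar>c\<bar>" for x
        using that(3)[of x] by (intro mult_left_mono) auto
      then show "AE x in lborel. norm (f x * \<psi> x) \<le> norm (c * f x)"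
        by (simp add: abs_mult mult.commute)
    qed
    \<comment> \<open>As a function of t, -\<phi>(x - t h) has derivative
      \<open>D (x - t *\<^sub>R h)\<close>, the two signs cancelling; integrating over [0, 1]
      produces the increment of \<phi>.\<close>
    have FTC: "(\<integral>t. D (x - t *\<^sub>R h) \<partial>?N) = \<phi> x - \<phi> (x - h)" for x
    proof -
      have deriv: "((\<lambda>t. - \<phi> (x - t *\<^sub>R h)) has_real_derivative D (x - t *\<^sub>R h)) (at t)" for t
      proof -
        have "(\<phi> has_derivative frechet_derivative \<phi> (at (x - t *\<^sub>R h))) (at (x - t *\<^sub>R h))"
          using test_function_differentiable[OF \<phi>] frechet_derivative_works by blast
        moreover have "((\<lambda>t. x - t *\<^sub>R h) has_derivative (\<lambda>u. - (u *\<^sub>R h))) (at t)"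
          by (auto intro!: derivative_eq_intros)
        ultimately have "((\<lambda>t. \<phi> (x - t *\<^sub>R h)) has_derivative (\<lambda>u. frechet_derivative \<phi> (at (x - t *\<^sub>R h)) (- (u *\<^sub>R h)))) (at t)"
          by (rule has_derivative_compose[rotated])
        moreover have "linear (frechet_derivative \<phi> (at (x - t *\<^sub>R h)))"
          using test_function_differentiable[OF \<phi>] linear_frechet_derivative by blast
        ultimately have "((\<lambda>t. \<phi> (x - t *\<^sub>R h)) has_derivative (\<lambda>u. - (u * D (x - t *\<^sub>R h)))) (at t)"
          by (simp add: linear_neg linear_cmul D_def)
        from has_derivative_minus[OF this] show ?thesis
          by (simp add: has_field_derivative_def mult_commute_abs)
      qed
      have "(\<integral>t. D (x - t *\<^sub>R h) \<partial>?N) = (\<integral>t. D (x - t *\<^sub>R h) \<partial>density lborel (\<lambda>t. ennreal (indicator {0..1} t)))"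
        by (simp add: unit_cube_def ennreal_indicator)
      also have "\<dots> = (\<integral>t. D (x - t *\<^sub>R h) * indicator {0..1} t \<partial>lborel)"
        by (subst integral_density) (auto simp: mult.commute)
      also have "\<dots> = - \<phi> (x - 1 *\<^sub>R h) - - \<phi> (x - 0 *\<^sub>R h)"
      proof (rule integral_FTC_Icc_real[OF _ deriv])
        have "continuous_on UNIV (\<lambda>t. D (x - t *\<^sub>R h))"
          by (rule continuous_on_compose2[OF D_cont]) (auto intro!: continuous_intros)
        then show "isCont (\<lambda>t. D (x - t *\<^sub>R h)) t" for t
          by (simp add: continuous_on_eq_continuous_at)
      qed simp
      finally show ?thesis by simp
    qed
    have shift: "(\<integral>x. V (x + c) * \<psi> x \<partial>lborel) = (\<integral>x. V x * \<psi> (x - c) \<partial>lborel)"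
      if [measurable]: "\<psi> \<in> borel_measurable borel" for \<psi> c
      using integral_shift[of "\<lambda>x. V (x + c) * \<psi> x" "- c"] by simp
    have inner: "(\<integral>x. (G (x + t *\<^sub>R h) \<bullet> h) * \<phi> x \<partial>lborel) = - (\<integral>x. V x * D (x - t *\<^sub>R h) \<partial>lborel)"
      if t: "t \<in> {0..1}" for t
    proof -
      have "(\<integral>x. (G (x + t *\<^sub>R h) \<bullet> h) * \<phi> x \<partial>lborel)
          = (\<integral>x. (\<Sum>b\<in>Basis. (h \<bullet> b) * ((G (x + t *\<^sub>R h) \<bullet> b) * \<phi> x)) \<partial>lborel)"
        by (simp add: euclidean_inner[of _ h] sum_distrib_left mult_ac)
      also have "\<dots> = (\<Sum>b\<in>Basis. (h \<bullet> b) * (\<integral>x. (G (x + t *\<^sub>R h) \<bullet> b) * \<phi> x \<partial>lborel))"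
      proof -
        have "integrable lborel (\<lambda>x. (G (x + t *\<^sub>R h) \<bullet> b) * \<phi> x)" for b
          using integrable_shift[OF Gi, of "t *\<^sub>R h"] by (intro int_mult[OF _ _ C]) auto
        then show ?thesis by (subst Bochner_Integration.integral_sum) auto
      qed
      also have "\<dots> = (\<Sum>b\<in>Basis. (h \<bullet> b) * - (\<integral>x. V (x + t *\<^sub>R h) * frechet_derivative \<phi> (at x) b \<partial>lborel))"
        using weak_pair_shift[OF VG \<phi> _ UW, of _ t] t by simp
      also have "\<dots> = - (\<integral>x. (\<Sum>b\<in>Basis. (h \<bullet> b) * (V (x + t *\<^sub>R h) * frechet_derivative \<phi> (at x) b)) \<partial>lborel)"
      proof -
        have "integrable lborel (\<lambda>x. V (x + t *\<^sub>R h) * frechet_derivative \<phi> (at x) b)" if b: "b \<in> Basis" for b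
        proof -
          obtain c where "\<And>x. \<bar>frechet_derivative \<phi> (at x) b\<bar> \<le> c"
            using test_function_partial_bounded[OF \<phi> b] by metis
          then show ?thesis
            using integrable_shift[OF Vi, of "t *\<^sub>R h"] test_function_measurable(2)[OF \<phi> b] by (intro int_mult) auto
        qed
        then show ?thesis by (subst Bochner_Integration.integral_sum) (auto simp: sum_negf)
      qed
      also have "\<dots> = - (\<integral>x. V (x + t *\<^sub>R h) * D x \<partial>lborel)"
        by (simp add: D_def frechet_derivative_test_function_sum[OF \<phi>, of _ h] sum_distrib_left mult_ac)
      also have "\<dots> = - (\<integral>x. V x * D (x - t *\<^sub>R h) \<partial>lborel)" by (simp add: shift)
      finally show ?thesis .
    qed
    \<comment> \<open>The integral of g \<phi> reaches the increment of \<phi> in four moves: Fubini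
      outwards, the weak identity for each t, Fubini back inwards, and the fundamental theorem of
      calculus along the segment.\<close>
    have "(\<integral>x. g x * \<phi> x \<partial>lborel) = (\<integral>t. (\<integral>x. (G (x + t *\<^sub>R h) \<bullet> h) * \<phi> x \<partial>lborel) \<partial>?N)"
      unfolding g_def by (rule Fubini_shift(1)[OF finite_measure_unit_cube Ghi s _ C, symmetric]) measurable
    also have "\<dots> = (\<integral>t. - (\<integral>x. V x * D (x - t *\<^sub>R h) \<partial>lborel) \<partial>?N)"
    proof (rule integral_cong_AE)
      show "(\<lambda>t. \<integral>x. (G (x + t *\<^sub>R h) \<bullet> h) * \<phi> x \<partial>lborel) \<in> borel_measurable ?N"
        by (rule lborel.borel_measurable_lebesgue_integral) measurable
      have "(\<lambda>t. \<integral>x. V x * D (x - t *\<^sub>R h) \<partial>lborel) \<in> borel_measurable ?N"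
        by (rule lborel.borel_measurable_lebesgue_integral) measurable
      then show "(\<lambda>t. - (\<integral>x. V x * D (x - t *\<^sub>R h) \<partial>lborel)) \<in> borel_measurable ?N" by simp
      show "AE t in ?N. (\<integral>x. (G (x + t *\<^sub>R h) \<bullet> h) * \<phi> x \<partial>lborel) = - (\<integral>x. V x * D (x - t *\<^sub>R h) \<partial>lborel)"
        using AE_unit_cube by eventually_elim (rule inner, simp)
    qed
    also have "\<dots> = - (\<integral>x. V x * (\<phi> x - \<phi> (x - h)) \<partial>lborel)"
    proof -
      have "(\<integral>t. (\<integral>x. V x * D (x - t *\<^sub>R h) \<partial>lborel) \<partial>?N) = (\<integral>x. V x * (\<integral>t. D (x - t *\<^sub>R h) \<partial>?N) \<partial>lborel)"
        by (rule Fubini_shift(2)[OF finite_measure_unit_cube Vi s _ C']) measurable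
      then show ?thesis by (simp add: FTC)
    qed
    also have "\<dots> = (\<integral>x. V x * \<phi> (x - h) \<partial>lborel) - (\<integral>x. V x * \<phi> x \<partial>lborel)"
    proof -
      have "integrable lborel (\<lambda>x. V x * \<phi> x)" "integrable lborel (\<lambda>x. V x * \<phi> (x - h))"
        by (rule int_mult[OF Vi _ C], measurable)+
      then show ?thesis by (simp add: right_diff_distrib)
    qed
    also have "(\<integral>x. V x * \<phi> (x - h) \<partial>lborel) = (\<integral>x. V (x + h) * \<phi> x \<partial>lborel)"
      by (simp add: shift)
    finally have "(\<integral>x. g x * \<phi> x \<partial>lborel) = (\<integral>x. V (x + h) * \<phi> x \<partial>lborel) - (\<integral>x. V x * \<phi> x \<partial>lborel)" .
    moreover have "integrable lborel (\<lambda>x. V x * \<phi> x)" "integrable lborel (\<lambda>x. V (x + h) * \<phi> x)" "integrable lborel (\<lambda>x. g x * \<phi> x)"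
      using Vi gi integrable_shift[OF Vi, of h] by (auto intro!: int_mult[OF _ _ C])
    ultimately show "(\<integral>x. (V (x + h) - V x - g x) * \<phi> x \<partial>lborel) = 0"
      by (simp add: left_diff_distrib)
  qed
  then show ?thesis unfolding g_def by eventually_elim simp
qed

text \<open>Jensen's inequality over t, Cauchy-Schwarz for the product with h, and translation
  invariance for each t. With |G|^p integrated over the whole space, the moving set U + t h leaves
  no trace on the right.\<close>

lemma weak_pair_translation_Lp:
  fixes V :: "'a::euclidean_space \<Rightarrow> real"
  assumes VG: "weak_pair W V G" and U: "open U" and p: "p > 1"
    and UW: "\<And>x t. x \<in> U \<Longrightarrow> 0 \<le> t \<Longrightarrow> t \<le> 1 \<Longrightarrow> x + t *\<^sub>R h \<in> W"
  shows "(\<integral>\<^sup>+x. ennreal (\<bar>V (x + h) - V x\<bar> powr p) * indicator U x \<partial>lborel)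
    \<le> ennreal (norm h powr p) * (\<integral>\<^sup>+x. ennreal (norm (G x) powr p) \<partial>lborel)"
proof -
  let ?N = "unit_cube :: real measure"
  have [measurable]: "G \<in> borel_measurable borel" using VG by (auto simp: weak_pair_def)
  have le: "ennreal (\<bar>\<integral>t. G (x + t *\<^sub>R h) \<bullet> h \<partial>?N\<bar> powr p)
      \<le> ennreal (norm h powr p) * (\<integral>\<^sup>+t. ennreal (norm (G (x + t *\<^sub>R h)) powr p) \<partial>?N)" for x
  proof -
    have "\<bar>\<integral>t. G (x + t *\<^sub>R h) \<bullet> h \<partial>?N\<bar> \<le> (\<integral>t. \<bar>G (x + t *\<^sub>R h) \<bullet> h\<bar> \<partial>?N)"
      by (rule integral_abs_bound)
    then have "ennreal (\<bar>\<integral>t. G (x + t *\<^sub>R h) \<bullet> h \<partial>?N\<bar> powr p) \<le> ennreal ((\<integral>t. \<bar>G (x + t *\<^sub>R h) \<bullet> h\<bar> \<partial>?N) powr p)"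
      using p by (intro ennreal_leI powr_mono2) auto
    also have "\<dots> \<le> (\<integral>\<^sup>+t. ennreal (\<bar>G (x + t *\<^sub>R h) \<bullet> h\<bar> powr p) \<partial>?N)"
      by (intro power_mean_inequality p) auto
    also have "\<dots> \<le> (\<integral>\<^sup>+t. ennreal (norm h powr p) * ennreal (norm (G (x + t *\<^sub>R h)) powr p) \<partial>?N)"
    proof (rule nn_integral_mono)
      fix t
      have "\<bar>G (x + t *\<^sub>R h) \<bullet> h\<bar> powr p \<le> (norm (G (x + t *\<^sub>R h)) * norm h) powr p"
        using p by (intro powr_mono2 Cauchy_Schwarz_ineq2) auto
      then show "ennreal (\<bar>G (x + t *\<^sub>R h) \<bullet> h\<bar> powr p) \<le> ennreal (norm h powr p) * ennreal (norm (G (x + t *\<^sub>R h)) powr p)"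
        by (simp add: powr_mult mult.commute ennreal_leI flip: ennreal_mult)
    qed
    also have "\<dots> = ennreal (norm h powr p) * (\<integral>\<^sup>+t. ennreal (norm (G (x + t *\<^sub>R h)) powr p) \<partial>?N)"
      by (rule nn_integral_cmult) measurable
    finally show ?thesis .
  qed
  have inc: "AE x in lborel. x \<in> U \<longrightarrow> V (x + h) - V x = (\<integral>t. G (x + t *\<^sub>R h) \<bullet> h \<partial>?N)"
    by (rule weak_pair_increment[OF VG U UW])
  have "(\<integral>\<^sup>+x. ennreal (\<bar>V (x + h) - V x\<bar> powr p) * indicator U x \<partial>lborel)
      \<le> (\<integral>\<^sup>+x. ennreal (norm h powr p) * (\<integral>\<^sup>+t. ennreal (norm (G (x + t *\<^sub>R h)) powr p) \<partial>?N) \<partial>lborel)"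
  proof (rule nn_integral_mono_AE)
    show "AE x in lborel. ennreal (\<bar>V (x + h) - V x\<bar> powr p) * indicator U x
        \<le> ennreal (norm h powr p) * (\<integral>\<^sup>+t. ennreal (norm (G (x + t *\<^sub>R h)) powr p) \<partial>?N)"
      using inc
    proof eventually_elim
      case (elim x)
      then show ?case using le[of x] by (cases "x \<in> U") auto
    qed
  qed
  also have "\<dots> = ennreal (norm h powr p) * (\<integral>\<^sup>+x. (\<integral>\<^sup>+t. ennreal (norm (G (x + t *\<^sub>R h)) powr p) \<partial>?N) \<partial>lborel)"
    by (rule nn_integral_cmult) measurable
  also have "(\<integral>\<^sup>+x. (\<integral>\<^sup>+t. ennreal (norm (G (x + t *\<^sub>R h)) powr p) \<partial>?N) \<partial>lborel)
      = (\<integral>\<^sup>+t. (\<integral>\<^sup>+x. ennreal (norm (G (x + t *\<^sub>R h)) powr p) \<partial>lborel) \<partial>?N)"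
    by (rule lborel_unit_cube.Fubini'[symmetric]) measurable
  also have "\<dots> = (\<integral>\<^sup>+t. (\<integral>\<^sup>+x. ennreal (norm (G x) powr p) \<partial>lborel) \<partial>?N)"
    by (intro nn_integral_cong nn_integral_shift) measurable
  also have "\<dots> = (\<integral>\<^sup>+x. ennreal (norm (G x) powr p) \<partial>lborel)" by simp
  finally show ?thesis .
qed

text \<open>Jensen's inequality reduces the claim to increments by \<epsilon> h, each bounded by
  \<open>weak_pair_translation_Lp\<close>. Besides convergence, the estimate yields that V lies in
  L^p on U, as it bounds the distance of V from a bounded function.\<close>

lemma cube_avg_minus_Lp:
  fixes V :: "'a::euclidean_space \<Rightarrow> real" and \<epsilon> :: real
  assumes VG: "weak_pair W V G" and U: "open U" and p: "p > 1" and \<epsilon>: "\<epsilon> > 0"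
    and UW: "\<And>x h. x \<in> U \<Longrightarrow> norm h \<le> \<epsilon> * DIM('a) \<Longrightarrow> x + h \<in> W"
  shows "(\<integral>\<^sup>+x. ennreal (\<bar>cube_avg \<epsilon> V x - V x\<bar> powr p) * indicator U x \<partial>lborel)
    \<le> ennreal ((\<epsilon> * DIM('a)) powr p) * (\<integral>\<^sup>+x. ennreal (norm (G x) powr p) \<partial>lborel)"
proof -
  let ?M = "unit_cube :: 'a measure"
  have Vi: "integrable lborel V" using VG by (auto simp: weak_pair_def)
  then have [measurable]: "V \<in> borel_measurable borel" by auto
  have [measurable]: "U \<in> sets borel" using U by simp
  have le: "ennreal (\<bar>cube_avg \<epsilon> V x - V x\<bar> powr p) \<le> (\<integral>\<^sup>+h. ennreal (\<bar>V (x + \<epsilon> *\<^sub>R h) - V x\<bar> powr p) \<partial>?M)" for x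
  proof -
    have "cube_avg \<epsilon> V x - V x = (\<integral>h. V (x + \<epsilon> *\<^sub>R h) - V x \<partial>?M)"
      using integrable_unit_cube[OF Vi \<epsilon>] by (simp add: cube_avg_def measure_def)
    then have "\<bar>cube_avg \<epsilon> V x - V x\<bar> \<le> (\<integral>h. \<bar>V (x + \<epsilon> *\<^sub>R h) - V x\<bar> \<partial>?M)"
      using integral_abs_bound by metis
    then have "ennreal (\<bar>cube_avg \<epsilon> V x - V x\<bar> powr p) \<le> ennreal ((\<integral>h. \<bar>V (x + \<epsilon> *\<^sub>R h) - V x\<bar> \<partial>?M) powr p)"
      using p by (intro ennreal_leI powr_mono2) auto
    also have "\<dots> \<le> (\<integral>\<^sup>+h. ennreal (\<bar>V (x + \<epsilon> *\<^sub>R h) - V x\<bar> powr p) \<partial>?M)"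
      by (intro power_mean_inequality p) auto
    finally show ?thesis .
  qed
  have "(\<integral>\<^sup>+x. ennreal (\<bar>cube_avg \<epsilon> V x - V x\<bar> powr p) * indicator U x \<partial>lborel)
      \<le> (\<integral>\<^sup>+x. (\<integral>\<^sup>+h. ennreal (\<bar>V (x + \<epsilon> *\<^sub>R h) - V x\<bar> powr p) \<partial>?M) * indicator U x \<partial>lborel)"
    using le by (intro nn_integral_mono mult_right_mono) auto
  also have "\<dots> = (\<integral>\<^sup>+x. (\<integral>\<^sup>+h. ennreal (\<bar>V (x + \<epsilon> *\<^sub>R h) - V x\<bar> powr p) * indicator U x \<partial>?M) \<partial>lborel)"
    by (intro nn_integral_cong nn_integral_multc[symmetric]) measurable
  also have "\<dots> = (\<integral>\<^sup>+h. (\<integral>\<^sup>+x. ennreal (\<bar>V (x + \<epsilon> *\<^sub>R h) - V x\<bar> powr p) * indicator U x \<partial>lborel) \<partial>?M)"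
    by (rule lborel_unit_cube.Fubini'[symmetric]) measurable
  also have "\<dots> \<le> (\<integral>\<^sup>+h. ennreal ((\<epsilon> * DIM('a)) powr p) * (\<integral>\<^sup>+x. ennreal (norm (G x) powr p) \<partial>lborel) \<partial>?M)"
  proof (rule nn_integral_mono_AE)
    show "AE h in ?M. (\<integral>\<^sup>+x. ennreal (\<bar>V (x + \<epsilon> *\<^sub>R h) - V x\<bar> powr p) * indicator U x \<partial>lborel)
        \<le> ennreal ((\<epsilon> * DIM('a)) powr p) * (\<integral>\<^sup>+x. ennreal (norm (G x) powr p) \<partial>lborel)"
      using AE_unit_cube
    proof eventually_elim
      case (elim h)
      have nh: "norm (\<epsilon> *\<^sub>R h) \<le> \<epsilon> * DIM('a)" using norm_unit_cube_le[OF elim] \<epsilon> by simp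
      have "(\<integral>\<^sup>+x. ennreal (\<bar>V (x + \<epsilon> *\<^sub>R h) - V x\<bar> powr p) * indicator U x \<partial>lborel)
          \<le> ennreal (norm (\<epsilon> *\<^sub>R h) powr p) * (\<integral>\<^sup>+x. ennreal (norm (G x) powr p) \<partial>lborel)"
      proof (rule weak_pair_translation_Lp[OF VG U p UW])
        \<comment> \<open>The factor t only shortens the step, so the whole segment stays within
          reach of \<open>UW\<close>.\<close>
        fix t :: real assume "0 \<le> t" "t \<le> 1"
        then have "norm (t *\<^sub>R \<epsilon> *\<^sub>R h) \<le> norm (\<epsilon> *\<^sub>R h)"
          using \<epsilon> by (simp add: abs_mult mult.assoc mult_left_le_one_le)
        with nh show "norm (t *\<^sub>R \<epsilon> *\<^sub>R h) \<le> \<epsilon> * DIM('a)" by linarith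
      qed
      also have "\<dots> \<le> ennreal ((\<epsilon> * DIM('a)) powr p) * (\<integral>\<^sup>+x. ennreal (norm (G x) powr p) \<partial>lborel)"
        using nh p by (intro mult_right_mono ennreal_leI powr_mono2) auto
      finally show ?case .
    qed
  qed
  also have "\<dots> = ennreal ((\<epsilon> * DIM('a)) powr p) * (\<integral>\<^sup>+x. ennreal (norm (G x) powr p) \<partial>lborel)" by simp
  finally show ?thesis .
qed

section \<open>Uniqueness of weak gradients and Borel representatives\<close>

lemma integrable_lebesgue_borel_version_real:
  fixes f :: "'a::euclidean_space \<Rightarrow> real"
  assumes "integrable lebesgue f"
  obtains f' where "integrable lborel f'" "AE x in lebesgue. f x = f' x"
proof -
  obtain f' where [measurable]: "f' \<in> borel_measurable lborel" and ae: "AE x in lborel. f x = f' x"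
    using completion_ex_borel_measurable_real[of f lborel] assms by auto
  have ae': "AE x in lebesgue. f x = f' x" using ae by (rule AE_completion)
  have "integrable lebesgue f'"
    using integrable_cong_AE_imp[OF assms _ ae']
    by (simp add: measurable_completion)
  then have "integrable lborel f'" by (simp add: integrable_completion)
  with ae' that show ?thesis by blast
qed

text \<open>The real case is applied to each coordinate; the finitely many exceptional null sets are
  united.\<close>

lemma integrable_lebesgue_borel_version:
  fixes f :: "'a::euclidean_space \<Rightarrow> 'b::euclidean_space"
  assumes "integrable lebesgue f"
  obtains f' where "integrable lborel f'" "AE x in lebesgue. f x = f' x"
proof -
  have "\<forall>b. \<exists>h. integrable lborel h \<and> (AE x in lebesgue. f x \<bullet> b = h x)"
    using integrable_lebesgue_borel_version_real[of "\<lambda>x. f x \<bullet> b" for b] assms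
    by (metis integrable_inner_left)
  then obtain h where h: "\<And>b. integrable lborel (h b)" "\<And>b. AE x in lebesgue. f x \<bullet> b = h b x" by metis
  have "AE x in lebesgue. \<forall>b\<in>Basis. f x \<bullet> b = h b x"
    unfolding AE_ball_countable[OF countable_finite[OF finite_Basis]] using h(2) by simp
  then have "AE x in lebesgue. f x = (\<Sum>b\<in>Basis. h b x *\<^sub>R b)"
  proof eventually_elim
    case (elim x)
    then have "(\<Sum>b\<in>Basis. h b x *\<^sub>R b) = (\<Sum>b\<in>Basis. (f x \<bullet> b) *\<^sub>R b)" by simp
    then show ?case by (simp add: euclidean_representation)
  qed
  moreover have "integrable lborel (\<lambda>x. \<Sum>b\<in>Basis. h b x *\<^sub>R b)" using h(1) by auto
  ultimately show ?thesis using that by blast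
qed

text \<open>\<open>weak_gradient\<close> is a representative about which nothing is known pointwise;
  completeness of Lebesgue measure carries measurability over to it from an explicit one.\<close>

lemma borel_measurable_lebesgue_on_AE:
  fixes f g :: "'a::euclidean_space \<Rightarrow> 'b::euclidean_space"
  assumes "g \<in> borel_measurable (lebesgue_on U)" "AE x in lebesgue_on U. g x = f x" "U \<in> sets lebesgue"
  shows "f \<in> borel_measurable (lebesgue_on U)"
proof -
  have U: "U \<inter> space lebesgue \<in> sets lebesgue" using assms(3) by simp
  have "(\<lambda>x. indicator U x *\<^sub>R g x) \<in> borel_measurable lebesgue"
    using assms(1) borel_measurable_restrict_space_iff[OF U] by blast
  moreover have "AE x in lebesgue. x \<in> U \<longrightarrow> g x = f x"
    using assms(2) by (simp only: AE_restrict_space_iff[OF U])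
  then have "AE x in lebesgue. indicator U x *\<^sub>R g x = indicator U x *\<^sub>R f x"
    by eventually_elim (auto simp: indicator_def)
  ultimately have "(\<lambda>x. indicator U x *\<^sub>R f x) \<in> borel_measurable lebesgue"
    by (rule borel_measurable_AE)
  then show ?thesis using borel_measurable_restrict_space_iff[OF U] by blast
qed

lemma L1_loc_mono: "U \<subseteq> W \<Longrightarrow> L1_loc W \<subseteq> L1_loc U"
  by (auto simp: L1_loc_def)

lemma L1_loc_diff: "f \<in> L1_loc U \<Longrightarrow> g \<in> L1_loc U \<Longrightarrow> (\<lambda>x. f x - g x) \<in> L1_loc U"
  by (auto simp: L1_loc_def)

lemma L1_loc_inner: "g \<in> L1_loc U \<Longrightarrow> (\<lambda>x. g x \<bullet> b) \<in> L1_loc U"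
  by (auto simp: L1_loc_def set_integrable_def simp flip: inner_scaleR_left)

lemma L1_loc_bounded_borel:
  fixes f :: "'a::euclidean_space \<Rightarrow> 'b::euclidean_space"
  assumes [measurable]: "f \<in> borel_measurable borel" and C: "\<And>x. norm (f x) \<le> C"
  shows "f \<in> L1_loc U"
proof -
  have "f absolutely_integrable_on K" if K: "compact K" for K
  proof -
    have [measurable]: "K \<in> sets borel" using K by (simp add: compact_imp_closed borel_closed)
    have "integrable lborel (\<lambda>x. indicator K x *\<^sub>R f x)"
    proof (rule Bochner_Integration.integrable_bound)
      show "integrable lborel (\<lambda>x. indicator K x * C)"
        using emeasure_lborel_cbox_finite emeasure_compact_finite[OF K] by simp
      show "AE x in lborel. norm (indicator K x *\<^sub>R f x) \<le> norm (indicator K x * C)"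
        by (intro AE_I2) (auto simp: indicator_def intro: order_trans[OF C abs_ge_self])
    qed measurable
    then show ?thesis by (simp add: set_integrable_def integrable_completion)
  qed
  then show ?thesis by (simp add: L1_loc_def)
qed

text \<open>Since \<psi> vanishes off the compact set K, the product is the integrable cut-off of f
  to K times a bounded function.\<close>

lemma integrable_L1_loc_test:
  fixes f :: "'a::euclidean_space \<Rightarrow> real"
  assumes "open U" and f: "f \<in> L1_loc U" and K: "compact K" "K \<subseteq> U"
    and \<psi>: "\<psi> \<in> borel_measurable borel" "\<And>x. \<bar>\<psi> x\<bar> \<le> C" "\<And>x. x \<notin> K \<Longrightarrow> \<psi> x = 0"
  shows "integrable (lebesgue_on U) (\<lambda>x. f x * \<psi> x)"
proof -
  have U: "U \<inter> space lebesgue \<in> sets lebesgue" using assms(1) by (simp add: borel_open)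
  have fi: "integrable lebesgue (\<lambda>x. indicator K x * f x)"
    using f K by (simp add: L1_loc_def set_integrable_def)
  have "integrable lebesgue (\<lambda>x. indicator K x * f x * \<psi> x)"
  proof (rule Bochner_Integration.integrable_bound)
    show "integrable lebesgue (\<lambda>x. C * (indicator K x * f x))" using fi by simp
    have "\<psi> \<in> borel_measurable lebesgue" using \<psi>(1) by (simp add: measurable_completion)
    then show "(\<lambda>x. indicator K x * f x * \<psi> x) \<in> borel_measurable lebesgue"
      by (rule borel_measurable_times[OF borel_measurable_integrable[OF fi]])
    have "\<bar>indicator K x * f x\<bar> * \<bar>\<psi> x\<bar> \<le> \<bar>indicator K x * f x\<bar> * \<bar>C\<bar>" for x
      using \<psi>(2)[of x] by (intro mult_left_mono) auto
    then show "AE x in lebesgue. norm (indicator K x * f x * \<psi> x) \<le> norm (C * (indicator K x * f x))"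
      by (simp add: abs_mult mult_ac)
  qed
  moreover have "indicator K x * f x * \<psi> x = indicator U x *\<^sub>R (f x * \<psi> x)" for x
    using K(2) \<psi>(3)[of x] by (auto simp: indicator_def)
  ultimately show ?thesis by (simp add: integrable_restrict_space[OF U])
qed

lemma integrable_test_function:
  assumes "open U" "f \<in> L1_loc U" "\<phi> \<in> test_functions U"
  shows "integrable (lebesgue_on U) (\<lambda>x. f x * \<phi> x)"
    and "b \<in> Basis \<Longrightarrow> integrable (lebesgue_on U) (\<lambda>x. f x * frechet_derivative \<phi> (at x) b)"
proof -
  note supp = test_function_support[OF assms(3)] and meas = test_function_measurable[OF assms(3)]
  obtain C where "\<And>x. \<bar>\<phi> x\<bar> \<le> C" using test_function_bounded[OF assms(3)] by metis
  from integrable_L1_loc_test[OF assms(1,2) supp meas(1) this] not_in_support(1)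
  show "integrable (lebesgue_on U) (\<lambda>x. f x * \<phi> x)" by blast
  show "integrable (lebesgue_on U) (\<lambda>x. f x * frechet_derivative \<phi> (at x) b)" if b: "b \<in> Basis"
  proof -
    obtain C where "\<And>x. \<bar>frechet_derivative \<phi> (at x) b\<bar> \<le> C"
      using test_function_partial_bounded[OF assms(3) b] by metis
    from integrable_L1_loc_test[OF assms(1,2) supp meas(2)[OF b] this] show ?thesis
      by (simp add: not_in_support(2))
  qed
qed

text \<open>Local integrability makes all products with test functions integrable, which is what
  permits splitting the integrals of differences.\<close>

lemma has_weak_gradient_diff:
  assumes U: "open U" and u: "has_weak_gradient U u g" and v: "has_weak_gradient U v h"
  shows "has_weak_gradient U (\<lambda>x. u x - v x) (\<lambda>x. g x - h x)"
  unfolding has_weak_gradient_def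
proof (intro conjI ballI)
  have L: "u \<in> L1_loc U" "v \<in> L1_loc U" "g \<in> L1_loc U" "h \<in> L1_loc U"
    using u v by (auto simp: has_weak_gradient_def)
  then show "(\<lambda>x. u x - v x) \<in> L1_loc U" "(\<lambda>x. g x - h x) \<in> L1_loc U"
    by (auto intro: L1_loc_diff)
  fix \<phi> :: "'a \<Rightarrow> real" and b :: 'a assume \<phi>: "\<phi> \<in> test_functions U" and b: "b \<in> Basis"
  note i = integrable_test_function(2)[OF U L(1) \<phi> b] integrable_test_function(2)[OF U L(2) \<phi> b]
    integrable_test_function(1)[OF U L1_loc_inner[OF L(3)] \<phi>, of b]
    integrable_test_function(1)[OF U L1_loc_inner[OF L(4)] \<phi>, of b]
  have "(\<integral>x. u x * frechet_derivative \<phi> (at x) b \<partial>lebesgue_on U) = - (\<integral>x. (g x \<bullet> b) * \<phi> x \<partial>lebesgue_on U)"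
    "(\<integral>x. v x * frechet_derivative \<phi> (at x) b \<partial>lebesgue_on U) = - (\<integral>x. (h x \<bullet> b) * \<phi> x \<partial>lebesgue_on U)"
    using u v \<phi> b by (auto simp: has_weak_gradient_def)
  then show "(\<integral>x. (u x - v x) * frechet_derivative \<phi> (at x) b \<partial>lebesgue_on U)
      = - (\<integral>x. ((g x - h x) \<bullet> b) * \<phi> x \<partial>lebesgue_on U)"
    using i by (simp add: left_diff_distrib inner_diff_left)
qed

text \<open>The difference g - h is a weak gradient of the zero function, so the fundamental lemma
  applies to each of its coordinates.\<close>

lemma has_weak_gradient_unique:
  fixes g h :: "'a::euclidean_space \<Rightarrow> 'a"
  assumes U: "open U" and "has_weak_gradient U v g" "has_weak_gradient U v h"
  shows "AE x in lebesgue_on U. g x = h x"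
proof -
  have d: "has_weak_gradient U (\<lambda>x. v x - v x) (\<lambda>x. g x - h x)"
    by (rule has_weak_gradient_diff) fact+
  have "AE x in lebesgue_on U. (g x - h x) \<bullet> b = 0" if b: "b \<in> Basis" for b
  proof (rule fundamental_lemma[OF U])
    show "(\<lambda>x. (g x - h x) \<bullet> b) \<in> L1_loc U"
      using d by (intro L1_loc_inner) (simp add: has_weak_gradient_def)
    show "(\<integral>x. (g x - h x) \<bullet> b * \<phi> x \<partial>lebesgue_on U) = 0" if "\<phi> \<in> test_functions U" for \<phi>
      using d that b by (auto simp: has_weak_gradient_def)
  qed
  then have "AE x in lebesgue_on U. \<forall>b\<in>Basis. (g x - h x) \<bullet> b = 0"
    unfolding AE_ball_countable[OF countable_finite[OF finite_Basis]] by simp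
  then show ?thesis
    by eventually_elim (auto intro: euclidean_eqI simp: inner_diff_left)
qed

lemma weak_gradient_AE_eq:
  assumes "open U" "has_weak_gradient U v g"
  shows "AE x in lebesgue_on U. weak_gradient U v x = g x"
proof (rule has_weak_gradient_unique[OF assms(1) _ assms(2)])
  show "has_weak_gradient U v (weak_gradient U v)"
    unfolding weak_gradient_def by (rule someI[where P = "has_weak_gradient U v", OF assms(2)])
qed

text \<open>A test function of U is one of W and vanishes off U together with its derivative, so
  passing from U to W changes no integral.\<close>

lemma has_weak_gradient_subset:
  assumes "open U" "open W" "U \<subseteq> W" and v: "has_weak_gradient W v g"
  shows "has_weak_gradient U v g"
  unfolding has_weak_gradient_def
proof (intro conjI ballI)
  show "v \<in> L1_loc U" "g \<in> L1_loc U"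
    using v L1_loc_mono[OF assms(3)] by (auto simp: has_weak_gradient_def)
  fix \<phi> :: "'a \<Rightarrow> real" and b :: 'a assume \<phi>: "\<phi> \<in> test_functions U" and b: "b \<in> Basis"
  have sets: "U \<inter> space lebesgue \<in> sets lebesgue" "W \<inter> space lebesgue \<in> sets lebesgue"
    using assms(1,2) by (simp_all add: borel_open)
  have eq: "(\<integral>x. f x \<partial>lebesgue_on U) = (\<integral>x. f x \<partial>lebesgue_on W)" if "\<And>x. x \<notin> U \<Longrightarrow> f x = 0" for f :: "'a \<Rightarrow> real"
  proof -
    have "(\<lambda>x. indicator U x *\<^sub>R f x) = (\<lambda>x. indicator W x *\<^sub>R f x)"
      using that assms(3) by (intro ext) (auto simp: indicator_def)
    then show ?thesis
      by (simp only: integral_restrict_space[OF sets(1)] integral_restrict_space[OF sets(2)])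
  qed
  have off: "\<phi> x = 0" "frechet_derivative \<phi> (at x) = (\<lambda>_. 0)" if "x \<notin> U" for x
    using not_in_support[of x \<phi>] test_function_support(2)[OF \<phi>] that by blast+
  have "\<phi> \<in> test_functions W" using \<phi> test_functions_mono[OF assms(3)] by blast
  then have "(\<integral>x. v x * frechet_derivative \<phi> (at x) b \<partial>lebesgue_on W) = - (\<integral>x. (g x \<bullet> b) * \<phi> x \<partial>lebesgue_on W)"
    using v b by (simp add: has_weak_gradient_def)
  then show "(\<integral>x. v x * frechet_derivative \<phi> (at x) b \<partial>lebesgue_on U) = - (\<integral>x. (g x \<bullet> b) * \<phi> x \<partial>lebesgue_on U)"
    by (simp add: eq off)
qed

text \<open>Test functions of W see nothing outside W, so cutting off to W and changing values on
  null sets preserve the identity.\<close>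

lemma weak_pair_if_has_weak_gradient:
  assumes "open W" "open \<Omega>" "W \<subseteq> \<Omega>" and v: "has_weak_gradient \<Omega> v g"
    and V: "integrable lborel V" "AE x in lebesgue. indicator W x * v x = V x"
    and G: "integrable lborel G" "AE x in lebesgue. indicator W x *\<^sub>R g x = G x"
  shows "weak_pair W V G"
  unfolding weak_pair_def
proof (intro conjI ballI V(1) G(1))
  fix \<phi> :: "'a \<Rightarrow> real" and b :: 'a assume \<phi>: "\<phi> \<in> test_functions W" and b: "b \<in> Basis"
  have W: "has_weak_gradient W v g" by (rule has_weak_gradient_subset) fact+
  have sets: "W \<inter> space lebesgue \<in> sets lebesgue" using assms(1) by (simp add: borel_open)
  note [measurable] = test_function_measurable(1)[OF \<phi>] test_function_measurable(2)[OF \<phi> b]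
  have [measurable]: "V \<in> borel_measurable borel" "G \<in> borel_measurable borel" using V G by auto
  have eq: "(\<integral>x. f x * \<psi> x \<partial>lebesgue_on W) = (\<integral>x. F x * \<psi> x \<partial>lborel)"
    if "AE x in lebesgue. indicator W x * f x = F x" and [measurable]: "F \<in> borel_measurable borel" "\<psi> \<in> borel_measurable borel"
      and i: "integrable (lebesgue_on W) (\<lambda>x. f x * \<psi> x)" for f F \<psi> :: "'a \<Rightarrow> real"
  proof -
    have "(\<integral>x. f x * \<psi> x \<partial>lebesgue_on W) = (\<integral>x. indicator W x *\<^sub>R (f x * \<psi> x) \<partial>lebesgue)"
      by (rule integral_restrict_space[OF sets])
    also have "\<dots> = (\<integral>x. F x * \<psi> x \<partial>lebesgue)"
    proof (rule integral_cong_AE)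
      show "(\<lambda>x. indicator W x *\<^sub>R (f x * \<psi> x)) \<in> borel_measurable lebesgue"
        using i integrable_restrict_space[OF sets, of "\<lambda>x. f x * \<psi> x"] by blast
      show "(\<lambda>x. F x * \<psi> x) \<in> borel_measurable lebesgue" by (intro measurable_completion) measurable
      show "AE x in lebesgue. indicator W x *\<^sub>R (f x * \<psi> x) = F x * \<psi> x"
        using that(1) by eventually_elim (simp add: mult.assoc[symmetric])
    qed
    also have "\<dots> = (\<integral>x. F x * \<psi> x \<partial>lborel)" by (rule integral_completion) measurable
    finally show ?thesis .
  qed
  have L: "v \<in> L1_loc W" "g \<in> L1_loc W" using W by (auto simp: has_weak_gradient_def)
  have Gb: "AE x in lebesgue. indicator W x * (g x \<bullet> b) = G x \<bullet> b"
    using G(2) by eventually_elim (metis inner_scaleR_left real_scaleR_def)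
  have "(\<integral>x. v x * frechet_derivative \<phi> (at x) b \<partial>lebesgue_on W) = - (\<integral>x. (g x \<bullet> b) * \<phi> x \<partial>lebesgue_on W)"
    using W \<phi> b by (simp add: has_weak_gradient_def)
  moreover have "(\<integral>x. v x * frechet_derivative \<phi> (at x) b \<partial>lebesgue_on W) = (\<integral>x. V x * frechet_derivative \<phi> (at x) b \<partial>lborel)"
    by (rule eq[OF V(2) _ _ integrable_test_function(2)[OF assms(1) L(1) \<phi> b]]) measurable
  moreover have "(\<integral>x. (g x \<bullet> b) * \<phi> x \<partial>lebesgue_on W) = (\<integral>x. (G x \<bullet> b) * \<phi> x \<partial>lborel)"
    by (rule eq[OF Gb _ _ integrable_test_function(1)[OF assms(1) L1_loc_inner[OF L(2)] \<phi>]]) measurable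
  ultimately show "(\<integral>x. V x * frechet_derivative \<phi> (at x) b \<partial>lborel) = - (\<integral>x. (G x \<bullet> b) * \<phi> x \<partial>lborel)"
    by simp
qed

lemma has_weak_gradient_cube_avg:
  fixes V :: "'a::euclidean_space \<Rightarrow> real" and \<epsilon> :: real
  assumes VG: "weak_pair W V G" and \<epsilon>: "\<epsilon> > 0" and U: "open U"
    and UW: "\<And>x h. x \<in> U \<Longrightarrow> norm h \<le> \<epsilon> * DIM('a) \<Longrightarrow> x + h \<in> W"
  shows "has_weak_gradient U (cube_avg \<epsilon> V) (cube_avg \<epsilon> G)"
  unfolding has_weak_gradient_def
proof (intro conjI ballI)
  have Vi: "integrable lborel V" and Gi: "integrable lborel G" using VG by (auto simp: weak_pair_def)
  have [measurable]: "V \<in> borel_measurable borel" "G \<in> borel_measurable borel" using Vi Gi by auto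
  show "cube_avg \<epsilon> V \<in> L1_loc U"
    by (rule L1_loc_bounded_borel[OF _ cube_avg_le_norm[OF Vi \<epsilon>]]) measurable
  show "cube_avg \<epsilon> G \<in> L1_loc U"
    by (rule L1_loc_bounded_borel[OF _ cube_avg_le_norm[OF Gi \<epsilon>]]) measurable
  fix \<phi> :: "'a \<Rightarrow> real" and b :: 'a assume \<phi>: "\<phi> \<in> test_functions U" and b: "b \<in> Basis"
  note [measurable] = test_function_measurable(1)[OF \<phi>] test_function_measurable(2)[OF \<phi> b]
  have off: "\<phi> x = 0" "frechet_derivative \<phi> (at x) = (\<lambda>_. 0)" if "x \<notin> U" for x
    using not_in_support[of x \<phi>] test_function_support(2)[OF \<phi>] that by blast+
  have "(\<integral>x. cube_avg \<epsilon> V x * frechet_derivative \<phi> (at x) b \<partial>lebesgue_on U) = (\<integral>x. cube_avg \<epsilon> V x * frechet_derivative \<phi> (at x) b \<partial>lborel)"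
    by (rule integral_lebesgue_on_eq_lborel[OF U]) (auto simp: off)
  also have "\<dots> = - (\<integral>x. (cube_avg \<epsilon> G x \<bullet> b) * \<phi> x \<partial>lborel)"
    by (rule weak_pair_cube_avg[OF VG \<epsilon> \<phi> b UW])
  also have "(\<integral>x. (cube_avg \<epsilon> G x \<bullet> b) * \<phi> x \<partial>lborel) = (\<integral>x. (cube_avg \<epsilon> G x \<bullet> b) * \<phi> x \<partial>lebesgue_on U)"
    by (rule integral_lebesgue_on_eq_lborel[OF U, symmetric]) (auto simp: off)
  finally show "(\<integral>x. cube_avg \<epsilon> V x * frechet_derivative \<phi> (at x) b \<partial>lebesgue_on U)
      = - (\<integral>x. (cube_avg \<epsilon> G x \<bullet> b) * \<phi> x \<partial>lebesgue_on U)" .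
qed

section \<open>Lebesgue spaces and representatives\<close>

lemma Lp_AE_cong:
  fixes f g :: "'a::euclidean_space \<Rightarrow> 'b::euclidean_space"
  assumes g: "g \<in> Lp p U" and ae: "AE x in lebesgue_on U. g x = f x" and U: "U \<in> sets lebesgue"
  shows "f \<in> Lp p U"
proof -
  have f: "f \<in> borel_measurable (lebesgue_on U)"
    using g by (intro borel_measurable_lebesgue_on_AE[OF _ ae U]) (simp add: Lp_def)
  moreover have "integrable (lebesgue_on U) (\<lambda>x. norm (f x) powr p)"
  proof (rule integrable_cong_AE_imp)
    show "integrable (lebesgue_on U) (\<lambda>x. norm (g x) powr p)" using g by (simp add: Lp_def)
    show "(\<lambda>x. norm (f x) powr p) \<in> borel_measurable (lebesgue_on U)" using f by measurable
    show "AE x in lebesgue_on U. norm (g x) powr p = norm (f x) powr p"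
      using ae by eventually_elim simp
  qed
  ultimately show ?thesis by (simp add: Lp_def)
qed

lemma Linf_AE_cong:
  fixes f g :: "'a::euclidean_space \<Rightarrow> 'b::euclidean_space"
  assumes g: "g \<in> Linf U" and ae: "AE x in lebesgue_on U. g x = f x" and U: "U \<in> sets lebesgue"
  shows "f \<in> Linf U"
proof -
  have "f \<in> borel_measurable (lebesgue_on U)"
    using g by (intro borel_measurable_lebesgue_on_AE[OF _ ae U]) (simp add: Linf_def)
  moreover obtain C where "AE x in lebesgue_on U. norm (g x) \<le> C" using g by (auto simp: Linf_def)
  with ae have "AE x in lebesgue_on U. norm (f x) \<le> C" by eventually_elim simp
  ultimately show ?thesis by (auto simp: Linf_def)
qed

lemma borel_measurable_imp_lebesgue_on:
  "f \<in> borel_measurable borel \<Longrightarrow> f \<in> borel_measurable (lebesgue_on U)"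
  by (intro measurable_restrict_space1 measurable_completion) simp

lemma nn_integral_lebesgue_on:
  assumes "U \<in> sets borel"
  shows "(\<integral>\<^sup>+x. f x \<partial>lebesgue_on U) = (\<integral>\<^sup>+x. f x * indicator U x \<partial>lborel)"
proof -
  have "U \<inter> space lebesgue \<in> sets lebesgue" using assms by simp
  then show ?thesis by (simp add: nn_integral_restrict_space nn_integral_completion)
qed

lemma Linf_borel:
  fixes f :: "'a::euclidean_space \<Rightarrow> 'b::euclidean_space"
  assumes "f \<in> borel_measurable borel" "\<And>x. norm (f x) \<le> C"
  shows "f \<in> Linf U"
  using assms by (auto simp: Linf_def borel_measurable_imp_lebesgue_on)

lemma Lp_borel:
  fixes f :: "'a::euclidean_space \<Rightarrow> 'b::euclidean_space"
  assumes [measurable]: "f \<in> borel_measurable borel" and U: "U \<in> sets borel"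
    and fin: "(\<integral>\<^sup>+x. ennreal (norm (f x) powr p) * indicator U x \<partial>lborel) < \<infinity>"
  shows "f \<in> Lp p U"
proof -
  have "integrable (lebesgue_on U) (\<lambda>x. norm (f x) powr p)"
  proof (rule integrableI_bounded)
    show "(\<lambda>x. norm (f x) powr p) \<in> borel_measurable (lebesgue_on U)"
      by (rule borel_measurable_imp_lebesgue_on) measurable
    show "(\<integral>\<^sup>+x. ennreal (norm (norm (f x) powr p)) \<partial>lebesgue_on U) < \<infinity>"
      using fin by (simp add: nn_integral_lebesgue_on[OF U])
  qed
  then show ?thesis by (simp add: Lp_def borel_measurable_imp_lebesgue_on)
qed

section \<open>Approximation of the multi-phase energy\<close>

text \<open>f is the pointwise limit of its cut-offs to growing balls, each of which is
  integrable.\<close>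

lemma L1_loc_UNIV_measurable:
  fixes f :: "'a::euclidean_space \<Rightarrow> real"
  assumes "f \<in> L1_loc UNIV"
  shows "f \<in> borel_measurable lebesgue"
proof (rule borel_measurable_LIMSEQ_real)
  show "(\<lambda>n. indicator (cball 0 (real n)) x * f x) \<longlonglongrightarrow> f x" for x
  proof (rule tendsto_eventually)
    have "\<forall>\<^sub>F n in sequentially. norm x \<le> real n"
      using eventually_ge_at_top[of "nat \<lceil>norm x\<rceil>"] by eventually_elim linarith
    then show "\<forall>\<^sub>F n in sequentially. indicator (cball 0 (real n)) x * f x = f x"
      by eventually_elim simp
  qed
  show "(\<lambda>x. indicator (cball 0 (real n)) x * f x) \<in> borel_measurable lebesgue" for n
    using assms by (intro borel_measurable_integrable) (simp add: L1_loc_def set_integrable_def)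
qed

text \<open>The maximum with 0 makes the Borel version non-negative everywhere, not just almost
  everywhere, as the weighted bound asks of it.\<close>

lemma muckenhoupt_borel_version:
  assumes "\<omega> \<in> muckenhoupt \<gamma>"
  obtains b where "b \<in> borel_measurable borel" "\<And>x. 0 \<le> b x" "AE x in lebesgue. \<omega> x = b x"
proof -
  have "\<omega> \<in> borel_measurable (completion lborel)"
    using assms by (intro L1_loc_UNIV_measurable) (simp add: muckenhoupt_def)
  then obtain b where b: "b \<in> borel_measurable lborel" "AE x in lborel. \<omega> x = b x"
    using completion_ex_borel_measurable_real by blast
  have nn: "0 \<le> \<omega> x" for x using assms by (simp add: muckenhoupt_def)
  have "AE x in lebesgue. \<omega> x = max 0 (b x)"
    using AE_completion[OF b(2)] by eventually_elim (metis max.absorb2 nn)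
  with b(1) show ?thesis by (intro that[of "\<lambda>x. max 0 (b x)"]) auto
qed

text \<open>Two additive bounds take the place of an absolute difference, which is awkward in
  \<open>ennreal\<close>; as E is finite, the truncated lower bound E - D m tends to E.\<close>

lemma nn_integral_squeeze_tendsto:
  fixes E :: ennreal
  assumes "\<And>m. F m \<le> E + D m" "\<And>m. E \<le> F m + D m" "D \<longlonglongrightarrow> 0" "E < \<infinity>"
  shows "F \<longlonglongrightarrow> E"
proof (rule tendsto_sandwich)
  show "\<forall>\<^sub>F m in sequentially. E - D m \<le> F m"
    using assms(2,4) by (intro always_eventually allI) (auto simp: ennreal_minus_le_iff add.commute)
  show "\<forall>\<^sub>F m in sequentially. F m \<le> E + D m" using assms(1) by simp
  show "(\<lambda>m. E + D m) \<longlonglongrightarrow> E" using tendsto_add[OF tendsto_const assms(3), of E] by simp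
  show "(\<lambda>m. E - D m) \<longlonglongrightarrow> E"
    using tendsto_diff_ennreal[OF tendsto_const assms(3), of E] assms(4) by simp
qed

lemma AE_lebesgue_on_if:
  assumes "AE x in lebesgue. P x" "U \<in> sets lebesgue"
  shows "AE x in lebesgue_on U. P x"
proof -
  have "U \<inter> space lebesgue \<in> sets lebesgue" using assms(2) by simp
  then show ?thesis using assms(1) by (auto simp: AE_restrict_space_iff elim: eventually_mono)
qed

text \<open>Ties the real integrals inside \<open>W1p_norm\<close> to extended ones, for which the
  estimates are proved; were the latter \<infinity>, both sides would be 0.\<close>

lemma integral_lebesgue_on_eq_enn2real:
  fixes f :: "'a::euclidean_space \<Rightarrow> real"
  assumes [measurable]: "f' \<in> borel_measurable borel" and ae: "AE x in lebesgue_on U. f x = f' x"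
    and "\<And>x. 0 \<le> f' x" and U: "U \<in> sets borel"
  shows "(\<integral>x. f x \<partial>lebesgue_on U) = enn2real (\<integral>\<^sup>+x. ennreal (f' x) * indicator U x \<partial>lborel)"
proof -
  have f': "f' \<in> borel_measurable (lebesgue_on U)" by (rule borel_measurable_imp_lebesgue_on) measurable
  have "f \<in> borel_measurable (lebesgue_on U)"
    by (rule borel_measurable_lebesgue_on_AE[OF f']) (use ae U in \<open>auto elim: eventually_mono\<close>)
  then have "(\<integral>x. f x \<partial>lebesgue_on U) = (\<integral>x. f' x \<partial>lebesgue_on U)"
    using f' ae by (intro integral_cong_AE)
  also have "\<dots> = enn2real (\<integral>\<^sup>+x. ennreal (f' x) \<partial>lebesgue_on U)"
    by (rule integral_eq_nn_integral[OF f']) (simp add: assms(3))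
  finally show ?thesis by (simp add: nn_integral_lebesgue_on[OF U])
qed

lemma multi_phase_approximation:
  fixes v :: "'a::euclidean_space \<Rightarrow> real"
  assumes \<Omega>: "open \<Omega>" and p: "p > 1" and q: "\<And>i. i \<in> {1..N} \<Longrightarrow> q i > 1"
    and a: "\<And>i. i \<in> {1..N} \<Longrightarrow> a i \<in> muckenhoupt (q i)"
    and v: "v \<in> W11_loc \<Omega>" and UW: "ball y r \<Subset> ball z R" and W\<Omega>: "ball z R \<Subset> \<Omega>"
    and fin: "energy N p q a \<Omega> v (ball z R) < \<infinity>"
  shows "\<exists>w. (\<forall>m. w m \<in> W1inf (ball y r)) \<and> converges_W1p p (ball y r) w v \<and>
    (\<lambda>m. energy N p q a (ball y r) (w m) (ball y r)) \<longlonglongrightarrow> energy N p q a \<Omega> v (ball y r)"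
proof -
  define U where "U = ball y r"
  define W where "W = ball z R"
  define n where "n = real DIM('a)"
  have n: "n > 0" by (simp add: n_def)
  have U: "open U" and W: "open W" and [measurable]: "U \<in> sets borel" "W \<in> sets borel"
    and Ul: "U \<in> sets lebesgue" and Wl: "W \<in> sets lebesgue" by (auto simp: U_def W_def)
  have sub: "closure U \<subseteq> W" "compact (closure U)" "closure W \<subseteq> \<Omega>" "compact (closure W)"
    using UW W\<Omega> by (auto simp: U_def W_def compactly_inside_def)
  then have subs: "U \<subseteq> W" "W \<subseteq> \<Omega>" "U \<subseteq> \<Omega>" using closure_subset by blast+

  define g where "g = weak_gradient \<Omega> v"
  have hg: "has_weak_gradient \<Omega> v g"
  proof -
    obtain g' where "has_weak_gradient \<Omega> v g'" using v by (auto simp: W11_loc_def)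
    then show ?thesis
      unfolding g_def weak_gradient_def by (rule someI[where P = "has_weak_gradient \<Omega> v"])
  qed
  \<comment> \<open>The closure of W is compact and inside \<Omega>, so functions locally integrable
    on \<Omega> have integrable cut-offs to W.\<close>
  have loc: "integrable lebesgue (\<lambda>x. indicator W x *\<^sub>R f x)" if "f \<in> L1_loc \<Omega>" for f :: "'a \<Rightarrow> 'c::euclidean_space"
  proof -
    have "set_integrable lebesgue (closure W) f" using that sub by (simp add: L1_loc_def)
    then have "set_integrable lebesgue W f"
      by (rule set_integrable_subset) (use Wl closure_subset in auto)
    then show ?thesis by (simp add: set_integrable_def)
  qed
  have "integrable lebesgue (\<lambda>x. indicator W x *\<^sub>R v x)"
    using hg by (intro loc) (simp add: has_weak_gradient_def)
  then obtain V where Vi: "integrable lborel V" and V: "AE x in lebesgue. indicator W x *\<^sub>R v x = V x"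
    by (rule integrable_lebesgue_borel_version)
  have "integrable lebesgue (\<lambda>x. indicator W x *\<^sub>R g x)"
    using hg by (intro loc) (simp add: has_weak_gradient_def)
  \<comment> \<open>G vanishes almost everywhere off W, so finite energy on W becomes finiteness of
    integrals over the whole space.\<close>
  then obtain G where Gi: "integrable lborel G" and G: "AE x in lebesgue. indicator W x *\<^sub>R g x = G x"
    by (rule integrable_lebesgue_borel_version)
  have [measurable]: "V \<in> borel_measurable borel" "G \<in> borel_measurable borel" using Vi Gi by auto
  have VG: "weak_pair W V G"
    by (rule weak_pair_if_has_weak_gradient[OF W \<Omega> subs(2) hg Vi _ Gi G]) (use V in simp)
  have vV: "AE x in lebesgue_on U. v x = V x"
    using AE_lebesgue_on_if[OF V Ul] AE_space[of "lebesgue_on U"] by eventually_elim (use subs in auto)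
  have gG: "AE x in lebesgue_on W. g x = G x"
    using AE_lebesgue_on_if[OF G Wl] AE_space[of "lebesgue_on W"] by eventually_elim auto
  have gGU: "AE x in lebesgue_on U. g x = G x"
    using AE_lebesgue_on_if[OF G Ul] AE_space[of "lebesgue_on U"] by eventually_elim (use subs in auto)

  obtain e where e: "e > 0" "(\<Union>x\<in>closure U. ball x e) \<subseteq> W"
    using compact_subset_open_imp_ball_epsilon_subset[OF sub(2) W sub(1)] by metis
  \<comment> \<open>Chosen so that \<epsilon> m times the dimension is at most e/2, where e is the
    room around the closure of U inside W: cubes that start in U stay in W.\<close>
  define \<epsilon> where "\<epsilon> m = e / (2 * n) * inverse (real (Suc m))" for m
  have \<epsilon>: "\<epsilon> m > 0" for m using e n by (simp add: \<epsilon>_def)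
  have \<epsilon>0: "\<epsilon> \<longlonglongrightarrow> 0"
    using tendsto_mult[OF tendsto_const LIMSEQ_inverse_real_of_nat, of "e / (2 * n)"] by (simp add: \<epsilon>_def[abs_def])
  have inside: "x + h \<in> W" if "x \<in> U" "norm h \<le> \<epsilon> m * real DIM('a)" for x h m
  proof -
    have "\<epsilon> m * n = e / 2 * inverse (real (Suc m))" using n by (simp add: \<epsilon>_def)
    also have "\<dots> \<le> e / 2 * 1" using e by (intro mult_left_mono) (auto simp: inverse_le_1_iff)
    also have "\<dots> < e" using e by simp
    finally have "x + h \<in> ball x e" using that by (simp add: n_def dist_norm)
    then show ?thesis using e(2) that(1) closure_subset[of U] by blast
  qed
  define w where "w m = cube_avg (\<epsilon> m) V" for m
  define Gm where "Gm m = cube_avg (\<epsilon> m) G" for m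
  have [measurable]: "w m \<in> borel_measurable borel" "Gm m \<in> borel_measurable borel" for m
    unfolding w_def Gm_def by measurable
  have hw: "has_weak_gradient U (w m) (Gm m)" for m
    unfolding w_def Gm_def by (rule has_weak_gradient_cube_avg[OF VG \<epsilon> U inside])
  have hv: "has_weak_gradient U v g" by (rule has_weak_gradient_subset[OF U \<Omega> subs(3) hg])
  have wgw: "AE x in lebesgue_on U. weak_gradient U (w m) x = Gm m x" for m
    by (rule weak_gradient_AE_eq[OF U hw])
  have wgv: "AE x in lebesgue_on U. weak_gradient U v x = G x"
    using weak_gradient_AE_eq[OF U hv] gGU by eventually_elim simp
  \<comment> \<open>The norm of w m - v involves the gradient representative chosen for the
    difference itself, which has to be identified on its own.\<close>
  have wgd: "AE x in lebesgue_on U. weak_gradient U (\<lambda>x. w m x - v x) x = Gm m x - G x" for m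
    using weak_gradient_AE_eq[OF U has_weak_gradient_diff[OF U hw hv]] gGU by eventually_elim simp
  have wb: "norm (w m x) \<le> (\<integral>y. norm (V y) \<partial>lborel) / \<epsilon> m ^ DIM('a)" for m x
    unfolding w_def by (rule cube_avg_le_norm[OF Vi \<epsilon>])
  have Gb: "norm (Gm m x) \<le> (\<integral>y. norm (G y) \<partial>lborel) / \<epsilon> m ^ DIM('a)" for m x
    unfolding Gm_def by (rule cube_avg_le_norm[OF Gi \<epsilon>])
  have GmG: "AE x in lborel. (\<lambda>m. Gm m x) \<longlonglongrightarrow> G x"
    using cube_avg_tendsto[OF Gi]
  proof eventually_elim
    case (elim x)
    have "filterlim \<epsilon> (at_right 0) sequentially"
      using \<epsilon>0 \<epsilon> by (intro tendsto_imp_filterlim_at_right) auto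
    from filterlim_compose[OF elim this] show ?case by (simp add: Gm_def)
  qed

  \<comment> \<open>Index 0 stands for the phase t^p with weight 1, so that the integrand of the
    energy is one sum over i \<le> N.\<close>
  define \<sigma> where "\<sigma> i = (if i = 0 then p else q i)" for i
  have "\<forall>i\<in>{1..N}. \<exists>b. b \<in> borel_measurable borel \<and> (\<forall>x. 0 \<le> b x) \<and> (AE x in lebesgue. a i x = b x)"
    using muckenhoupt_borel_version a by metis
  then obtain b where b: "\<And>i. i \<in> {1..N} \<Longrightarrow> b i \<in> borel_measurable borel"
    "\<And>i x. i \<in> {1..N} \<Longrightarrow> 0 \<le> b i x" "\<And>i. i \<in> {1..N} \<Longrightarrow> AE x in lebesgue. a i x = b i x"
    by metis
  define \<beta> where "\<beta> i x = (if i = 0 then 1 else if i \<le> N then b i x else 0)" for i x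
  have \<beta>_eq: "\<beta> i = b i" "\<sigma> i = q i" if "i \<in> {1..N}" for i using that by (auto simp: \<beta>_def \<sigma>_def)
  have \<beta>0_eq: "\<beta> 0 = (\<lambda>_. 1)" "\<sigma> 0 = p" by (auto simp: \<beta>_def \<sigma>_def)
  have cases: "i = 0 \<or> i \<in> {1..N}" if "i \<le> N" for i using that by auto
  have \<beta>m[measurable]: "\<beta> i \<in> borel_measurable borel" for i
  proof (cases "i \<in> {1..N}")
    case True
    then show ?thesis using \<beta>_eq b by simp
  next
    case False
    then have "\<beta> i = (\<lambda>_. if i = 0 then 1 else 0)" by (auto simp: \<beta>_def)
    then show ?thesis by simp
  qed
  have \<beta>0: "0 \<le> \<beta> i x" for i x using b(2)[of i x] by (auto simp: \<beta>_def)
  have \<sigma>: "\<sigma> i > 1" if "i \<le> N" for i using that p q[of i] by (auto simp: \<sigma>_def)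
  \<comment> \<open>One constant serves all m; this uniformity is what makes the part of G above a
    large height negligible for all averages at once.\<close>
  have \<beta>_bounded: "\<exists>C<\<infinity>. \<forall>m F. integrable lborel F \<longrightarrow> (\<forall>x. 0 \<le> F x) \<longrightarrow>
      (\<integral>\<^sup>+x. ennreal (cube_avg (\<epsilon> m) F x powr \<sigma> i * \<beta> i x) \<partial>lborel)
        \<le> C * (\<integral>\<^sup>+x. ennreal (F x powr \<sigma> i * \<beta> i x) \<partial>lborel)" if "i \<le> N" for i
    using cases[OF that]
  proof
    assume i: "i = 0"
    show ?thesis
    proof (intro exI[of _ 1] conjI allI impI)
      fix m and F :: "'a \<Rightarrow> real" assume F: "integrable lborel F" "\<forall>x. 0 \<le> F x"
      have "F \<in> borel_measurable borel" using F(1) by auto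
      then show "(\<integral>\<^sup>+x. ennreal (cube_avg (\<epsilon> m) F x powr \<sigma> i * \<beta> i x) \<partial>lborel)
          \<le> 1 * (\<integral>\<^sup>+x. ennreal (F x powr \<sigma> i * \<beta> i x) \<partial>lborel)"
        using cube_avg_Lp_bounded[OF p, of F "\<epsilon> m"] F(2) by (simp add: i \<beta>0_eq)
    qed simp
  next
    assume i: "i \<in> {1..N}"
    define C where "C = ennreal ((unit_ball_vol DIM('a) * (DIM('a) + 1) ^ DIM('a)) powr q i * (DIM('a) + 1) ^ DIM('a))
        * muckenhoupt_const (q i) (a i)"
    have "C < \<infinity>" using a[OF i] by (simp add: C_def muckenhoupt_def ennreal_mult_less_top)
    moreover have "(\<integral>\<^sup>+x. ennreal (cube_avg (\<epsilon> m) F x powr q i * b i x) \<partial>lborel)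
        \<le> C * (\<integral>\<^sup>+x. ennreal (F x powr q i * b i x) \<partial>lborel)"
      if "integrable lborel F" "\<forall>x. 0 \<le> F x" for m F
      unfolding C_def
      by (rule cube_avg_muckenhoupt_bounded[OF a[OF i] q[OF i] \<epsilon> b(3)[OF i] b(2)[OF i] b(1)[OF i]]) (use that in auto)
    ultimately show ?thesis unfolding \<beta>_eq[OF i] by blast
  qed
  have \<beta>_loc: "(\<integral>\<^sup>+x. ennreal (\<beta> i x) * indicator U x \<partial>lborel) < \<infinity>" if "i \<le> N" for i
    using cases[OF that]
  proof
    assume "i = 0"
    then show ?thesis using emeasure_lborel_ball_finite[of y r] by (simp add: \<beta>0_eq U_def)
  next
    assume i: "i \<in> {1..N}"
    have "integrable lebesgue (\<lambda>x. indicator (closure U) x * a i x)"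
      using a[OF i] sub(2) by (simp add: muckenhoupt_def L1_loc_def set_integrable_def)
    then have "(\<integral>\<^sup>+x. ennreal (norm (indicator (closure U) x * a i x)) \<partial>lebesgue) < \<infinity>"
      by (simp add: integrable_iff_bounded)
    moreover have "(\<integral>\<^sup>+x. ennreal (b i x) * indicator U x \<partial>lebesgue) \<le> (\<integral>\<^sup>+x. ennreal (norm (indicator (closure U) x * a i x)) \<partial>lebesgue)"
      using b(3)[OF i] closure_subset[of U]
      by (intro nn_integral_mono_AE) (auto elim!: eventually_mono simp: indicator_def intro!: ennreal_leI)
    ultimately show ?thesis by (simp add: \<beta>_eq[OF i] nn_integral_completion)
  qed

  define M where "M x t = (\<Sum>i\<le>N. \<beta> i x * t powr \<sigma> i)" for x t
  have M_meas[measurable]: "(\<lambda>x. M x (f x)) \<in> borel_measurable borel" if [measurable]: "f \<in> borel_measurable borel" for f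
    unfolding M_def by measurable
  have M0: "0 \<le> M x t" for x t unfolding M_def by (intro sum_nonneg mult_nonneg_nonneg \<beta>0) simp
  have "AE x in lebesgue. \<forall>i\<in>{1..N}. a i x = b i x"
    unfolding AE_ball_countable[OF countable_finite[OF finite_atLeastAtMost]] using b(3) by simp
  \<comment> \<open>One null set for all t, since the identity is used with the gradients of v and
    of every w m.\<close>
  then have aM: "AE x in lebesgue. \<forall>t. multi_phase N p q a x t = M x t"
  proof eventually_elim
    case (elim x)
    have "{..N} = insert 0 {1..N}" by auto
    then have "M x t = t powr p + (\<Sum>i=1..N. b i x * t powr q i)" for t
      unfolding M_def by (simp add: \<beta>_eq \<beta>0_eq)
    then show ?case using elim by (simp add: multi_phase_def)
  qed
  have energy_eq: "energy N p q a U' u S = (\<integral>\<^sup>+x. ennreal (M x (norm (f x))) * indicator S x \<partial>lborel)"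
    if "AE x in lebesgue_on S. weak_gradient U' u x = f x" and S: "S \<in> sets borel" for U' u S and f :: "'a \<Rightarrow> 'a"
  proof -
    have "AE x in lebesgue_on S. \<forall>t. multi_phase N p q a x t = M x t"
      by (rule AE_lebesgue_on_if[OF aM]) (use S in simp)
    then have "AE x in lebesgue_on S. ennreal (multi_phase N p q a x (norm (weak_gradient U' u x))) = ennreal (M x (norm (f x)))"
      using that(1) by eventually_elim simp
    then have "energy N p q a U' u S = (\<integral>\<^sup>+x. ennreal (M x (norm (f x))) \<partial>lebesgue_on S)"
      unfolding energy_def by (rule nn_integral_cong_AE)
    then show ?thesis by (simp add: nn_integral_lebesgue_on[OF S])
  qed
  have E_W: "(\<integral>\<^sup>+x. ennreal (M x (norm (G x))) * indicator W x \<partial>lborel) < \<infinity>"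
    using fin energy_eq[OF gG[unfolded g_def]] by (simp add: W_def)
  \<comment> \<open>A single phase is at most the sum of all of them, and almost everywhere off W it
    is 0 because G is.\<close>
  have \<beta>_fin: "(\<integral>\<^sup>+x. ennreal (norm (G x) powr \<sigma> i * \<beta> i x) \<partial>lborel) < \<infinity>" if i: "i \<le> N" for i
  proof -
    have "AE x in lborel. indicator W x *\<^sub>R g x = G x" using G by (simp add: AE_completion_iff)
    then have "AE x in lborel. ennreal (norm (G x) powr \<sigma> i * \<beta> i x) \<le> ennreal (M x (norm (G x))) * indicator W x"
    proof eventually_elim
      case (elim x)
      show ?case
      proof (cases "x \<in> W")
        case True
        have "\<beta> i x * norm (G x) powr \<sigma> i \<le> M x (norm (G x))"
          unfolding M_def using i \<beta>0 by (intro member_le_sum) auto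
        then show ?thesis using True by (simp add: mult.commute ennreal_leI)
      next
        case False
        then have "G x = 0" using elim by simp
        then show ?thesis by simp
      qed
    qed
    then have "(\<integral>\<^sup>+x. ennreal (norm (G x) powr \<sigma> i * \<beta> i x) \<partial>lborel) \<le> (\<integral>\<^sup>+x. ennreal (M x (norm (G x))) * indicator W x \<partial>lborel)"
      by (rule nn_integral_mono_AE)
    with E_W show ?thesis by (rule le_less_trans[rotated])
  qed

  have conv: "(\<lambda>m. \<integral>\<^sup>+x. ennreal (\<Phi> m x * \<beta> i x) * indicator U x \<partial>lborel) \<longlonglongrightarrow> 0"
    if i: "i \<le> N" and "\<And>m. \<Phi> m \<in> borel_measurable borel" and "AE x in lborel. (\<lambda>m. \<Phi> m x) \<longlonglongrightarrow> 0"
      and "c \<ge> 0" and "\<And>m x. \<Phi> m x \<le> c * (norm (Gm m x) powr \<sigma> i + norm (G x) powr \<sigma> i)" for i \<Phi> c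
  proof -
    obtain C where C: "C < \<infinity>" "\<And>m F. integrable lborel F \<Longrightarrow> (\<And>x. 0 \<le> F x) \<Longrightarrow>
      (\<integral>\<^sup>+x. ennreal (cube_avg (\<epsilon> m) F x powr \<sigma> i * \<beta> i x) \<partial>lborel)
        \<le> C * (\<integral>\<^sup>+x. ennreal (F x powr \<sigma> i * \<beta> i x) \<partial>lborel)"
      using \<beta>_bounded[OF i] by metis
    show ?thesis
      by (rule weighted_cube_avg_tendsto_0[OF \<sigma>[OF i] \<beta>m \<beta>0 C(2) C(1) \<epsilon> Gi \<beta>_fin[OF i] _ \<beta>_loc[OF i] that(2,3,4)])
         (use that(5) in \<open>auto simp: Gm_def\<close>)
  qed

  define E where "E = (\<integral>\<^sup>+x. ennreal (M x (norm (G x))) * indicator U x \<partial>lborel)"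
  define Em where "Em m = (\<integral>\<^sup>+x. ennreal (M x (norm (Gm m x))) * indicator U x \<partial>lborel)" for m
  define \<Delta> where "\<Delta> i m x = \<bar>norm (Gm m x) powr \<sigma> i - norm (G x) powr \<sigma> i\<bar>" for i m x
  \<comment> \<open>Bounds the change of energy between G and its average phase by phase. As
    \<Delta> is symmetric in the two, it serves both sides of the squeeze.\<close>
  define D where "D m = (\<Sum>i\<le>N. \<integral>\<^sup>+x. ennreal (\<Delta> i m x * \<beta> i x) * indicator U x \<partial>lborel)" for m
  have [measurable]: "\<Delta> i m \<in> borel_measurable borel" for i m unfolding \<Delta>_def[abs_def] by measurable
  have "(\<lambda>m. \<integral>\<^sup>+x. ennreal (\<Delta> i m x * \<beta> i x) * indicator U x \<partial>lborel) \<longlonglongrightarrow> 0" if i: "i \<le> N" for i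
  proof (rule conv[of i "\<Delta> i" 1, OF i])
    show "AE x in lborel. (\<lambda>m. \<Delta> i m x) \<longlonglongrightarrow> 0"
      using GmG
    proof eventually_elim
      case (elim x)
      have "(\<lambda>m. norm (Gm m x) powr \<sigma> i) \<longlonglongrightarrow> norm (G x) powr \<sigma> i"
        using \<sigma>[OF i] by (intro tendsto_powr2 tendsto_norm elim tendsto_const) auto
      then show ?case unfolding \<Delta>_def by (intro tendsto_rabs_zero) (rule LIM_zero)
    qed
    show "\<Delta> i m x \<le> 1 * (norm (Gm m x) powr \<sigma> i + norm (G x) powr \<sigma> i)" for m x
      by (simp add: \<Delta>_def abs_le_iff)
  qed auto
  then have "D \<longlonglongrightarrow> (\<Sum>i\<le>N. 0)" unfolding D_def by (intro tendsto_sum) auto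
  then have D0: "D \<longlonglongrightarrow> 0" by simp
  have compare: "(\<integral>\<^sup>+x. ennreal (M x (norm (f x))) * indicator U x \<partial>lborel)
      \<le> (\<integral>\<^sup>+x. ennreal (M x (norm (h x))) * indicator U x \<partial>lborel) + D m"
    if [measurable]: "f \<in> borel_measurable borel" "h \<in> borel_measurable borel"
      and fh: "\<And>i x. norm (f x) powr \<sigma> i \<le> norm (h x) powr \<sigma> i + \<Delta> i m x" for f h :: "'a \<Rightarrow> 'a" and m
  proof -
    have "ennreal (M x (norm (f x))) * indicator U x
        \<le> ennreal (M x (norm (h x))) * indicator U x + (\<Sum>i\<le>N. ennreal (\<Delta> i m x * \<beta> i x) * indicator U x)" for x
    proof -
      have "M x (norm (f x)) \<le> (\<Sum>i\<le>N. \<beta> i x * (norm (h x) powr \<sigma> i + \<Delta> i m x))"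
        unfolding M_def by (intro sum_mono mult_left_mono fh \<beta>0)
      also have "\<dots> = M x (norm (h x)) + (\<Sum>i\<le>N. \<Delta> i m x * \<beta> i x)"
        by (simp add: M_def distrib_left sum.distrib mult.commute)
      finally have "ennreal (M x (norm (f x))) \<le> ennreal (M x (norm (h x)) + (\<Sum>i\<le>N. \<Delta> i m x * \<beta> i x))"
        by (rule ennreal_leI)
      also have "\<dots> = ennreal (M x (norm (h x))) + (\<Sum>i\<le>N. ennreal (\<Delta> i m x * \<beta> i x))"
        using M0 \<beta>0 by (simp add: \<Delta>_def sum_nonneg sum_ennreal)
      finally show ?thesis by (auto simp: indicator_def)
    qed
    then have "(\<integral>\<^sup>+x. ennreal (M x (norm (f x))) * indicator U x \<partial>lborel)
        \<le> (\<integral>\<^sup>+x. ennreal (M x (norm (h x))) * indicator U x + (\<Sum>i\<le>N. ennreal (\<Delta> i m x * \<beta> i x) * indicator U x) \<partial>lborel)"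
      by (rule nn_integral_mono)
    also have "\<dots> = (\<integral>\<^sup>+x. ennreal (M x (norm (h x))) * indicator U x \<partial>lborel) + D m"
      unfolding D_def by (subst nn_integral_sum[symmetric]; (subst nn_integral_add)?) auto
    finally show ?thesis .
  qed
  have "E \<le> (\<integral>\<^sup>+x. ennreal (M x (norm (G x))) * indicator W x \<partial>lborel)"
    unfolding E_def using subs(1) by (intro nn_integral_mono) (auto simp: indicator_def)
  with E_W have "E < \<infinity>" by (rule le_less_trans[rotated])
  then have "Em \<longlonglongrightarrow> E"
    unfolding E_def Em_def
    by (intro nn_integral_squeeze_tendsto[OF _ _ D0] compare) (auto simp: \<Delta>_def)
  moreover have "energy N p q a U (w m) U = Em m" for m
    unfolding Em_def by (rule energy_eq[OF wgw]) simp
  moreover have "energy N p q a \<Omega> v U = E"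
    unfolding E_def by (rule energy_eq[OF gGU[unfolded g_def]]) simp
  ultimately have energies: "(\<lambda>m. energy N p q a U (w m) U) \<longlonglongrightarrow> energy N p q a \<Omega> v U" by simp

  define I where "I = (\<integral>\<^sup>+x. ennreal (norm (G x) powr p) \<partial>lborel)"
  have I: "I < \<infinity>" using \<beta>_fin[of 0] by (simp add: I_def \<beta>0_eq)
  define A where "A m = (\<integral>\<^sup>+x. ennreal (\<bar>w m x - V x\<bar> powr p) * indicator U x \<partial>lborel)" for m
  define B where "B m = (\<integral>\<^sup>+x. ennreal (norm (Gm m x - G x) powr p) * indicator U x \<partial>lborel)" for m
  have A: "A m \<le> ennreal ((\<epsilon> m * n) powr p) * I" for m
    unfolding A_def I_def w_def n_def by (rule cube_avg_minus_Lp[OF VG U p \<epsilon> inside])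
  have "(\<lambda>m. I * ennreal ((\<epsilon> m * n) powr p)) \<longlonglongrightarrow> I * ennreal 0"
  proof (intro ennreal_tendsto_cmult tendsto_ennrealI)
    have "(\<lambda>m. \<epsilon> m * n) \<longlonglongrightarrow> 0 * n" by (intro tendsto_mult \<epsilon>0 tendsto_const)
    then show "(\<lambda>m. (\<epsilon> m * n) powr p) \<longlonglongrightarrow> 0"
      using p \<epsilon> n by (intro tendsto_zero_powrI[of _ _ "\<lambda>_. p" p]) (auto simp: less_imp_le)
  qed (use I in auto)
  then have A0: "A \<longlonglongrightarrow> 0"
    by (intro tendsto_sandwich[of "\<lambda>_. 0" A sequentially "\<lambda>m. I * ennreal ((\<epsilon> m * n) powr p)"])
       (auto simp: A mult.commute[of I])
  have B0: "B \<longlonglongrightarrow> 0"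
  proof -
    have "(\<lambda>m. \<integral>\<^sup>+x. ennreal (norm (Gm m x - G x) powr p * \<beta> 0 x) * indicator U x \<partial>lborel) \<longlonglongrightarrow> 0"
    proof (rule conv[of 0 "\<lambda>m x. norm (Gm m x - G x) powr p" "2 powr p"])
      show "AE x in lborel. (\<lambda>m. norm (Gm m x - G x) powr p) \<longlonglongrightarrow> 0"
        using GmG
      proof eventually_elim
        case (elim x)
        have "(\<lambda>m. norm (Gm m x - G x)) \<longlonglongrightarrow> 0"
          using tendsto_norm_zero[OF LIM_zero[OF elim]] .
        then show ?case using p by (intro tendsto_zero_powrI[of _ _ "\<lambda>_. p" p]) auto
      qed
      show "norm (Gm m x - G x) powr p \<le> 2 powr p * (norm (Gm m x) powr \<sigma> 0 + norm (G x) powr \<sigma> 0)" for m x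
      proof -
        have "norm (Gm m x - G x) powr p \<le> (norm (Gm m x) + norm (G x)) powr p"
          using p by (intro powr_mono2 norm_triangle_ineq4) auto
        also have "\<dots> \<le> 2 powr p * (norm (Gm m x) powr p + norm (G x) powr p)"
          using p by (intro add_powr_le) auto
        finally show ?thesis by (simp add: \<beta>0_eq)
      qed
    qed auto
    then show ?thesis unfolding B_def by (simp add: \<beta>0_eq)
  qed

  have fin_bd: "(\<integral>\<^sup>+x. ennreal (norm (f x) powr p) * indicator U x \<partial>lborel) < \<infinity>"
    if "\<And>x. norm (f x) \<le> c" for f :: "'a \<Rightarrow> 'c::euclidean_space" and c
  proof -
    have "(\<integral>\<^sup>+x. ennreal (norm (f x) powr p) * indicator U x \<partial>lborel) \<le> (\<integral>\<^sup>+x. ennreal (c powr p) * indicator U x \<partial>lborel)"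
      using p that by (intro nn_integral_mono mult_right_mono ennreal_leI powr_mono2) auto
    also have "\<dots> = ennreal (c powr p) * emeasure lborel U" by (simp add: nn_integral_cmult_indicator)
    also have "\<dots> < \<infinity>" using emeasure_lborel_ball_finite[of y r] by (simp add: U_def ennreal_mult_less_top)
    finally show ?thesis .
  qed
  have w_Lp: "w m \<in> Lp p U" for m by (rule Lp_borel[OF _ _ fin_bd[OF wb]]) measurable
  have Gm_Lp: "Gm m \<in> Lp p U" for m by (rule Lp_borel[OF _ _ fin_bd[OF Gb]]) measurable
  \<comment> \<open>Local integrability of v says nothing about its p-th power. It is controlled
    through |V| \<le> |w 0| + |w 0 - V|: the first term is bounded, and \<open>A 0\<close> is finite
    by the estimate for averages.\<close>
  have "(\<integral>\<^sup>+x. ennreal (norm (V x) powr p) * indicator U x \<partial>lborel) < \<infinity>"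
  proof -
    have "(\<integral>\<^sup>+x. ennreal (norm (V x) powr p) * indicator U x \<partial>lborel)
        \<le> (\<integral>\<^sup>+x. ennreal (2 powr p) * (ennreal (norm (w 0 x) powr p) * indicator U x + ennreal (\<bar>w 0 x - V x\<bar> powr p) * indicator U x) \<partial>lborel)"
    proof (rule nn_integral_mono)
      fix x
      have "norm (V x) powr p \<le> (norm (w 0 x) + \<bar>w 0 x - V x\<bar>) powr p"
        using p by (intro powr_mono2) auto
      also have "\<dots> \<le> 2 powr p * (norm (w 0 x) powr p + \<bar>w 0 x - V x\<bar> powr p)"
        using p by (intro add_powr_le) auto
      finally have "ennreal (norm (V x) powr p) \<le> ennreal (2 powr p) * (ennreal (norm (w 0 x) powr p) + ennreal (\<bar>w 0 x - V x\<bar> powr p))"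
        by (simp add: ennreal_leI flip: ennreal_mult ennreal_plus)
      then show "ennreal (norm (V x) powr p) * indicator U x
        \<le> ennreal (2 powr p) * (ennreal (norm (w 0 x) powr p) * indicator U x + ennreal (\<bar>w 0 x - V x\<bar> powr p) * indicator U x)"
        by (auto simp: indicator_def)
    qed
    also have "\<dots> = ennreal (2 powr p) * ((\<integral>\<^sup>+x. ennreal (norm (w 0 x) powr p) * indicator U x \<partial>lborel) + A 0)"
      unfolding A_def by (simp add: nn_integral_cmult nn_integral_add)
    also have "\<dots> < \<infinity>"
    proof -
      have "A 0 < \<infinity>" using A[of 0] I by (auto simp: ennreal_mult_less_top intro: le_less_trans)
      with fin_bd[OF wb, of 0] show ?thesis by (simp add: ennreal_mult_less_top)
    qed
    finally show ?thesis .
  qed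
  then have V_Lp: "V \<in> Lp p U" by (intro Lp_borel) auto
  have G_Lp: "G \<in> Lp p U"
  proof (rule Lp_borel)
    have "(\<integral>\<^sup>+x. ennreal (norm (G x) powr p) * indicator U x \<partial>lborel) \<le> I"
      unfolding I_def by (intro nn_integral_mono) (auto simp: indicator_def)
    with I show "(\<integral>\<^sup>+x. ennreal (norm (G x) powr p) * indicator U x \<partial>lborel) < \<infinity>" by (rule le_less_trans[rotated])
  qed auto
  have sym: "AE x in lebesgue_on U. h x = f x" if "AE x in lebesgue_on U. f x = h x" for f h :: "'a \<Rightarrow> 'c"
    using that by eventually_elim simp
  have w_W1p: "w m \<in> W1p p U" for m
    using hw w_Lp Lp_AE_cong[OF Gm_Lp sym[OF wgw] Ul] by (auto simp: W1p_def W11_loc_def)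
  have v_W1p: "v \<in> W1p p U"
    using hv Lp_AE_cong[OF V_Lp sym[OF vV] Ul] Lp_AE_cong[OF G_Lp sym[OF wgv] Ul] by (auto simp: W1p_def W11_loc_def)
  have w_W1inf: "w m \<in> W1inf U" for m
  proof -
    have "w m \<in> Linf U" by (rule Linf_borel[OF _ wb]) measurable
    moreover have "Gm m \<in> Linf U" by (rule Linf_borel[OF _ Gb]) measurable
    ultimately show ?thesis
      using hw Linf_AE_cong[OF _ sym[OF wgw] Ul] by (auto simp: W1inf_def W11_loc_def)
  qed
  have norm_eq: "W1p_norm p U (\<lambda>x. w m x - v x) = (enn2real (A m) + enn2real (B m)) powr (1 / p)" for m
  proof -
    have "(\<integral>x. \<bar>w m x - v x\<bar> powr p \<partial>lebesgue_on U) = enn2real (A m)"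
      unfolding A_def
      by (rule integral_lebesgue_on_eq_enn2real) (use vV in \<open>auto elim: eventually_mono\<close>)
    moreover have "(\<integral>x. norm (weak_gradient U (\<lambda>x. w m x - v x) x) powr p \<partial>lebesgue_on U) = enn2real (B m)"
      unfolding B_def
      by (rule integral_lebesgue_on_eq_enn2real) (use wgd[of m] in \<open>auto elim: eventually_mono\<close>)
    ultimately show ?thesis by (simp add: W1p_norm_def)
  qed
  have "(\<lambda>m. enn2real (A m) + enn2real (B m)) \<longlonglongrightarrow> enn2real 0 + enn2real 0"
    using A0 B0 by (intro tendsto_add tendsto_enn2real) auto
  then have "(\<lambda>m. W1p_norm p U (\<lambda>x. w m x - v x)) \<longlonglongrightarrow> 0"
    unfolding norm_eq using p by (intro tendsto_zero_powrI[of _ _ "\<lambda>_. 1 / p" "1 / p"]) auto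
  with w_W1p v_W1p have "converges_W1p p U w v" by (simp add: converges_W1p_def)
  with w_W1inf energies show ?thesis unfolding U_def by blast
qed

theorem theorem3p2:
  fixes \<Omega> :: "(real ^ 'n) set"
    and N :: nat and p :: real and q :: "nat \<Rightarrow> real"
    and a :: "nat \<Rightarrow> real ^ 'n \<Rightarrow> real"
  assumes "CARD('n) \<ge> 2"
    and "open \<Omega>" and "bounded \<Omega>"
    and "N \<ge> 1"
    and "1 < p" and "p \<le> q 1" and "mono_on {1..N} q"
    and "\<forall>i\<in>{1..N}. \<forall>x. 0 \<le> a i x"
    and "\<forall>i\<in>{1..N}. a i \<in> muckenhoupt (q i)"
  shows "\<forall>v \<in> W11_loc \<Omega>. \<forall>y r z R.
    0 < r \<and> 0 < R \<and> ball y r \<Subset> ball z R \<and> ball z R \<Subset> \<Omega> \<and>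
    energy N p q a \<Omega> v (ball z R) < \<infinity> \<longrightarrow>
    (\<exists>w :: nat \<Rightarrow> real ^ 'n \<Rightarrow> real.
      (\<forall>m. w m \<in> W1inf (ball y r)) \<and>
      converges_W1p p (ball y r) w v \<and>
      (\<lambda>m. energy N p q a (ball y r) (w m) (ball y r)) \<longlonglongrightarrow> energy N p q a \<Omega> v (ball y r))"
proof (intro ballI allI impI, elim conjE)
  fix v y r z R
  assume v: "v \<in> W11_loc \<Omega>" "ball y r \<Subset> ball z R" "ball z R \<Subset> \<Omega>" "energy N p q a \<Omega> v (ball z R) < \<infinity>"
  \<comment> \<open>Monotonicity gives q i \<ge> q 1 \<ge> p > 1.\<close>
  have q: "q i > 1" if "i \<in> {1..N}" for i
    using that assms(4,5,6) monotone_onD[OF assms(7), of 1 i] by auto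
  show "\<exists>w. (\<forall>m. w m \<in> W1inf (ball y r)) \<and> converges_W1p p (ball y r) w v \<and>
      (\<lambda>m. energy N p q a (ball y r) (w m) (ball y r)) \<longlonglongrightarrow> energy N p q a \<Omega> v (ball y r)"
    by (rule multi_phase_approximation[OF assms(2,5) q _ v]) (use assms(9) in auto)
qed

end
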